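(* Let $d\ge1$ be an integer and let $q>0$. If $q<1$, then $$\inf\Big\{F_q(\Omega)\ :\ \Omega\text{ nonempty, bounded, convex and open in }\mathbb{R}^d\Big\}\ge C_d^-\big(d(d+2)\,\omega_d^{2/d}\big)^{1-q},$$ while if $q>1$, then $$\sup\Big\{F_q(\Omega)\ :\ \Omega\text{ nonempty, bounded, convex and open in }\mathbb{R}^d\Big\}\le C_d^+\big(d(d+2)\,\omega_d^{2/d}\big)^{1-q}.$$
   Context: $\omega_d$ is the Lebesgue measure of the unit ball of $\mathbb{R}^d$. For an open set $\Omega\subset\mathbb{R}^d$ with Lebesgue measure $0<|\Omega|<\infty$: $\lambda(\Omega)=\min\{\int_\Omega|\nabla u|^2dx\,/\int_\Omega u^2dx : u\in H^1_0(\Omega),\ u\ne0\}$ is the first eigenvalue of the Dirichlet Laplacian; $T(\Omega)=\int_\Omega w_\Omega\,dx$ is the torsional rigidity, where $w_\Omega\in H^1_0(\Omega)$ is the unique weak solution of $-\Delta w=1$ in $\Omega$. For $q>0$, $$F_q(\Omega)=\frac{\lambda(\Omega)\,T(\Omega)^q}{|\Omega|^{(dq+2q-2)/d}}.$$ In particular $F_1(\Omega)=\lambda(\Omega)T(\Omega)/|\Omega|$. The constants $C_d^-$ and $C_d^+$ are, respectively, the infimum and the supremum of $F_1(\Omega)$ over all nonempty bounded convex open sets $\Omega\subset\mathbb{R}^d$. *)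

theory Defs
  imports "HOL-Analysis.Analysis"
begin

text \<open>
  Only the values of a function on \<open>\<Omega>\<close> matter below: elements of \<open>L\<^sup>2(\<Omega>)\<close>, \<open>H\<^sup>1(\<Omega>)\<close>, \<dots> are
  represented by total functions, and all integrals are taken over \<open>lebesgue_on \<Omega>\<close>.
\<close>

subsection \<open>Test functions\<close>

primrec C_k :: "nat \<Rightarrow> ('a::euclidean_space \<Rightarrow> real) \<Rightarrow> bool" where
  "C_k 0 f \<longleftrightarrow> continuous_on UNIV f"
| "C_k (Suc k) f \<longleftrightarrow> (\<forall>x. f differentiable (at x)) \<and>
     (\<forall>b\<in>Basis. C_k k (\<lambda>x. frechet_derivative f (at x) b))"

definition test_functions :: "'a::euclidean_space set \<Rightarrow> ('a \<Rightarrow> real) set" where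
  "test_functions \<Omega> = {\<phi>. (\<forall>k. C_k k \<phi>) \<and>
     compact (closure {x. \<phi> x \<noteq> 0}) \<and> closure {x. \<phi> x \<noteq> 0} \<subseteq> \<Omega>}"

subsection \<open>Sobolev spaces\<close>

definition locally_integrable_on ::
    "('a::euclidean_space \<Rightarrow> 'b::euclidean_space) \<Rightarrow> 'a set \<Rightarrow> bool" where
  "locally_integrable_on f \<Omega> \<longleftrightarrow> (\<forall>K. compact K \<and> K \<subseteq> \<Omega> \<longrightarrow> integrable (lebesgue_on K) f)"

definition square_integrable_on ::
    "('a::euclidean_space \<Rightarrow> 'b::euclidean_space) \<Rightarrow> 'a set \<Rightarrow> bool" where
  "square_integrable_on f \<Omega> \<longleftrightarrow>
     f \<in> borel_measurable (lebesgue_on \<Omega>) \<and> integrable (lebesgue_on \<Omega>) (\<lambda>x. (norm (f x))\<^sup>2)"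

definition has_weak_gradient ::
    "('a::euclidean_space \<Rightarrow> real) \<Rightarrow> ('a \<Rightarrow> 'a) \<Rightarrow> 'a set \<Rightarrow> bool" where
  "has_weak_gradient u g \<Omega> \<longleftrightarrow> locally_integrable_on u \<Omega> \<and> locally_integrable_on g \<Omega> \<and>
     (\<forall>\<phi>\<in>test_functions \<Omega>. \<forall>b\<in>Basis.
        (LINT x|lebesgue_on \<Omega>. u x * frechet_derivative \<phi> (at x) b) =
        - (LINT x|lebesgue_on \<Omega>. (g x \<bullet> b) * \<phi> x))"

text \<open>For open \<open>\<Omega>\<close> the weak gradient is unique up to a null set; \<open>weak_grad\<close> picks a representative.\<close>

definition weak_grad :: "'a::euclidean_space set \<Rightarrow> ('a \<Rightarrow> real) \<Rightarrow> 'a \<Rightarrow> 'a" where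
  "weak_grad \<Omega> u = (SOME g. has_weak_gradient u g \<Omega>)"

definition H1 :: "'a::euclidean_space set \<Rightarrow> ('a \<Rightarrow> real) set" where
  "H1 \<Omega> = {u. square_integrable_on u \<Omega> \<and>
     (\<exists>g. has_weak_gradient u g \<Omega> \<and> square_integrable_on g \<Omega>)}"

definition H1_norm :: "'a::euclidean_space set \<Rightarrow> ('a \<Rightarrow> real) \<Rightarrow> real" where
  "H1_norm \<Omega> u = sqrt ((LINT x|lebesgue_on \<Omega>. (u x)\<^sup>2) +
     (LINT x|lebesgue_on \<Omega>. (norm (weak_grad \<Omega> u x))\<^sup>2))"

definition H10 :: "'a::euclidean_space set \<Rightarrow> ('a \<Rightarrow> real) set" where
  "H10 \<Omega> = {u \<in> H1 \<Omega>. \<exists>\<phi>. (\<forall>n::nat. \<phi> n \<in> test_functions \<Omega>) \<and>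
     (\<lambda>n. H1_norm \<Omega> (\<lambda>x. u x - \<phi> n x)) \<longlonglongrightarrow> 0}"

subsection \<open>First Dirichlet eigenvalue and torsional rigidity\<close>

text \<open>
  The minimum of the Rayleigh quotient, written as \<open>Inf\<close>: that the minimum is attained is a
  theorem about \<open>H10\<close>. The condition \<open>u \<noteq> 0\<close> is meant in \<open>L\<^sup>2(\<Omega>)\<close>.
\<close>

definition eigenvalue1 :: "'a::euclidean_space set \<Rightarrow> real" where
  "eigenvalue1 \<Omega> = (INF u\<in>{u \<in> H10 \<Omega>. \<not> (AE x in lebesgue_on \<Omega>. u x = 0)}.
     (LINT x|lebesgue_on \<Omega>. (norm (weak_grad \<Omega> u x))\<^sup>2) / (LINT x|lebesgue_on \<Omega>. (u x)\<^sup>2))"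

definition is_torsion_function :: "'a::euclidean_space set \<Rightarrow> ('a \<Rightarrow> real) \<Rightarrow> bool" where
  "is_torsion_function \<Omega> w \<longleftrightarrow> w \<in> H10 \<Omega> \<and>
     (\<forall>v\<in>H10 \<Omega>. (LINT x|lebesgue_on \<Omega>. weak_grad \<Omega> w x \<bullet> weak_grad \<Omega> v x) =
                (LINT x|lebesgue_on \<Omega>. v x))"

text \<open>The weak solution of \<open>-\<Delta>w = 1\<close> is unique only almost everywhere, hence \<open>SOME\<close>.\<close>

definition torsional_rigidity :: "'a::euclidean_space set \<Rightarrow> real" where
  "torsional_rigidity \<Omega> = (LINT x|lebesgue_on \<Omega>. (SOME w. is_torsion_function \<Omega> w) x)"

definition F :: "real \<Rightarrow> 'a::euclidean_space set \<Rightarrow> real" where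
  "F q \<Omega> = eigenvalue1 \<Omega> * torsional_rigidity \<Omega> powr q /
     measure lebesgue \<Omega> powr ((real DIM('a) * q + 2 * q - 2) / real DIM('a))"

definition convex_domains :: "'a::euclidean_space set set" where
  "convex_domains = {\<Omega>. \<Omega> \<noteq> {} \<and> bounded \<Omega> \<and> convex \<Omega> \<and> open \<Omega>}"

text \<open>
  Infima and suprema over domains are taken in the extended reals, so that they carry their
  usual meaning without any boundedness side condition.
\<close>

definition C_minus :: "'a::euclidean_space itself \<Rightarrow> ereal" where
  "C_minus _ = (INF \<Omega>\<in>(convex_domains :: 'a set set). ereal (F 1 \<Omega>))"

definition C_plus :: "'a::euclidean_space itself \<Rightarrow> ereal" where
  "C_plus _ = (SUP \<Omega>\<in>(convex_domains :: 'a set set). ereal (F 1 \<Omega>))"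

definition omega :: "'a::euclidean_space itself \<Rightarrow> real" where
  "omega _ = measure lebesgue (ball (0 :: 'a) 1)"

end

theory Submission
  imports Defs "HOL-Probability.Probability"
begin

text \<open>
  Since \<open>F\<^sub>q(\<Omega>) = F\<^sub>1(\<Omega>) (T(\<Omega>) / |\<Omega>|\<^bsup>(d+2)/d\<^esup>)\<^bsup>q-1\<^esup>\<close>, both claims follow from the Saint-Venant
  inequality: among sets of given measure the ball has the largest torsional rigidity. Let
  \<open>\<tau>\<close> be a triangular map that transports Lebesgue measure on \<open>\<Omega>\<close> to \<open>\<kappa>\<close> times Lebesgue measure on
  the unit ball. Its diagonal derivatives have product \<open>1/\<kappa>\<close>, so \<open>div \<tau> \<ge> d \<kappa>\<^bsup>-1/d\<^esup>\<close> by AM-GM, and for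
  \<open>\<phi> \<ge> 0\<close> with compact support in \<open>\<Omega>\<close>, integration by parts and Young's inequality give
  \<open>d \<kappa>\<^bsup>-1/d\<^esup> \<integral> \<phi> \<le> - \<integral> \<nabla>\<phi> \<bullet> \<tau> \<le> 1/2 \<integral> |\<nabla>\<phi>|\<^sup>2 + 1/2 \<kappa> \<integral> |y|\<^sup>2\<close> with the last integral over the unit ball.
  After rescaling \<open>\<phi>\<close> this bounds the torsion energy \<open>1/2 \<integral> |\<nabla>\<phi>|\<^sup>2 - \<integral> \<phi>\<close> from below by its value for the
  ball. A minimizing sequence of this energy converges to the torsion function \<open>w\<close>, whose energy
  is \<open>-T(\<Omega>)/2\<close>.
\<close>

subsection \<open>Transport on the line\<close>

text \<open>Transport takes the place of symmetrization, so that one-dimensional calculus and Fubini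
  carry the whole inequality. The obstacle is regularity: the diagonal derivatives of the triangular
  map are quotients of marginals, and marginals of indicators may vanish or jump. Both indicators
  are therefore approximated by positive continuous densities with Gaussian decay. Every
  one-dimensional map is then a C^1 bijection of the line, and the limit is taken only in the final
  estimate, never in the maps.

  The constants are those for which a ball gives equality. If \<open>\<Omega>\<close> is the ball of
  radius \<open>r\<close> at 0, then \<open>\<kappa> = r^d\<close>, the map is \<open>x / r\<close>,
  the torsion function is \<open>(r^2 - |x|^2) / (2 d)\<close>, and after multiplication by
  \<open>d / r = d \<kappa>^(-1/d)\<close> its gradient is exactly minus the map, which is the
  equality case of Young's inequality.

  With \<open>K = d (d + 2) \<omega>^(2/d)\<close> the result reads
  \<open>T / |\<Omega>|^((d+2)/d) \<le> 1 / K\<close>. The exponent \<open>q - 1\<close> changes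
  sign at \<open>q = 1\<close>, whence a lower bound for \<open>q < 1\<close> and an upper bound for
  \<open>q > 1\<close>.\<close>

lemma cumulative_integral:
  fixes f :: "real \<Rightarrow> real"
  assumes cont: "continuous_on UNIV f" and pos: "\<And>s. 0 < f s"
    and fin: "(\<integral>\<^sup>+s. ennreal (f s) \<partial>lborel) < \<infinity>"
  obtains F where "\<And>s. (F has_real_derivative f s) (at s)" "(F \<longlongrightarrow> 0) at_bot"
    "(F \<longlongrightarrow> enn2real (\<integral>\<^sup>+s. ennreal (f s) \<partial>lborel)) at_top"
proof -
  \<comment> \<open>The antiderivative is the distribution function of the measure with density
    \<open>f\<close>: its limits at both ends are then known, and only its increments have to be
    identified with integrals.\<close>
  define M where "M = density lborel (\<lambda>s. ennreal (f s))"
  have meas [measurable]: "f \<in> borel_measurable borel"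
    by (rule borel_measurable_continuous_onI[OF cont])
  have total: "emeasure M (space M) = (\<integral>\<^sup>+s. ennreal (f s) \<partial>lborel)"
    unfolding M_def by (subst emeasure_density) auto
  interpret finite_measure M
    by (rule finite_measureI) (use fin total in simp)
  interpret finite_borel_measure M
    by unfold_locales (simp add: M_def)
  have Ioc: "cdf M b - cdf M a = integral {a..b} f" if "a \<le> b" for a b
  proof -
    have ct: "continuous_on {a..b} f"
      by (rule continuous_on_subset[OF cont]) auto
    have si: "set_integrable lborel {a..b} f"
      by (rule borel_integrable_atLeastAtMost'[OF ct])
    have "ennreal (cdf M b - cdf M a) = emeasure M {a<..b}"
      using emeasure_Ioc[OF that] by simp
    also have "\<dots> = (\<integral>\<^sup>+s. ennreal (f s) * indicator {a<..b} s \<partial>lborel)"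
      unfolding M_def by (subst emeasure_density) auto
    also have "\<dots> = (\<integral>\<^sup>+s. ennreal (indicator {a..b} s * f s) \<partial>lborel)"
      by (intro nn_integral_cong_AE eventually_mono[OF AE_lborel_singleton[of a]])
         (auto simp: indicator_def)
    also have "\<dots> = ennreal (\<integral>s. indicator {a..b} s * f s \<partial>lborel)"
      by (rule nn_integral_eq_integral)
         (use si pos in \<open>auto simp: set_integrable_def less_imp_le\<close>)
    also have "(\<integral>s. indicator {a..b} s * f s \<partial>lborel) = integral {a..b} f"
      using set_borel_integral_eq_integral(2)[OF si] by (simp add: set_lebesgue_integral_def)
    finally show ?thesis
      using cdf_nondecreasing[OF that] integral_nonneg[OF integrable_continuous_real[OF ct]] pos
      by (auto simp: less_imp_le)
  qed
  have "(cdf M has_real_derivative f s) (at s)" for s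
  proof -
    have "((\<lambda>y. integral {s-1..y} f) has_real_derivative f s) (at s within {s-1..s+1})"
      by (rule integral_has_real_derivative) (use continuous_on_subset[OF cont] in auto)
    then have "((\<lambda>y. integral {s-1..y} f) has_real_derivative f s) (at s)"
      by (subst (asm) at_within_Icc_at) auto
    then have "((\<lambda>y. cdf M (s-1) + integral {s-1..y} f) has_real_derivative f s) (at s)"
      by (auto intro!: derivative_eq_intros)
    then show ?thesis
    proof (rule has_field_derivative_transform_within_open[of _ _ _ "{s-1<..}"])
      show "cdf M (s - 1) + integral {s - 1..x} f = cdf M x" if "x \<in> {s-1<..}" for x
        using Ioc[of "s-1" x] that by simp
    qed auto
  qed
  then show ?thesis
    using that[of "cdf M"] cdf_lim_at_bot cdf_lim_at_top total by (simp add: measure_def)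
qed

text \<open>Equating cumulative masses, \<open>G (\<tau> s) = F s\<close>, determines \<tau>,
  because both cumulative functions increase strictly onto the same open interval
  \<open>(0, m)\<close>; differentiating this equation gives the stated derivative. Surjectivity is
  recorded because the later change of variables has to cover the whole line.\<close>

lemma monotone_transport:
  fixes f g :: "real \<Rightarrow> real"
  assumes contf: "continuous_on UNIV f" and posf: "\<And>s. 0 < f s"
    and contg: "continuous_on UNIV g" and posg: "\<And>s. 0 < g s"
    and fin: "(\<integral>\<^sup>+s. ennreal (f s) \<partial>lborel) < \<infinity>"
    and eq: "(\<integral>\<^sup>+s. ennreal (f s) \<partial>lborel) = (\<integral>\<^sup>+s. ennreal (g s) \<partial>lborel)"
  obtains \<tau> where "\<And>s. (\<tau> has_real_derivative f s / g (\<tau> s)) (at s)" "surj \<tau>"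
proof -
  define m where "m = enn2real (\<integral>\<^sup>+s. ennreal (f s) \<partial>lborel)"
  obtain F where F: "\<And>s. (F has_real_derivative f s) (at s)" "(F \<longlongrightarrow> 0) at_bot" "(F \<longlongrightarrow> m) at_top"
    by (rule cumulative_integral[OF contf posf fin, folded m_def]) (rule that)
  obtain G where G: "\<And>s. (G has_real_derivative g s) (at s)" "(G \<longlongrightarrow> 0) at_bot" "(G \<longlongrightarrow> m) at_top"
    by (rule cumulative_integral[OF contg posg fin[unfolded eq], folded eq, folded m_def]) (rule that)
  have mono: "K x < K y" if K: "\<And>s. (K has_real_derivative k s) (at s)" "\<And>s. 0 < k s" and "x < y"
    for K k :: "real \<Rightarrow> real" and x y
    using DERIV_pos_imp_increasing[of x y K] that by blast
  have range: "0 < K x \<and> K x < m"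
    if K: "\<And>s. (K has_real_derivative k s) (at s)" "\<And>s. 0 < k s" "(K \<longlongrightarrow> 0) at_bot" "(K \<longlongrightarrow> m) at_top"
    for K k :: "real \<Rightarrow> real" and x
  proof
    \<comment> \<open>Passing to the limit gives only weak inequalities. Comparing \<open>x\<close>
      with \<open>x - 1\<close>, and below with \<open>x + 1\<close>, makes them strict.\<close>
    have "0 \<le> K (x - 1)"
      by (rule tendsto_upperbound[OF K(3)])
         (use mono[OF K(1,2)] in \<open>auto intro!: eventually_at_bot_linorderI[of "x-1"] simp: le_less\<close>)
    then show "0 < K x" using mono[OF K(1,2), of "x-1" x] by simp
    have "K (x + 1) \<le> m"
      by (rule tendsto_lowerbound[OF K(4)])
         (use mono[OF K(1,2)] in \<open>auto intro!: eventually_at_top_linorderI[of "x+1"] simp: le_less\<close>)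
    then show "K x < m" using mono[OF K(1,2), of x "x+1"] by simp
  qed
  have surj: "\<exists>x. K x = v"
    if K: "\<And>s. (K has_real_derivative k s) (at s)" "(K \<longlongrightarrow> 0) at_bot" "(K \<longlongrightarrow> m) at_top"
      and v: "0 < v" "v < m"
    for K k :: "real \<Rightarrow> real" and v
  proof -
    obtain a where a: "K a < v"
      using order_tendstoD(2)[OF K(2) v(1)] eventually_happens[of _ at_bot] by force
    obtain b where b: "v < K b"
      using order_tendstoD(1)[OF K(3) v(2)] eventually_happens[of _ at_top] by force
    have cK: "continuous_on S K" for S
      by (rule continuous_at_imp_continuous_on) (use K(1) DERIV_isCont in blast)
    show ?thesis
    proof (cases "a \<le> b")
      case True
      then show ?thesis using IVT'[of K a v b] a b cK by force
    next
      case False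
      then show ?thesis using IVT2'[of K a v b] a b cK by force
    qed
  qed
  have "\<exists>t. G t = F s" for s
    using surj[OF G(1) G(2,3)] range[OF F(1) posf F(2,3)] by blast
  then obtain \<tau> where \<tau>: "\<And>s. G (\<tau> s) = F s" by metis
  have G_inj: "x = y" if "G x = G y" for x y
    using mono[OF G(1) posg] that by (metis linorder_neq_iff)
  have "(\<tau> has_real_derivative f s / g (\<tau> s)) (at s)" for s
  proof -
    define H where "H = the_inv G"
    have HG: "H (G x) = x" for x
      unfolding H_def by (rule the_inv_f_f) (use G_inj in \<open>auto simp: inj_def\<close>)
    have GH: "G (H v) = v" if "0 < v" "v < m" for v
      using surj[OF G(1) G(2,3) that] HG by auto
    have "isCont H (G (\<tau> s))"
      by (rule isCont_inverse_function[where f=G and d=1]) (auto simp: HG intro: DERIV_isCont[OF G(1)])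
    moreover have r: "0 < G (\<tau> s)" "G (\<tau> s) < m"
      using range[OF G(1) posg G(2,3)] by auto
    \<comment> \<open>\<open>H\<close> inverts \<open>G\<close> on \<open>(0, m)\<close> only, so
      the inverse function rule is applied at a point that is known to be interior.\<close>
    ultimately have "DERIV H (G (\<tau> s)) :> inverse (g (\<tau> s))"
      by (intro DERIV_inverse_function[where f=G and a=0 and b=m])
         (use HG G(1) GH posg[of "\<tau> s"] in auto)
    then have "DERIV (\<lambda>s. H (F s)) s :> inverse (g (\<tau> s)) * f s"
      by (intro DERIV_chain2[OF _ F(1)]) (simp add: \<tau>)
    moreover have "H (F s) = \<tau> s" for s
      using HG[of "\<tau> s"] \<tau>[of s] by simp
    ultimately show ?thesis by (simp add: field_simps)
  qed
  moreover have "\<exists>s. \<tau> s = t" for t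
  proof -
    obtain s where "F s = G t"
      using surj[OF F(1) F(2,3), of "G t"] range[OF G(1) posg G(2,3)] by blast
    then show ?thesis using \<tau>[of s] G_inj by auto
  qed
  then have "surj \<tau>" unfolding surj_def by metis
  ultimately show ?thesis using that by blast
qed

text \<open>Lebesgue measure is determined by its values on intervals. The image under \<tau> of the
  measure with density \<tau>' gives \<open>(l, u)\<close> the right value, since the preimage is an
  interval \<open>(a, b)\<close> over which \<tau>' integrates to
  \<open>\<tau> b - \<tau> a\<close>.\<close>

lemma nn_integral_increasing_substitution:
  fixes \<tau> \<tau>' :: "real \<Rightarrow> real" and h :: "real \<Rightarrow> ennreal"
  assumes der: "\<And>s. (\<tau> has_real_derivative \<tau>' s) (at s)" and pos: "\<And>s. 0 < \<tau>' s"
    and surj: "surj \<tau>" and meas [measurable]: "\<tau>' \<in> borel_measurable borel" "h \<in> borel_measurable borel"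
  shows "(\<integral>\<^sup>+s. ennreal (\<tau>' s) * h (\<tau> s) \<partial>lborel) = (\<integral>\<^sup>+t. h t \<partial>lborel)"
proof -
  have mono: "\<tau> x < \<tau> y \<longleftrightarrow> x < y" for x y
  proof -
    have "\<tau> x < \<tau> y" if "x < y" for x y
      using DERIV_pos_imp_increasing[OF that, of \<tau>] der pos by blast
    then show ?thesis by (metis linorder_neq_iff order_less_asym)
  qed
  have m\<tau> [measurable]: "\<tau> \<in> borel_measurable borel"
    by (intro borel_measurable_continuous_onI continuous_at_imp_continuous_on)
       (use der DERIV_isCont in blast)
  have "lborel = distr (density lborel (\<lambda>s. ennreal (\<tau>' s))) borel \<tau>"
  proof (rule lborel_eqI)
    fix l u :: real
    assume "\<And>b. b \<in> Basis \<Longrightarrow> l \<bullet> b \<le> u \<bullet> b"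
    then have lu: "l \<le> u" by simp
    obtain a b where ab: "\<tau> a = l" "\<tau> b = u" using surj by (metis surjD)
    have "a \<le> b" using lu mono[of b a] ab by simp
    have "emeasure (distr (density lborel (\<lambda>s. ennreal (\<tau>' s))) borel \<tau>) (box l u) =
        (\<integral>\<^sup>+s. ennreal (\<tau>' s) * indicator (\<tau> -` {l<..<u}) s \<partial>lborel)"
      
      using m\<tau> by (subst emeasure_distr, simp, simp, subst emeasure_density) (use measurable_sets[OF m\<tau>, of "{l<..<u}"] in auto)
    also have "\<tau> -` {l<..<u} = {a<..<b}"
      using mono ab by auto
    also have "(\<integral>\<^sup>+s. ennreal (\<tau>' s) * indicator {a<..<b} s \<partial>lborel) =
        (\<integral>\<^sup>+s. ennreal (\<tau>' s) * indicator {a..b} s \<partial>lborel)"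
      by (intro nn_integral_cong_AE
            eventually_mono[OF eventually_conj[OF AE_lborel_singleton[of a] AE_lborel_singleton[of b]]])
         (auto simp: indicator_def)
    also have "\<dots> = ennreal (\<tau> b - \<tau> a)"
      by (rule nn_integral_FTC_Icc)
         (use der pos \<open>a \<le> b\<close> in \<open>auto simp: less_imp_le has_real_derivative_iff_has_vector_derivative[symmetric] intro: DERIV_subset\<close>)
    finally show "emeasure (distr (density lborel (\<lambda>s. ennreal (\<tau>' s))) borel \<tau>) (box l u) =
        ennreal (\<Prod>b\<in>Basis. (u - l) \<bullet> b)"
      using ab by simp
  qed simp
  then have "(\<integral>\<^sup>+t. h t \<partial>lborel) = (\<integral>\<^sup>+t. h t \<partial>distr (density lborel (\<lambda>s. ennreal (\<tau>' s))) borel \<tau>)"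
    by simp
  then show ?thesis
    by (simp add: nn_integral_distr nn_integral_density)
qed

text \<open>Integration by parts along a line, followed by Young's inequality on the support of \<open>u'\<close>.\<close>

lemma transport_line_inequality:
  fixes u u' \<tau> \<tau>' r :: "real \<Rightarrow> real"
  assumes u: "\<And>s. (u has_real_derivative u' s) (at s)" "continuous_on UNIV u'" "\<And>s. 0 \<le> u s"
    and \<tau>: "\<And>s. (\<tau> has_real_derivative \<tau>' s) (at s)" "continuous_on UNIV \<tau>'" "\<And>s. 0 < \<tau>' s"
    and r: "continuous_on UNIV r" "\<And>s. 0 < r s" "\<And>s. r s < 1 \<Longrightarrow> u' s = 0"
    and supp: "\<And>s. B < \<bar>s\<bar> \<Longrightarrow> u s = 0"
  shows "(\<integral>\<^sup>+s. ennreal (\<tau>' s * u s) \<partial>lborel) \<le>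
    (\<integral>\<^sup>+s. ennreal (1/2 * (u' s)\<^sup>2 + 1/2 * (\<tau> s)\<^sup>2 * r s) \<partial>lborel)"
proof -
  \<comment> \<open>The extra unit puts both endpoints outside the support, so that the boundary
    terms vanish, and the absolute value covers a negative \<open>B\<close>.\<close>
  define A where "A = \<bar>B\<bar> + 1"
  have [simp]: "- A \<le> A" "0 \<le> A" unfolding A_def by simp_all
  have out: "u s = 0" if "s \<notin> {-A<..<A}" for s
    by (rule supp) (use that in \<open>auto simp: A_def\<close>)
  have uc: "continuous_on S u" and tc: "continuous_on S \<tau>" for S
    by (rule continuous_at_imp_continuous_on, use u(1) \<tau>(1) DERIV_isCont in blast)+
  have cs: "continuous_on S u'" "continuous_on S \<tau>'" "continuous_on S r" for S
    using u(2) \<tau>(2) r(1) continuous_on_subset by blast+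
  let ?P = "\<lambda>s. \<tau>' s * u s" and ?Q = "\<lambda>s. 1/2 * (u' s)\<^sup>2 + 1/2 * (\<tau> s)\<^sup>2 * r s"
  have P: "continuous_on {-A..A} ?P" and Q: "continuous_on {-A..A} ?Q"
    and W: "continuous_on {-A..A} (\<lambda>s. \<tau> s * u' s)"
    by (intro continuous_intros uc tc cs)+
  have "((\<lambda>s. \<tau> s * u' s + \<tau>' s * u s) has_integral (\<tau> A * u A - \<tau> (-A) * u (-A))) {-A..A}"
    by (rule fundamental_theorem_of_calculus)
       (auto intro!: derivative_eq_intros u \<tau> DERIV_subset[OF u(1)] DERIV_subset[OF \<tau>(1)]
         simp: has_real_derivative_iff_has_vector_derivative[symmetric])
  moreover have "u A = 0" "u (-A) = 0" by (auto intro: out)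
  ultimately have 0: "integral {-A..A} (\<lambda>s. \<tau> s * u' s + \<tau>' s * u s) = 0"
    by (simp add: integral_unique)
  have "integral {-A..A} ?P \<le> integral {-A..A} (\<lambda>s. (\<tau> s * u' s + \<tau>' s * u s) + ?Q s)"
  proof (rule integral_le)
    fix s
    \<comment> \<open>Young's inequality produces the weight 1 in front of the square of \<tau>.
      Where \<open>r s \<ge> 1\<close> this weight may be enlarged to \<open>r s\<close>; elsewhere
      the left-hand side is 0.\<close>
    have "- (\<tau> s * u' s) \<le> ?Q s"
    proof (cases "r s < 1")
      case True
      then show ?thesis using r(3) r(2)[of s] by simp
    next
      case False
      have "0 \<le> (u' s + \<tau> s)\<^sup>2" by simp
      then have "- (\<tau> s * u' s) \<le> 1/2 * (u' s)\<^sup>2 + 1/2 * (\<tau> s)\<^sup>2 * 1"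
        by (simp add: power2_eq_square algebra_simps)
      also have "\<dots> \<le> ?Q s"
        by (intro add_left_mono mult_left_mono) (use False in auto)
      finally show ?thesis .
    qed
    then show "?P s \<le> (\<tau> s * u' s + \<tau>' s * u s) + ?Q s" by simp
  qed (intro integrable_continuous_real continuous_intros uc tc cs)+
  also have "\<dots> = integral {-A..A} (\<lambda>s. \<tau> s * u' s + \<tau>' s * u s) + integral {-A..A} ?Q"
    by (rule Henstock_Kurzweil_Integration.integral_add)
       (intro integrable_continuous_real continuous_intros uc tc cs)+
  finally have le: "integral {-A..A} ?P \<le> integral {-A..A} ?Q" using 0 by simp
  have nn: "(\<integral>\<^sup>+s. ennreal (indicator {-A..A} s * k s) \<partial>lborel) = ennreal (integral {-A..A} k)"
    if "continuous_on {-A..A} k" "\<And>s. 0 \<le> k s" for k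
  proof -
    have si: "set_integrable lborel {-A..A} k"
      by (rule borel_integrable_atLeastAtMost'[OF that(1)])
    have "(\<integral>\<^sup>+s. ennreal (indicator {-A..A} s * k s) \<partial>lborel) = ennreal (\<integral>s. indicator {-A..A} s * k s \<partial>lborel)"
      by (rule nn_integral_eq_integral) (use si that(2) in \<open>auto simp: set_integrable_def\<close>)
    then show ?thesis
      using set_borel_integral_eq_integral(2)[OF si] by (simp add: set_lebesgue_integral_def)
  qed
  have "(\<integral>\<^sup>+s. ennreal (?P s) \<partial>lborel) = (\<integral>\<^sup>+s. ennreal (indicator {-A..A} s * ?P s) \<partial>lborel)"
    by (intro nn_integral_cong) (use out in \<open>auto simp: indicator_def\<close>)
  also have "\<dots> = ennreal (integral {-A..A} ?P)"
    by (rule nn[OF P]) (use u(3) \<tau>(3) in \<open>auto simp: less_imp_le\<close>)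
  also have "\<dots> \<le> ennreal (integral {-A..A} ?Q)" using le by (rule ennreal_leI)
  also have "\<dots> = (\<integral>\<^sup>+s. ennreal (indicator {-A..A} s * ?Q s) \<partial>lborel)"
    by (rule nn[OF Q, symmetric]) (use r(2) in \<open>auto simp: less_imp_le\<close>)
  also have "\<dots> \<le> (\<integral>\<^sup>+s. ennreal (?Q s) \<partial>lborel)"
    by (intro nn_integral_mono ennreal_leI) (use r(2) in \<open>auto simp: indicator_def less_imp_le\<close>)
  finally show ?thesis .
qed

subsection \<open>Transport in coordinates\<close>

abbreviation PiL :: "'i set \<Rightarrow> ('i \<Rightarrow> real) measure" where
  "PiL I \<equiv> Pi\<^sub>M I (\<lambda>_. lborel)"

lemma space_PiL: "space (PiL I) = extensional I"
  by (auto simp: space_PiM PiE_def)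

lemma fun_upd_extensional: "x \<in> extensional I \<Longrightarrow> x(i := s) \<in> extensional (insert i I)"
  by (auto simp: extensional_def)

lemma measurable_slice:
  assumes "r \<in> borel_measurable (PiL (insert i I))"
  shows "(\<lambda>x. r (x(i := s))) \<in> borel_measurable (PiL I)"
  by (rule measurable_compose[OF measurable_fun_upd[where J=I and M="\<lambda>_. lborel" and I="insert i I"] assms]) auto

text \<open>
  Regularity is only asked along coordinate lines, so that it passes to slices and, by dominated
  convergence, to marginals.
\<close>

definition gauss_density :: "'i set \<Rightarrow> (('i \<Rightarrow> real) \<Rightarrow> real) \<Rightarrow> bool" where
  "gauss_density I r \<longleftrightarrow> r \<in> borel_measurable (PiL I) \<and>
    (\<exists>C. \<forall>x\<in>extensional I. 0 < r x \<and> r x \<le> C * (\<Prod>i\<in>I. exp (- (x i)\<^sup>2)) \<and>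
      (\<forall>i\<in>I. continuous_on UNIV (\<lambda>s. r (x(i := s)))))"

lemma gauss_density_slice:
  assumes r: "gauss_density (insert i I) r" and I: "finite I" "i \<notin> I"
  shows "gauss_density I (\<lambda>x. r (x(i := s)))"
proof -
  obtain C where C: "\<And>x. x \<in> extensional (insert i I) \<Longrightarrow> 0 < r x \<and>
      r x \<le> C * (\<Prod>i\<in>insert i I. exp (- (x i)\<^sup>2)) \<and>
      (\<forall>i\<in>insert i I. continuous_on UNIV (\<lambda>s. r (x(i := s))))"
    and m: "r \<in> borel_measurable (PiL (insert i I))"
    using r unfolding gauss_density_def by blast
  have "0 < r (x(i := s)) \<and> r (x(i := s)) \<le> C * exp (-s\<^sup>2) * (\<Prod>i\<in>I. exp (- (x i)\<^sup>2)) \<and>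
      (\<forall>j\<in>I. continuous_on UNIV (\<lambda>t. r (x(j := t, i := s))))" if x: "x \<in> extensional I" for x
  proof -
    have "(\<Prod>j\<in>I. exp (- ((x(i := s)) j)\<^sup>2)) = (\<Prod>j\<in>I. exp (- (x j)\<^sup>2))"
      using I by (intro prod.cong) auto
    moreover have "x(j := t, i := s) = x(i := s, j := t)" if "j \<in> I" for j t
      using that I by (metis fun_upd_twist)
    ultimately show ?thesis
      using C[OF fun_upd_extensional[OF x, of i s]] I by (auto simp: mult.assoc)
  qed
  then show ?thesis
    unfolding gauss_density_def using measurable_slice[OF m] by blast
qed

lemma gauss_density_scale:
  assumes "gauss_density I r" "0 < c"
  shows "gauss_density I (\<lambda>x. c * r x)"
proof -
  obtain C where C: "\<And>x. x \<in> extensional I \<Longrightarrow> 0 < r x \<and> r x \<le> C * (\<Prod>i\<in>I. exp (- (x i)\<^sup>2)) \<and>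
      (\<forall>i\<in>I. continuous_on UNIV (\<lambda>s. r (x(i := s))))"
    and m: "r \<in> borel_measurable (PiL I)"
    using assms unfolding gauss_density_def by blast
  have "0 < c * r x \<and> c * r x \<le> (c * C) * (\<Prod>i\<in>I. exp (- (x i)\<^sup>2)) \<and>
      (\<forall>i\<in>I. continuous_on UNIV (\<lambda>s. c * r (x(i := s))))" if "x \<in> extensional I" for x
    using C[OF that] \<open>0 < c\<close> by (auto simp: mult.assoc intro!: continuous_intros)
  then show ?thesis
    unfolding gauss_density_def using m by (auto intro!: borel_measurable_times)
qed

section \<open>Integrability, positivity and continuity of Gaussian-bounded densities and their
  marginals\<close>

lemma integrable_exp_minus_square: "integrable lborel (\<lambda>x::real. exp (- x\<^sup>2))"
proof -
  have "integrable lborel (\<lambda>x. sqrt pi * normal_density 0 (1 / sqrt 2) x)"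
    by (intro integrable_mult_right integrable_normal_density) simp
  also have "(\<lambda>x. sqrt pi * normal_density 0 (1 / sqrt 2) x) = (\<lambda>x::real. exp (- x\<^sup>2))"
    by (auto simp: normal_density_def fun_eq_iff power_divide)
  finally show ?thesis .
qed

lemma integrable_prod_exp_minus_square:
  "finite I \<Longrightarrow> integrable (PiL I) (\<lambda>x. \<Prod>i\<in>I. exp (- (x i)\<^sup>2))"
proof -
  interpret product_sigma_finite "\<lambda>_. lborel :: real measure" ..
  show "finite I \<Longrightarrow> integrable (PiL I) (\<lambda>x. \<Prod>i\<in>I. exp (- (x i)\<^sup>2))"
    by (rule product_integrable_prod) (auto intro: integrable_exp_minus_square)
qed

lemma gauss_density_integrable:
  assumes r: "gauss_density I r" and I: "finite I"
  shows "integrable (PiL I) r"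
proof -
  obtain C where C: "\<And>x. x \<in> extensional I \<Longrightarrow> 0 < r x \<and> r x \<le> C * (\<Prod>i\<in>I. exp (- (x i)\<^sup>2))"
    and m: "r \<in> borel_measurable (PiL I)"
    using r unfolding gauss_density_def by blast
  show ?thesis
  proof (rule Bochner_Integration.integrable_bound)
    show "integrable (PiL I) (\<lambda>x. C * (\<Prod>i\<in>I. exp (- (x i)\<^sup>2)))"
      by (intro integrable_mult_right integrable_prod_exp_minus_square I)
    show "AE x in PiL I. norm (r x) \<le> norm (C * (\<Prod>i\<in>I. exp (- (x i)\<^sup>2)))"
      using C by (intro AE_I2) (fastforce simp: space_PiL)
  qed (rule m)
qed

text \<open>A positive function with integral 0 would make the whole space a null set, whereas the
  unit cube has measure 1. This covers the empty index set too, where the cube is a single point of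
  mass 1.\<close>

lemma gauss_density_integral_pos:
  assumes r: "gauss_density I r" and I: "finite I"
  shows "0 < (\<integral>x. r x \<partial>PiL I)"
proof -
  interpret product_sigma_finite "\<lambda>_. lborel :: real measure" ..
  have pos: "0 < r x" if "x \<in> extensional I" for x
    using r that unfolding gauss_density_def by blast
  have m: "r \<in> borel_measurable (PiL I)"
    using r unfolding gauss_density_def by blast
  have "(\<integral>x. r x \<partial>PiL I) \<noteq> 0"
  proof
    assume "(\<integral>x. r x \<partial>PiL I) = 0"
    then have "AE x in PiL I. r x = 0"
      by (subst (asm) integral_nonneg_eq_0_iff_AE[OF gauss_density_integrable[OF r I]])
        (use pos in \<open>auto intro!: AE_I2 simp: space_PiL less_imp_le\<close>)
    then have "AE x in PiL I. False"
      by (rule AE_mp) (use pos in \<open>force simp: space_PiL intro!: AE_I2\<close>)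
    then have "space (PiL I) \<in> null_sets (PiL I)"
      by (simp add: AE_iff_null)
    moreover have box: "Pi\<^sub>E I (\<lambda>_. {0..1}) \<in> sets (PiL I)"
      using I by (intro sets_PiM_I_finite) auto
    ultimately have "Pi\<^sub>E I (\<lambda>_. {0..1}) \<in> null_sets (PiL I)"
      by (meson null_sets_subset sets.sets_into_space)
    moreover have "emeasure (PiL I) (Pi\<^sub>E I (\<lambda>_. {0..1})) = 1"
      using I by (subst emeasure_PiM) auto
    ultimately show False by auto
  qed
  moreover have "0 \<le> (\<integral>x. r x \<partial>PiL I)"
    by (intro Bochner_Integration.integral_nonneg) (use pos in \<open>auto simp: space_PiL less_imp_le\<close>)
  ultimately show ?thesis by simp
qed

text \<open>Dominated convergence. The majorant must not depend on the moving coordinate, so the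
  factor \<open>exp (- s^2)\<close> is estimated by 1; replacing \<open>C\<close> by its absolute
  value makes this legitimate for every sign of \<open>C\<close>.\<close>

lemma gauss_density_marginal_continuous:
  assumes r: "gauss_density (insert i I) r" and I: "finite I" "i \<notin> I"
  shows "continuous_on UNIV (\<lambda>s. \<integral>x. r (x(i := s)) \<partial>PiL I)"
proof -
  obtain C where C: "\<And>x. x \<in> extensional (insert i I) \<Longrightarrow> 0 < r x \<and>
      r x \<le> C * (\<Prod>i\<in>insert i I. exp (- (x i)\<^sup>2)) \<and>
      (\<forall>i\<in>insert i I. continuous_on UNIV (\<lambda>s. r (x(i := s))))"
    and m: "r \<in> borel_measurable (PiL (insert i I))"
    using r unfolding gauss_density_def by blast
  have bound: "0 < r (x(i := s)) \<and> r (x(i := s)) \<le> \<bar>C\<bar> * (\<Prod>i\<in>I. exp (- (x i)\<^sup>2))"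
    if x: "x \<in> extensional I" for x s
  proof -
    have "(\<Prod>j\<in>I. exp (- ((x(i := s)) j)\<^sup>2)) = (\<Prod>j\<in>I. exp (- (x j)\<^sup>2))"
      using I by (intro prod.cong) auto
    then have "0 < r (x(i := s)) \<and> r (x(i := s)) \<le> (C * exp (- s\<^sup>2)) * (\<Prod>i\<in>I. exp (- (x i)\<^sup>2))"
      using C[OF fun_upd_extensional[OF x, of i s]] I by (auto simp: mult.assoc)
    moreover have "(C * exp (- s\<^sup>2)) * (\<Prod>i\<in>I. exp (- (x i)\<^sup>2)) \<le> \<bar>C\<bar> * (\<Prod>i\<in>I. exp (- (x i)\<^sup>2))"
    proof (rule mult_right_mono)
      have "C * exp (- s\<^sup>2) \<le> \<bar>C\<bar> * exp (- s\<^sup>2)" by (rule mult_right_mono) auto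
      also have "\<dots> \<le> \<bar>C\<bar> * 1" by (rule mult_left_mono) auto
      finally show "C * exp (- s\<^sup>2) \<le> \<bar>C\<bar>" by simp
    qed (simp add: prod_nonneg)
    ultimately show ?thesis by linarith
  qed
  have "isCont (\<lambda>s. \<integral>x. r (x(i := s)) \<partial>PiL I) s" for s
    unfolding continuous_at_sequentially comp_def
  proof (intro allI impI)
    fix t :: "nat \<Rightarrow> real" assume t: "t \<longlonglongrightarrow> s"
    show "(\<lambda>n. \<integral>x. r (x(i := t n)) \<partial>PiL I) \<longlonglongrightarrow> (\<integral>x. r (x(i := s)) \<partial>PiL I)"
    proof (rule integral_dominated_convergence)
      show "integrable (PiL I) (\<lambda>x. \<bar>C\<bar> * (\<Prod>i\<in>I. exp (- (x i)\<^sup>2)))"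
        by (intro integrable_mult_right integrable_prod_exp_minus_square I)
      show "AE x in PiL I. norm (r (x(i := t n))) \<le> \<bar>C\<bar> * (\<Prod>i\<in>I. exp (- (x i)\<^sup>2))" for n
        using bound by (intro AE_I2) (auto simp: space_PiL abs_of_pos)
      show "AE x in PiL I. (\<lambda>n. r (x(i := t n))) \<longlonglongrightarrow> r (x(i := s))"
      proof (rule AE_I2)
        fix x assume "x \<in> space (PiL I)"
        then have "x(i := s) \<in> extensional (insert i I)"
          by (auto simp: space_PiL fun_upd_extensional)
        from C[OF this] have "continuous_on UNIV (\<lambda>u. r (x(i := u)))" by auto
        then show "(\<lambda>n. r (x(i := t n))) \<longlonglongrightarrow> r (x(i := s))"
          using t by (auto simp: continuous_on_eq_continuous_at continuous_at_sequentially comp_def)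
      qed
    qed (auto intro: measurable_slice[OF m])
  qed
  then show ?thesis by (simp add: continuous_on_eq_continuous_at)
qed

text \<open>The class of functions \<phi> for the induction on coordinates; \<open>u' i\<close> is
  the partial derivative in direction \<open>i\<close>. As for the densities, regularity along lines
  is what survives fixing a coordinate. One \<open>B\<close> bounds the support in all coordinates,
  so the intervals of integration are the same for all slices.\<close>

definition line_smooth ::
    "'i set \<Rightarrow> real \<Rightarrow> (('i \<Rightarrow> real) \<Rightarrow> real) \<Rightarrow> ('i \<Rightarrow> ('i \<Rightarrow> real) \<Rightarrow> real) \<Rightarrow> bool" where
  "line_smooth I B u u' \<longleftrightarrow> u \<in> borel_measurable (PiL I) \<and> (\<forall>i\<in>I. u' i \<in> borel_measurable (PiL I)) \<and>
    (\<forall>x\<in>extensional I. 0 \<le> u x \<and> (\<forall>i\<in>I. (B < \<bar>x i\<bar> \<longrightarrow> u x = 0) \<and>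
      continuous_on UNIV (\<lambda>s. u' i (x(i := s))) \<and>
      (\<forall>s. ((\<lambda>s. u (x(i := s))) has_real_derivative u' i (x(i := s))) (at s))))"

lemma line_smooth_slice:
  assumes u: "line_smooth (insert i I) B u u'" and I: "i \<notin> I"
  shows "line_smooth I B (\<lambda>x. u (x(i := s))) (\<lambda>j x. u' j (x(i := s)))"
proof -
  have "0 \<le> u (x(i := s)) \<and> (\<forall>j\<in>I. (B < \<bar>x j\<bar> \<longrightarrow> u (x(i := s)) = 0) \<and>
      continuous_on UNIV (\<lambda>t. u' j (x(j := t, i := s))) \<and>
      (\<forall>t. ((\<lambda>t. u (x(j := t, i := s))) has_real_derivative u' j (x(j := t, i := s))) (at t)))"
    if x: "x \<in> extensional I" for x
  proof -
    have tw: "x(j := t, i := s) = x(i := s, j := t)" if "j \<in> I" for j t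
      using that I by (metis fun_upd_twist)
    have ne: "j \<noteq> i" if "j \<in> I" for j using that I by auto
    have *: "0 \<le> u (x(i := s)) \<and> (\<forall>j\<in>insert i I. (B < \<bar>(x(i := s)) j\<bar> \<longrightarrow> u (x(i := s)) = 0) \<and>
      continuous_on UNIV (\<lambda>t. u' j (x(i := s, j := t))) \<and>
      (\<forall>t. ((\<lambda>t. u (x(i := s, j := t))) has_real_derivative u' j (x(i := s, j := t))) (at t)))"
      using u fun_upd_extensional[OF x, of i s] unfolding line_smooth_def by blast
    show ?thesis
    proof (intro conjI ballI)
      show "0 \<le> u (x(i := s))" using * by blast
      fix j assume j: "j \<in> I"
      show "B < \<bar>x j\<bar> \<longrightarrow> u (x(i := s)) = 0"
        using * j ne[OF j] by (metis fun_upd_other insertI2)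
      show "continuous_on UNIV (\<lambda>t. u' j (x(j := t, i := s)))"
        unfolding tw[OF j] using * j by blast
      show "\<forall>t. ((\<lambda>t. u (x(j := t, i := s))) has_real_derivative u' j (x(j := t, i := s))) (at t)"
        unfolding tw[OF j] using * j by blast
    qed
  qed
  moreover have "(\<lambda>x. u (x(i := s))) \<in> borel_measurable (PiL I)"
    "\<forall>j\<in>I. (\<lambda>x. u' j (x(i := s))) \<in> borel_measurable (PiL I)"
    using u unfolding line_smooth_def by (auto intro: measurable_slice)
  ultimately show ?thesis unfolding line_smooth_def by blast
qed

text \<open>
  The Knothe transport estimate, without the Knothe map: only the marginals in the coordinate \<open>i\<close>
  are transported, and the induction hypothesis is applied to the slices. The AM-GM inequality
  between the \<open>n\<close> partial derivatives enters in the form \<open>t \<ge> a + a ln (t / a)\<close> for each of them, with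
  one fixed parameter \<open>a\<close>; this makes the left-hand side additive in the induction.
  The factor of \<open>\<phi>\<close> may be negative, in which case \<open>ennreal\<close> truncates it to 0.
\<close>

lemma transport_inequality:
  fixes \<rho> \<sigma> \<phi> :: "('i \<Rightarrow> real) \<Rightarrow> real" and \<phi>' :: "'i \<Rightarrow> ('i \<Rightarrow> real) \<Rightarrow> real"
  assumes "finite I" "0 < a" "0 < \<kappa>"
    and "gauss_density I \<rho>" "gauss_density I \<sigma>"
    and "(\<integral>x. \<rho> x \<partial>PiL I) = (\<integral>x. \<sigma> x \<partial>PiL I)"
    and "\<And>x. x \<in> extensional I \<Longrightarrow> \<sigma> x \<le> \<kappa>"
    and "line_smooth I B \<phi> \<phi>'"
    and "\<And>x. x \<in> extensional I \<Longrightarrow> \<rho> x < 1 \<Longrightarrow> \<phi> x = 0 \<and> (\<forall>i\<in>I. \<phi>' i x = 0)"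
  shows "(\<integral>\<^sup>+x. ennreal ((real (card I) * (a - a * ln a) - a * ln \<kappa>) * \<phi> x) \<partial>PiL I) \<le>
    (\<integral>\<^sup>+x. ennreal (\<Sum>i\<in>I. 1/2 * (\<phi>' i x)\<^sup>2) \<partial>PiL I) +
    (\<integral>\<^sup>+x. ennreal (\<Sum>i\<in>I. 1/2 * (x i)\<^sup>2 * \<sigma> x) \<partial>PiL I)"
  using assms
proof (induction I arbitrary: \<kappa> \<rho> \<sigma> \<phi> \<phi>' rule: finite_induct)
  case empty
  let ?u = "\<lambda>_::'i. undefined :: real"
  interpret product_sigma_finite "\<lambda>_::'i. lborel :: real measure" ..
  have u: "?u \<in> extensional {}" by simp
  have eq: "\<rho> ?u = \<sigma> ?u"
    using empty(5) by (simp add: PiM_empty lebesgue_integral_count_space_finite)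
  \<comment> \<open>In dimension 0 the factor of \<phi> is \<open>- a * ln \<kappa>\<close>, and
    where \<phi> does not vanish \<open>1 \<le> \<rho> = \<sigma> \<le> \<kappa>\<close>, so the
    product is nonpositive.\<close>
  have "(0 - a * ln \<kappa>) * \<phi> ?u \<le> 0"
  proof (cases "\<rho> ?u < 1")
    case True
    then show ?thesis using empty(8)[OF u] by simp
  next
    case False
    then have "1 \<le> \<kappa>" using empty(6)[OF u] eq by simp
    moreover have "0 \<le> \<phi> ?u" using empty(7) u unfolding line_smooth_def by blast
    ultimately show ?thesis using \<open>0 < a\<close> by (simp add: mult_nonneg_nonneg)
  qed
  then show ?case by (simp add: PiM_empty nn_integral_count_space_finite ennreal_neg)
next
  case (insert i I)
  interpret product_sigma_finite "\<lambda>_::'i. lborel :: real measure" ..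
  have I: "finite I" "i \<notin> I" by fact+
  note Fub = product_nn_integral_insert[OF I] and Fub' = product_nn_integral_insert_rev[OF I]
  note g\<rho> = \<open>gauss_density (insert i I) \<rho>\<close> and g\<sigma> = \<open>gauss_density (insert i I) \<sigma>\<close>
    and ls = \<open>line_smooth (insert i I) B \<phi> \<phi>'\<close>
  have m [measurable]: "\<rho> \<in> borel_measurable (PiL (insert i I))" "\<sigma> \<in> borel_measurable (PiL (insert i I))"
     "\<phi> \<in> borel_measurable (PiL (insert i I))" and
    m' [measurable]: "\<And>j. j \<in> insert i I \<Longrightarrow> \<phi>' j \<in> borel_measurable (PiL (insert i I))"
    using g\<rho> g\<sigma> ls unfolding gauss_density_def line_smooth_def by blast+
  have m_i [measurable]: "\<phi>' i \<in> borel_measurable (PiL (insert i I))" by (rule m') simp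
  have m_j [measurable]: "\<And>j. j \<in> I \<Longrightarrow> \<phi>' j \<in> borel_measurable (PiL (insert i I))" by (rule m') simp
  have coord [measurable]: "(\<lambda>x. x j) \<in> borel_measurable (PiL (insert i I))" if "j \<in> insert i I" for j
    using measurable_component_singleton[OF that, of "\<lambda>_. lborel"] by simp
  have coord_i [measurable]: "(\<lambda>x. x i) \<in> borel_measurable (PiL (insert i I))" by (rule coord) simp
  have pos: "0 < \<rho> x" "0 < \<sigma> x" "0 \<le> \<phi> x" if "x \<in> extensional (insert i I)" for x
    using g\<rho> g\<sigma> ls that unfolding gauss_density_def line_smooth_def by blast+
  have in_ext: "x(i := s) \<in> extensional (insert i I)" if "x \<in> space (PiL I)" for x s
    using that by (auto simp: space_PiL fun_upd_extensional)
  define f where "f = (\<lambda>s. \<integral>x. \<rho> (x(i := s)) \<partial>PiL I)"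
  define g where "g = (\<lambda>s. \<integral>x. \<sigma> (x(i := s)) \<partial>PiL I)"
  have cf: "continuous_on UNIV f" and cg: "continuous_on UNIV g"
    unfolding f_def g_def by (rule gauss_density_marginal_continuous[OF _ I], fact)+
  have f_pos: "0 < f s" and g_pos: "0 < g s" for s
    unfolding f_def g_def by (rule gauss_density_integral_pos[OF gauss_density_slice[OF _ I] I(1)], fact)+
  have nnf: "(\<integral>\<^sup>+x. ennreal (\<rho> (x(i := s))) \<partial>PiL I) = ennreal (f s)" for s
    unfolding f_def
    by (rule nn_integral_eq_integral[OF gauss_density_integrable[OF gauss_density_slice[OF g\<rho> I] I(1)]])
       (use pos in_ext in \<open>auto intro!: AE_I2 simp: less_imp_le\<close>)
  have nng: "(\<integral>\<^sup>+x. ennreal (\<sigma> (x(i := s))) \<partial>PiL I) = ennreal (g s)" for s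
    unfolding g_def
    by (rule nn_integral_eq_integral[OF gauss_density_integrable[OF gauss_density_slice[OF g\<sigma> I] I(1)]])
       (use pos in_ext in \<open>auto intro!: AE_I2 simp: less_imp_le\<close>)
  have fI: "finite (insert i I)" using I by simp
  have massf: "(\<integral>\<^sup>+s. ennreal (f s) \<partial>lborel) = ennreal (\<integral>x. \<rho> x \<partial>PiL (insert i I))"
  proof -
    have "(\<integral>\<^sup>+s. ennreal (f s) \<partial>lborel) = (\<integral>\<^sup>+x. ennreal (\<rho> x) \<partial>PiL (insert i I))"
      by (subst Fub') (auto simp: nnf)
    also have "\<dots> = ennreal (\<integral>x. \<rho> x \<partial>PiL (insert i I))"
      by (rule nn_integral_eq_integral[OF gauss_density_integrable[OF g\<rho> fI]])
         (use pos in \<open>auto intro!: AE_I2 simp: less_imp_le space_PiL\<close>)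
    finally show ?thesis .
  qed
  have massg: "(\<integral>\<^sup>+s. ennreal (g s) \<partial>lborel) = ennreal (\<integral>x. \<sigma> x \<partial>PiL (insert i I))"
  proof -
    have "(\<integral>\<^sup>+s. ennreal (g s) \<partial>lborel) = (\<integral>\<^sup>+x. ennreal (\<sigma> x) \<partial>PiL (insert i I))"
      by (subst Fub') (auto simp: nng)
    also have "\<dots> = ennreal (\<integral>x. \<sigma> x \<partial>PiL (insert i I))"
      by (rule nn_integral_eq_integral[OF gauss_density_integrable[OF g\<sigma> fI]])
         (use pos in \<open>auto intro!: AE_I2 simp: less_imp_le space_PiL\<close>)
    finally show ?thesis .
  qed
  have fin: "(\<integral>\<^sup>+s. ennreal (f s) \<partial>lborel) < \<infinity>" unfolding massf by simp
  have eqm: "(\<integral>\<^sup>+s. ennreal (f s) \<partial>lborel) = (\<integral>\<^sup>+s. ennreal (g s) \<partial>lborel)"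
    unfolding massf massg using insert.prems by simp
  obtain \<tau> where d\<tau>: "\<And>s. (\<tau> has_real_derivative f s / g (\<tau> s)) (at s)" and surj: "surj \<tau>"
    by (rule monotone_transport[OF cf f_pos cg g_pos fin eqm]) (rule that)
  define \<tau>' where "\<tau>' = (\<lambda>s. f s / g (\<tau> s))"
  have d\<tau>': "(\<tau> has_real_derivative \<tau>' s) (at s)" and \<tau>'_pos: "0 < \<tau>' s" for s
    unfolding \<tau>'_def using d\<tau> f_pos g_pos by auto
  have \<tau>'_g: "f s = \<tau>' s * g (\<tau> s)" for s
    unfolding \<tau>'_def using g_pos[of "\<tau> s"] by simp
  have c\<tau>: "continuous_on UNIV \<tau>"
    by (rule continuous_at_imp_continuous_on) (use d\<tau> DERIV_isCont in blast)
  have c\<tau>': "continuous_on UNIV \<tau>'"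
    unfolding \<tau>'_def
    by (intro continuous_on_divide cf continuous_on_compose2[OF cg c\<tau>]) (use g_pos in \<open>auto simp: less_le\<close>)
  have [measurable]: "\<tau> \<in> borel_measurable borel" "\<tau>' \<in> borel_measurable borel" "g \<in> borel_measurable borel"
    using c\<tau> c\<tau>' cg by (auto intro: borel_measurable_continuous_onI)
  define N where "N = real (card I) * (a - a * ln a)"
  define m where "m = (\<lambda>t. \<integral>\<^sup>+x. ennreal (\<Sum>j\<in>I. 1/2 * (x j)\<^sup>2 * \<sigma> (x(i := t))) \<partial>PiL I)"

  \<comment> \<open>The identity \<open>f s = \<tau>' s * g (\<tau> s)\<close> says that the source
    slice at \<open>s\<close> has the same mass as \<open>\<tau>' s\<close> times the target slice
    at \<open>\<tau> s\<close>. This multiple is the target for the remaining coordinates, so its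
    upper bound becomes \<open>\<kappa> * \<tau>' s\<close>.\<close>
  have IH: "(\<integral>\<^sup>+x. ennreal ((N - a * ln (\<kappa> * \<tau>' s)) * \<phi> (x(i := s))) \<partial>PiL I) \<le>
      (\<integral>\<^sup>+x. ennreal (\<Sum>j\<in>I. 1/2 * (\<phi>' j (x(i := s)))\<^sup>2) \<partial>PiL I) + ennreal (\<tau>' s) * m (\<tau> s)" for s
  proof -
    have "(\<integral>\<^sup>+x. ennreal ((N - a * ln (\<kappa> * \<tau>' s)) * \<phi> (x(i := s))) \<partial>PiL I) \<le>
      (\<integral>\<^sup>+x. ennreal (\<Sum>j\<in>I. 1/2 * (\<phi>' j (x(i := s)))\<^sup>2) \<partial>PiL I) +
      (\<integral>\<^sup>+x. ennreal (\<Sum>j\<in>I. 1/2 * (x j)\<^sup>2 * (\<tau>' s * \<sigma> (x(i := \<tau> s)))) \<partial>PiL I)"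
      unfolding N_def
    proof (rule insert.IH)
      show "0 < a" by fact
      show "0 < \<kappa> * \<tau>' s" using \<open>0 < \<kappa>\<close> \<tau>'_pos by simp
      show "gauss_density I (\<lambda>x. \<rho> (x(i := s)))" by (rule gauss_density_slice[OF g\<rho> I])
      show "gauss_density I (\<lambda>x. \<tau>' s * \<sigma> (x(i := \<tau> s)))"
        by (rule gauss_density_scale[OF gauss_density_slice[OF g\<sigma> I] \<tau>'_pos])
      show "(\<integral>x. \<rho> (x(i := s)) \<partial>PiL I) = (\<integral>x. \<tau>' s * \<sigma> (x(i := \<tau> s)) \<partial>PiL I)"
        using \<tau>'_g[of s] unfolding f_def g_def by simp
      show "line_smooth I B (\<lambda>x. \<phi> (x(i := s))) (\<lambda>j x. \<phi>' j (x(i := s)))"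
        by (rule line_smooth_slice[OF ls I(2)])
      fix x :: "'i \<Rightarrow> real" assume x: "x \<in> extensional I"
      show "\<tau>' s * \<sigma> (x(i := \<tau> s)) \<le> \<kappa> * \<tau>' s"
        using mult_left_mono[OF insert.prems(6)[OF fun_upd_extensional[OF x, of i "\<tau> s"]], of "\<tau>' s"]
          \<tau>'_pos[of s] by (simp add: mult.commute fun_upd_def)
      show "\<phi> (x(i := s)) = 0 \<and> (\<forall>j\<in>I. \<phi>' j (x(i := s)) = 0)" if "\<rho> (x(i := s)) < 1"
        using insert.prems(8)[OF fun_upd_extensional[OF x] that] by blast
    qed
    also have "(\<integral>\<^sup>+x. ennreal (\<Sum>j\<in>I. 1/2 * (x j)\<^sup>2 * (\<tau>' s * \<sigma> (x(i := \<tau> s)))) \<partial>PiL I) =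
        (\<integral>\<^sup>+x. ennreal (\<tau>' s) * ennreal (\<Sum>j\<in>I. 1/2 * (x j)\<^sup>2 * \<sigma> (x(i := \<tau> s))) \<partial>PiL I)"
    proof (rule nn_integral_cong)
      fix x
      have "(\<Sum>j\<in>I. 1/2 * (x j)\<^sup>2 * (\<tau>' s * \<sigma> (x(i := \<tau> s)))) = \<tau>' s * (\<Sum>j\<in>I. 1/2 * (x j)\<^sup>2 * \<sigma> (x(i := \<tau> s)))"
        unfolding sum_distrib_left by (intro sum.cong refl mult.left_commute)
      then show "ennreal (\<Sum>j\<in>I. 1/2 * (x j)\<^sup>2 * (\<tau>' s * \<sigma> (x(i := \<tau> s)))) =
          ennreal (\<tau>' s) * ennreal (\<Sum>j\<in>I. 1/2 * (x j)\<^sup>2 * \<sigma> (x(i := \<tau> s)))"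
        by (simp only: ennreal_mult'[OF less_imp_le[OF \<tau>'_pos]])
    qed
    also have "\<dots> = ennreal (\<tau>' s) * m (\<tau> s)"
      unfolding m_def
    proof (rule nn_integral_cmult)
      have "(\<lambda>x. x j) \<in> borel_measurable (PiL I)" if "j \<in> I" for j
        using measurable_component_singleton[OF that, of "\<lambda>_. lborel"] by simp
      moreover have "(\<lambda>x. \<sigma> (x(i := \<tau> s))) \<in> borel_measurable (PiL I)"
        by (rule measurable_slice) (rule m)
      ultimately show "(\<lambda>x. ennreal (\<Sum>j\<in>I. 1/2 * (x j)\<^sup>2 * \<sigma> (x(i := \<tau> s)))) \<in> borel_measurable (PiL I)"
        by (intro measurable_compose[OF _ measurable_ennreal] borel_measurable_sum borel_measurable_times
          borel_measurable_power) auto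
    qed
    finally show ?thesis .
  qed

  have line: "(\<integral>\<^sup>+s. ennreal (\<tau>' s * \<phi> (x(i := s))) \<partial>lborel) \<le>
      (\<integral>\<^sup>+s. ennreal (1/2 * (\<phi>' i (x(i := s)))\<^sup>2 + 1/2 * (\<tau> s)\<^sup>2 * \<rho> (x(i := s))) \<partial>lborel)"
    if x: "x \<in> space (PiL I)" for x
  proof (rule transport_line_inequality[OF _ _ _ d\<tau>' c\<tau>' \<tau>'_pos])
    let ?y = "\<lambda>s. x(i := s)"
    have ls': "\<forall>y\<in>extensional (insert i I). 0 \<le> \<phi> y \<and> (B < \<bar>y i\<bar> \<longrightarrow> \<phi> y = 0) \<and>
      continuous_on UNIV (\<lambda>s. \<phi>' i (y(i := s))) \<and>
      (\<forall>s. ((\<lambda>s. \<phi> (y(i := s))) has_real_derivative \<phi>' i (y(i := s))) (at s))"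
      using ls unfolding line_smooth_def by blast
    note e = bspec[OF ls' in_ext[OF x, of undefined], simplified]
    show "((\<lambda>s. \<phi> (?y s)) has_real_derivative \<phi>' i (?y s)) (at s)" for s using e by blast
    show "continuous_on UNIV (\<lambda>s. \<phi>' i (?y s))" using e by blast
    show "0 \<le> \<phi> (?y s)" for s using pos(3)[OF in_ext[OF x]] by blast
    show "\<phi> (?y s) = 0" if "B < \<bar>s\<bar>" for s
      using bspec[OF ls' in_ext[OF x, of s]] that by simp
    have "\<forall>y\<in>extensional (insert i I). continuous_on UNIV (\<lambda>s. \<rho> (y(i := s)))"
      using g\<rho> unfolding gauss_density_def by blast
    from bspec[OF this in_ext[OF x, of undefined]]
    show "continuous_on UNIV (\<lambda>s. \<rho> (?y s))" by simp
    show "0 < \<rho> (?y s)" for s using pos(1)[OF in_ext[OF x]] by blast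
    show "\<phi>' i (?y s) = 0" if "\<rho> (?y s) < 1" for s
      using insert.prems(8)[OF in_ext[OF x] that] by blast
  qed

  let ?M = "PiL (insert i I)"
  \<comment> \<open>The slice estimates are integrated over \<open>s\<close>; the factor
    \<open>\<tau>' s\<close> of the last term is what the substitution \<open>t = \<tau> s\<close>
    needs to give back the full target \<sigma>.\<close>
  have step1: "(\<integral>\<^sup>+x. ennreal ((N - a * ln (\<kappa> * \<tau>' (x i))) * \<phi> x) \<partial>?M) \<le>
     (\<integral>\<^sup>+x. ennreal (\<Sum>j\<in>I. 1/2 * (\<phi>' j x)\<^sup>2) \<partial>?M) + (\<integral>\<^sup>+x. ennreal (\<Sum>j\<in>I. 1/2 * (x j)\<^sup>2 * \<sigma> x) \<partial>?M)"
  proof -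
    have [measurable]: "(\<lambda>x. ennreal (\<Sum>j\<in>I. 1/2 * (\<phi>' j x)\<^sup>2)) \<in> borel_measurable ?M"
      "(\<lambda>x. ennreal (\<Sum>j\<in>I. 1/2 * (x j)\<^sup>2 * \<sigma> x)) \<in> borel_measurable ?M"
      by (auto intro!: measurable_compose[OF _ measurable_ennreal] borel_measurable_sum
          borel_measurable_times borel_measurable_power m m_j coord)
    have upd: "(\<lambda>(s, x). x(i := s)) \<in> lborel \<Otimes>\<^sub>M PiL I \<rightarrow>\<^sub>M ?M"
      unfolding case_prod_beta'
      by (rule measurable_fun_upd[where J=I]) auto
    have mm: "(\<lambda>s. \<integral>\<^sup>+x. h (x(i := s)) \<partial>PiL I) \<in> borel_measurable lborel"
      if [measurable]: "h \<in> borel_measurable ?M" for h :: "_ \<Rightarrow> ennreal"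
    proof -
      interpret P: finite_product_sigma_finite "\<lambda>_::'i. lborel :: real measure" I by standard fact
      show ?thesis
        by (rule P.borel_measurable_nn_integral) (use measurable_compose[OF upd that] in \<open>simp add: case_prod_beta'\<close>)
    qed
    have m_eq: "m = (\<lambda>t. \<integral>\<^sup>+x. ennreal (\<Sum>j\<in>I. 1/2 * ((x(i := t)) j)\<^sup>2 * \<sigma> (x(i := t))) \<partial>PiL I)"
      unfolding m_def using I by (intro ext nn_integral_cong arg_cong[where f=ennreal] sum.cong) auto
    have [measurable]: "m \<in> borel_measurable borel"
      unfolding m_eq using mm[of "\<lambda>x. ennreal (\<Sum>j\<in>I. 1/2 * (x j)\<^sup>2 * \<sigma> x)"] by simp
    have "(\<integral>\<^sup>+x. ennreal ((N - a * ln (\<kappa> * \<tau>' (x i))) * \<phi> x) \<partial>?M) =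
        (\<integral>\<^sup>+s. (\<integral>\<^sup>+x. ennreal ((N - a * ln (\<kappa> * \<tau>' s)) * \<phi> (x(i := s))) \<partial>PiL I) \<partial>lborel)"
      by (subst Fub') auto
    also have "\<dots> \<le> (\<integral>\<^sup>+s. ((\<integral>\<^sup>+x. ennreal (\<Sum>j\<in>I. 1/2 * (\<phi>' j (x(i := s)))\<^sup>2) \<partial>PiL I) + ennreal (\<tau>' s) * m (\<tau> s)) \<partial>lborel)"
      by (rule nn_integral_mono) (rule IH)
    also have "\<dots> = (\<integral>\<^sup>+s. (\<integral>\<^sup>+x. ennreal (\<Sum>j\<in>I. 1/2 * (\<phi>' j (x(i := s)))\<^sup>2) \<partial>PiL I) \<partial>lborel) +
        (\<integral>\<^sup>+s. ennreal (\<tau>' s) * m (\<tau> s) \<partial>lborel)"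
      by (rule nn_integral_add) (use mm[of "\<lambda>x. ennreal (\<Sum>j\<in>I. 1/2 * (\<phi>' j x)\<^sup>2)"] in auto)
    also have "(\<integral>\<^sup>+s. ennreal (\<tau>' s) * m (\<tau> s) \<partial>lborel) = (\<integral>\<^sup>+t. m t \<partial>lborel)"
      by (rule nn_integral_increasing_substitution[OF d\<tau>' \<tau>'_pos surj]) auto
    also have "(\<integral>\<^sup>+t. m t \<partial>lborel) = (\<integral>\<^sup>+x. ennreal (\<Sum>j\<in>I. 1/2 * (x j)\<^sup>2 * \<sigma> x) \<partial>?M)"
      by (subst Fub') (auto simp: m_eq)
    also have "(\<integral>\<^sup>+s. (\<integral>\<^sup>+x. ennreal (\<Sum>j\<in>I. 1/2 * (\<phi>' j (x(i := s)))\<^sup>2) \<partial>PiL I) \<partial>lborel) =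
        (\<integral>\<^sup>+x. ennreal (\<Sum>j\<in>I. 1/2 * (\<phi>' j x)\<^sup>2) \<partial>?M)"
      by (subst Fub') auto
    finally show ?thesis .
  qed

  \<comment> \<open>Young's inequality in direction \<open>i\<close> leaves the square of
    \<open>\<tau> (x i)\<close> weighted by \<rho>. It depends on one coordinate only, so
    integrating out the others turns \<rho> into \<open>f\<close>, and the substitution
    \<open>t = \<tau> s\<close> turns the result into the second moment of \<sigma> in direction
    \<open>i\<close>.\<close>
  have step2: "(\<integral>\<^sup>+x. ennreal (\<tau>' (x i) * \<phi> x) \<partial>?M) \<le>
     (\<integral>\<^sup>+x. ennreal (1/2 * (\<phi>' i x)\<^sup>2) \<partial>?M) + (\<integral>\<^sup>+x. ennreal (1/2 * (x i)\<^sup>2 * \<sigma> x) \<partial>?M)"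
  proof -
    have "(\<integral>\<^sup>+x. ennreal (\<tau>' (x i) * \<phi> x) \<partial>?M) = (\<integral>\<^sup>+x. (\<integral>\<^sup>+s. ennreal (\<tau>' s * \<phi> (x(i := s))) \<partial>lborel) \<partial>PiL I)"
      by (subst Fub) auto
    also have "\<dots> \<le> (\<integral>\<^sup>+x. (\<integral>\<^sup>+s. ennreal (1/2 * (\<phi>' i (x(i := s)))\<^sup>2 + 1/2 * (\<tau> s)\<^sup>2 * \<rho> (x(i := s))) \<partial>lborel) \<partial>PiL I)"
      by (rule nn_integral_mono) (rule line)
    also have "\<dots> = (\<integral>\<^sup>+x. ennreal (1/2 * (\<phi>' i x)\<^sup>2 + 1/2 * (\<tau> (x i))\<^sup>2 * \<rho> x) \<partial>?M)"
      by (subst Fub) auto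
    also have "\<dots> = (\<integral>\<^sup>+x. (ennreal (1/2 * (\<phi>' i x)\<^sup>2) + ennreal (1/2 * (\<tau> (x i))\<^sup>2 * \<rho> x)) \<partial>?M)"
      by (intro nn_integral_cong ennreal_plus) (use pos(1) in \<open>auto simp: space_PiL less_imp_le\<close>)
    also have "\<dots> = (\<integral>\<^sup>+x. ennreal (1/2 * (\<phi>' i x)\<^sup>2) \<partial>?M) + (\<integral>\<^sup>+x. ennreal (1/2 * (\<tau> (x i))\<^sup>2 * \<rho> x) \<partial>?M)"
      by (rule nn_integral_add) auto
    also have "(\<integral>\<^sup>+x. ennreal (1/2 * (\<tau> (x i))\<^sup>2 * \<rho> x) \<partial>?M) =
        (\<integral>\<^sup>+s. (\<integral>\<^sup>+x. ennreal (1/2 * (\<tau> s)\<^sup>2) * ennreal (\<rho> (x(i := s))) \<partial>PiL I) \<partial>lborel)"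
      by (subst Fub') (auto intro!: nn_integral_cong simp flip: ennreal_mult')
    also have "\<dots> = (\<integral>\<^sup>+s. ennreal (\<tau>' s) * (ennreal (1/2 * (\<tau> s)\<^sup>2) * ennreal (g (\<tau> s))) \<partial>lborel)"
    proof (rule nn_integral_cong)
      fix s
      have "(\<integral>\<^sup>+x. ennreal (1/2 * (\<tau> s)\<^sup>2) * ennreal (\<rho> (x(i := s))) \<partial>PiL I) = ennreal (1/2 * (\<tau> s)\<^sup>2) * ennreal (f s)"
        unfolding nnf[symmetric]
        by (intro nn_integral_cmult measurable_compose[OF _ measurable_ennreal] measurable_slice m)
      also note \<tau>'_g[of s]
      finally show "(\<integral>\<^sup>+x. ennreal (1/2 * (\<tau> s)\<^sup>2) * ennreal (\<rho> (x(i := s))) \<partial>PiL I) =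
          ennreal (\<tau>' s) * (ennreal (1/2 * (\<tau> s)\<^sup>2) * ennreal (g (\<tau> s)))"
        using \<tau>'_pos[of s] by (simp add: ennreal_mult' less_imp_le mult_ac fun_upd_def)
    qed
    also have "\<dots> = (\<integral>\<^sup>+t. ennreal (1/2 * t\<^sup>2) * ennreal (g t) \<partial>lborel)"
      by (rule nn_integral_increasing_substitution[OF d\<tau>' \<tau>'_pos surj, where h="\<lambda>t. ennreal (1/2 * t\<^sup>2) * ennreal (g t)"]) auto
    also have "\<dots> = (\<integral>\<^sup>+t. (\<integral>\<^sup>+x. ennreal (1/2 * t\<^sup>2) * ennreal (\<sigma> (x(i := t))) \<partial>PiL I) \<partial>lborel)"
      unfolding nng[symmetric]
      by (intro nn_integral_cong nn_integral_cmult[symmetric] measurable_compose[OF _ measurable_ennreal] measurable_slice m)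
    also have "\<dots> = (\<integral>\<^sup>+x. ennreal (1/2 * (x i)\<^sup>2 * \<sigma> x) \<partial>?M)"
      by (subst Fub') (auto intro!: nn_integral_cong simp flip: ennreal_mult')
    finally show ?thesis .
  qed

  have "(\<integral>\<^sup>+x. ennreal ((real (card (insert i I)) * (a - a * ln a) - a * ln \<kappa>) * \<phi> x) \<partial>?M) \<le>
      (\<integral>\<^sup>+x. (ennreal ((N - a * ln (\<kappa> * \<tau>' (x i))) * \<phi> x) + ennreal (\<tau>' (x i) * \<phi> x)) \<partial>?M)"
  proof (rule nn_integral_mono)
    fix x assume "x \<in> space ?M"
    then have \<phi>: "0 \<le> \<phi> x" using pos(3) by (simp add: space_PiL)
    let ?t = "\<tau>' (x i)"
    have t: "0 < ?t" by (rule \<tau>'_pos)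
    \<comment> \<open>The slice estimate has lost \<open>a * ln ?t\<close>, since its parameter was
      \<open>\<kappa> * ?t\<close>. Adding \<open>?t\<close> compensates for this and gains
      \<open>a - a * ln a\<close>, the contribution of one more coordinate.\<close>
    have "ln (?t / a) \<le> ?t / a - 1" using t \<open>0 < a\<close> by (intro ln_le_minus_one) simp
    then have "a * (ln ?t - ln a) \<le> ?t - a"
      using t \<open>0 < a\<close> by (simp add: ln_div field_simps)
    then have "real (card (insert i I)) * (a - a * ln a) - a * ln \<kappa> \<le> (N - a * ln (\<kappa> * ?t)) + ?t"
      using t \<open>0 < \<kappa>\<close> I by (simp add: N_def ln_mult algebra_simps)
    then have "ennreal ((real (card (insert i I)) * (a - a * ln a) - a * ln \<kappa>) * \<phi> x) \<le>
        ennreal ((N - a * ln (\<kappa> * ?t)) * \<phi> x + ?t * \<phi> x)"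
      using \<phi> by (intro ennreal_leI) (simp add: mult_right_mono flip: distrib_right)
    \<comment> \<open>The first summand may be negative, and \<open>ennreal\<close> is additive on
      nonnegative numbers only; its positive part has the same image under
      \<open>ennreal\<close>.\<close>
    also have "\<dots> \<le> ennreal (max 0 ((N - a * ln (\<kappa> * ?t)) * \<phi> x) + ?t * \<phi> x)"
      by (intro ennreal_leI) simp
    also have "\<dots> = ennreal ((N - a * ln (\<kappa> * ?t)) * \<phi> x) + ennreal (?t * \<phi> x)"
      using t \<phi> by (subst ennreal_plus) (auto simp: max_def ennreal_neg)
    finally show "ennreal ((real (card (insert i I)) * (a - a * ln a) - a * ln \<kappa>) * \<phi> x) \<le>
        ennreal ((N - a * ln (\<kappa> * ?t)) * \<phi> x) + ennreal (?t * \<phi> x)" .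
  qed
  also have "\<dots> = (\<integral>\<^sup>+x. ennreal ((N - a * ln (\<kappa> * \<tau>' (x i))) * \<phi> x) \<partial>?M) + (\<integral>\<^sup>+x. ennreal (\<tau>' (x i) * \<phi> x) \<partial>?M)"
    by (rule nn_integral_add) auto
  also have "\<dots> \<le> ((\<integral>\<^sup>+x. ennreal (\<Sum>j\<in>I. 1/2 * (\<phi>' j x)\<^sup>2) \<partial>?M) + (\<integral>\<^sup>+x. ennreal (\<Sum>j\<in>I. 1/2 * (x j)\<^sup>2 * \<sigma> x) \<partial>?M)) +
     ((\<integral>\<^sup>+x. ennreal (1/2 * (\<phi>' i x)\<^sup>2) \<partial>?M) + (\<integral>\<^sup>+x. ennreal (1/2 * (x i)\<^sup>2 * \<sigma> x) \<partial>?M))"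
    by (rule add_mono[OF step1 step2])
  also have "\<dots> = ((\<integral>\<^sup>+x. ennreal (1/2 * (\<phi>' i x)\<^sup>2) \<partial>?M) + (\<integral>\<^sup>+x. ennreal (\<Sum>j\<in>I. 1/2 * (\<phi>' j x)\<^sup>2) \<partial>?M)) +
     ((\<integral>\<^sup>+x. ennreal (1/2 * (x i)\<^sup>2 * \<sigma> x) \<partial>?M) + (\<integral>\<^sup>+x. ennreal (\<Sum>j\<in>I. 1/2 * (x j)\<^sup>2 * \<sigma> x) \<partial>?M))"
    by (simp add: add_ac)
  also have "(\<integral>\<^sup>+x. ennreal (1/2 * (\<phi>' i x)\<^sup>2) \<partial>?M) + (\<integral>\<^sup>+x. ennreal (\<Sum>j\<in>I. 1/2 * (\<phi>' j x)\<^sup>2) \<partial>?M) =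
      (\<integral>\<^sup>+x. ennreal (\<Sum>j\<in>insert i I. 1/2 * (\<phi>' j x)\<^sup>2) \<partial>?M)"
    using I by (subst nn_integral_add[symmetric])
      (auto intro!: nn_integral_cong simp: sum_nonneg simp flip: ennreal_plus)
  also have "(\<integral>\<^sup>+x. ennreal (1/2 * (x i)\<^sup>2 * \<sigma> x) \<partial>?M) + (\<integral>\<^sup>+x. ennreal (\<Sum>j\<in>I. 1/2 * (x j)\<^sup>2 * \<sigma> x) \<partial>?M) =
      (\<integral>\<^sup>+x. ennreal (\<Sum>j\<in>insert i I. 1/2 * (x j)\<^sup>2 * \<sigma> x) \<partial>?M)"
  proof (subst nn_integral_add[symmetric])
    show "(\<lambda>x. ennreal (\<Sum>j\<in>I. 1/2 * (x j)\<^sup>2 * \<sigma> x)) \<in> borel_measurable ?M"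
      by (auto intro!: measurable_compose[OF _ measurable_ennreal] borel_measurable_sum
          borel_measurable_times borel_measurable_power m coord)
    show "(\<integral>\<^sup>+x. (ennreal (1/2 * (x i)\<^sup>2 * \<sigma> x) + ennreal (\<Sum>j\<in>I. 1/2 * (x j)\<^sup>2 * \<sigma> x)) \<partial>?M) =
      (\<integral>\<^sup>+x. ennreal (\<Sum>j\<in>insert i I. 1/2 * (x j)\<^sup>2 * \<sigma> x) \<partial>?M)"
    proof (rule nn_integral_cong)
      fix x assume "x \<in> space ?M"
      then have "0 \<le> \<sigma> x" using pos(2) by (simp add: space_PiL less_imp_le)
      then show "ennreal (1/2 * (x i)\<^sup>2 * \<sigma> x) + ennreal (\<Sum>j\<in>I. 1/2 * (x j)\<^sup>2 * \<sigma> x) =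
          ennreal (\<Sum>j\<in>insert i I. 1/2 * (x j)\<^sup>2 * \<sigma> x)"
        using I by (subst ennreal_plus[symmetric]) (auto intro!: sum_nonneg)
    qed
  qed auto
  finally show ?case .
qed

subsection \<open>The Saint-Venant inequality for smooth functions\<close>

abbreviation of_coords :: "('a \<Rightarrow> real) \<Rightarrow> 'a::euclidean_space" where
  "of_coords x \<equiv> \<Sum>b\<in>Basis. x b *\<^sub>R b"

lemma of_coords_measurable: "of_coords \<in> borel_measurable (PiL (Basis :: 'a::euclidean_space set))"
  by measurable

lemma of_coords_inner: "b \<in> Basis \<Longrightarrow> of_coords x \<bullet> b = x b"
  by (simp add: inner_sum_left_Basis)

lemma of_coords_upd:
  fixes x :: "'a::euclidean_space \<Rightarrow> real"
  assumes "b \<in> Basis"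
  shows "of_coords (x(b := s)) = of_coords x + (s - x b) *\<^sub>R b"
  by (rule euclidean_eqI)
     (use assms in \<open>auto simp: inner_sum_left_Basis inner_add_left inner_Basis\<close>)

lemma norm_sq_Basis: "(norm (y::'a::euclidean_space))\<^sup>2 = (\<Sum>b\<in>Basis. (y \<bullet> b)\<^sup>2)"
  unfolding power2_norm_eq_inner by (subst euclidean_inner) (simp add: power2_eq_square)

lemma norm_of_coords: "(norm (of_coords x :: 'a::euclidean_space))\<^sup>2 = (\<Sum>b\<in>Basis. (x b)\<^sup>2)"
  unfolding norm_sq_Basis by (intro sum.cong) (auto simp: of_coords_inner)

lemma exp_norm_of_coords:
  "exp (- (norm (of_coords x :: 'a::euclidean_space))\<^sup>2) = (\<Prod>b\<in>(Basis::'a set). exp (- (x b)\<^sup>2))"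
  unfolding norm_of_coords by (simp add: exp_sum sum_negf[symmetric])

lemma nn_integral_of_coords:
  fixes h :: "'a::euclidean_space \<Rightarrow> ennreal"
  assumes "h \<in> borel_measurable borel"
  shows "(\<integral>\<^sup>+x. h (of_coords x) \<partial>PiL Basis) = (\<integral>\<^sup>+y. h y \<partial>lborel)"
  by (subst lborel_eq) (simp add: nn_integral_distr assms)

lemma integral_of_coords:
  fixes h :: "'a::euclidean_space \<Rightarrow> real"
  assumes "h \<in> borel_measurable borel"
  shows "(\<integral>x. h (of_coords x) \<partial>PiL Basis) = (\<integral>y. h y \<partial>lborel)"
  by (subst lborel_eq) (simp add: integral_distr assms)

lemma integrable_exp_minus_norm_square:
  "integrable lborel (\<lambda>y::'a::euclidean_space. exp (- (norm y)\<^sup>2))"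
proof -
  have "integrable (distr (PiL Basis) borel of_coords) (\<lambda>y::'a. exp (- (norm y)\<^sup>2)) \<longleftrightarrow>
      integrable (PiL Basis) (\<lambda>x. exp (- (norm (of_coords x :: 'a))\<^sup>2))"
    by (rule integrable_distr_eq) measurable
  moreover have "integrable (PiL Basis) (\<lambda>x. exp (- (norm (of_coords x :: 'a))\<^sup>2))"
    unfolding exp_norm_of_coords by (intro integrable_prod_exp_minus_square) simp
  ultimately show ?thesis by (subst lborel_eq) simp
qed

lemma integrable_gauss_bound:
  fixes f :: "'a::euclidean_space \<Rightarrow> real"
  assumes "f \<in> borel_measurable borel" "\<And>y. \<bar>f y\<bar> \<le> C * exp (- (norm y)\<^sup>2)"
  shows "integrable lborel f"
proof (rule Bochner_Integration.integrable_bound)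
  show "integrable lborel (\<lambda>y::'a. C * exp (- (norm y)\<^sup>2))"
    by (intro integrable_mult_right integrable_exp_minus_norm_square)
  show "AE y in lborel. norm (f y) \<le> norm (C * exp (- (norm y)\<^sup>2))"
    using assms(2) by (intro AE_I2) (metis abs_ge_self order_trans real_norm_def)
qed (use assms in simp)

section \<open>Passage from coordinates to Euclidean space\<close>

lemma gauss_density_of_coords:
  fixes r :: "'a::euclidean_space \<Rightarrow> real"
  assumes cont: "continuous_on UNIV r" and pos: "\<And>y. 0 < r y"
    and bound: "\<And>y. r y \<le> C * exp (- (norm y)\<^sup>2)"
  shows "gauss_density Basis (\<lambda>x. r (of_coords x))"
  unfolding gauss_density_def
proof (intro conjI exI[of _ C] ballI)
  show "(\<lambda>x. r (of_coords x)) \<in> borel_measurable (PiL Basis)"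
    by (rule measurable_compose[OF of_coords_measurable borel_measurable_continuous_onI[OF cont]])
  fix x :: "'a \<Rightarrow> real"
  show "0 < r (of_coords x)" by (rule pos)
  show "r (of_coords x) \<le> C * (\<Prod>b\<in>Basis. exp (- (x b)\<^sup>2))"
    using bound[of "of_coords x"] by (simp only: exp_norm_of_coords)
  fix b :: 'a assume "b \<in> Basis"
  then show "continuous_on UNIV (\<lambda>s. r (of_coords (x(b := s))))"
    unfolding of_coords_upd[OF \<open>b \<in> Basis\<close>]
    by (intro continuous_on_compose2[OF cont] continuous_intros) auto
qed

lemma line_smooth_of_coords:
  fixes u :: "'a::euclidean_space \<Rightarrow> real"
  assumes u: "\<And>y. (u has_derivative (\<lambda>h. G y \<bullet> h)) (at y)" and G: "continuous_on UNIV G"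
    and nonneg: "\<And>y. 0 \<le> u y" and supp: "\<And>y. B < norm y \<Longrightarrow> u y = 0"
  shows "line_smooth Basis B (\<lambda>x. u (of_coords x)) (\<lambda>b x. G (of_coords x) \<bullet> b)"
proof -
  have cu: "continuous_on UNIV u"
    by (intro continuous_at_imp_continuous_on ballI has_derivative_continuous[OF u])
  have mu: "(\<lambda>x. u (of_coords x)) \<in> borel_measurable (PiL Basis)"
    by (rule measurable_compose[OF of_coords_measurable borel_measurable_continuous_onI[OF cu]])
  have mG: "(\<lambda>x. G (of_coords x) \<bullet> b) \<in> borel_measurable (PiL Basis)" for b
    by (rule measurable_compose[OF of_coords_measurable borel_measurable_continuous_onI])
       (intro continuous_intros G)
  have "u (of_coords x) = 0" if "B < \<bar>x b\<bar>" "b \<in> Basis" for x b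
  proof (rule supp)
    have "\<bar>x b\<bar> \<le> norm (of_coords x :: 'a)"
      using Basis_le_norm[OF that(2), of "of_coords x"] by (simp add: of_coords_inner that)
    then show "B < norm (of_coords x :: 'a)" using that by simp
  qed
  moreover have "continuous_on UNIV (\<lambda>s. G (of_coords (x(b := s))) \<bullet> b)" if "b \<in> Basis" for x b
    unfolding of_coords_upd[OF that]
    by (intro continuous_on_inner continuous_on_compose2[OF G] continuous_intros) auto
  moreover have "((\<lambda>s. u (of_coords (x(b := s)))) has_real_derivative G (of_coords (x(b := s))) \<bullet> b) (at s)"
    if "b \<in> Basis" for x b s
  proof -
    have "((\<lambda>s. of_coords x + (s - x b) *\<^sub>R b) has_derivative (\<lambda>h. h *\<^sub>R b)) (at s)"
      by (auto intro!: derivative_eq_intros)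
    then have "((\<lambda>s. u (of_coords x + (s - x b) *\<^sub>R b)) has_derivative
        (\<lambda>h. G (of_coords x + (s - x b) *\<^sub>R b) \<bullet> (h *\<^sub>R b))) (at s)"
      by (rule has_derivative_compose[OF _ u])
    moreover have "(\<lambda>h. G (of_coords x + (s - x b) *\<^sub>R b) \<bullet> (h *\<^sub>R b)) = (*) (G (of_coords x + (s - x b) *\<^sub>R b) \<bullet> b)"
      by (auto simp: fun_eq_iff)
    ultimately show ?thesis
      unfolding of_coords_upd[OF that] has_field_derivative_def by simp
  qed
  ultimately show ?thesis
    unfolding line_smooth_def using mu mG nonneg by blast
qed

text \<open>This is \<open>transport_inequality\<close> with real integrals. A negative coefficient
  is treated apart: truncation would lose the left-hand side, but then it is nonpositive anyway. The
  Gaussian bound on \<open>(norm y)^2 * \<sigma> y\<close> makes the second moment finite, so that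
  the extended integrals convert to real ones.\<close>

lemma euclidean_transport_inequality:
  fixes \<rho> \<sigma> u :: "'a::euclidean_space \<Rightarrow> real" and G :: "'a \<Rightarrow> 'a"
  assumes a: "0 < a" and \<kappa>: "0 < \<kappa>"
    and \<rho>: "continuous_on UNIV \<rho>" "\<And>y. 0 < \<rho> y" "\<And>y. \<rho> y \<le> C * exp (- (norm y)\<^sup>2)"
    and \<sigma>: "continuous_on UNIV \<sigma>" "\<And>y. 0 < \<sigma> y" "\<And>y. \<sigma> y \<le> D * exp (- (norm y)\<^sup>2)"
      "\<And>y. (norm y)\<^sup>2 * \<sigma> y \<le> D * exp (- (norm y)\<^sup>2)" "\<And>y. \<sigma> y \<le> \<kappa>"
    and mass: "(\<integral>y. \<rho> y \<partial>lborel) = (\<integral>y. \<sigma> y \<partial>lborel)"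
    and u: "\<And>y. (u has_derivative (\<lambda>h. G y \<bullet> h)) (at y)" "continuous_on UNIV G"
      "\<And>y. 0 \<le> u y" "\<And>y. B < norm y \<Longrightarrow> u y = 0"
    and small: "\<And>y. \<rho> y < 1 \<Longrightarrow> u y = 0 \<and> G y = 0"
    and int: "integrable lborel u" "integrable lborel (\<lambda>y. (norm (G y))\<^sup>2)"
  shows "(real DIM('a) * (a - a * ln a) - a * ln \<kappa>) * (\<integral>y. u y \<partial>lborel) \<le>
    1/2 * (\<integral>y. (norm (G y))\<^sup>2 \<partial>lborel) + 1/2 * (\<integral>y. (norm y)\<^sup>2 * \<sigma> y \<partial>lborel)"
proof -
  have cu: "continuous_on UNIV u"
    by (intro continuous_at_imp_continuous_on ballI has_derivative_continuous[OF u(1)])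
  have [measurable]: "\<rho> \<in> borel_measurable borel" "\<sigma> \<in> borel_measurable borel"
    "u \<in> borel_measurable borel" "G \<in> borel_measurable borel"
    using \<rho>(1) \<sigma>(1) cu u(2) by (auto intro: borel_measurable_continuous_onI)
  let ?c = "real DIM('a) * (a - a * ln a) - a * ln \<kappa>"
  have int\<sigma>: "integrable lborel (\<lambda>y. (norm y)\<^sup>2 * \<sigma> y)"
    by (rule integrable_gauss_bound[where C=D]) (use \<sigma> in \<open>auto simp: abs_mult less_imp_le abs_of_pos\<close>)
  show ?thesis
  proof (cases "0 \<le> ?c")
    case False
    then have "?c * (\<integral>y. u y \<partial>lborel) \<le> 0"
      by (intro mult_nonpos_nonneg Bochner_Integration.integral_nonneg) (use u(3) in auto)
    also have "0 \<le> 1/2 * (\<integral>y. (norm (G y))\<^sup>2 \<partial>lborel) + 1/2 * (\<integral>y. (norm y)\<^sup>2 * \<sigma> y \<partial>lborel)"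
      by (intro add_nonneg_nonneg mult_nonneg_nonneg Bochner_Integration.integral_nonneg)
         (use \<sigma>(2) in \<open>auto simp: less_imp_le\<close>)
    finally show ?thesis .
  next
    case True
    have "(\<integral>\<^sup>+x. ennreal (?c * u (of_coords x)) \<partial>PiL Basis) \<le>
      (\<integral>\<^sup>+x. ennreal (\<Sum>b\<in>Basis. 1/2 * (G (of_coords x) \<bullet> b)\<^sup>2) \<partial>PiL Basis) +
      (\<integral>\<^sup>+x. ennreal (\<Sum>b\<in>Basis. 1/2 * (x b)\<^sup>2 * \<sigma> (of_coords x)) \<partial>PiL (Basis :: 'a set))"
      by (rule transport_inequality[OF _ a \<kappa> gauss_density_of_coords[OF \<rho>]
            gauss_density_of_coords[OF \<sigma>(1-3)] _ _ line_smooth_of_coords[OF u]])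
         (use mass \<sigma>(5) small in \<open>auto simp: integral_of_coords\<close>)
    also have "(\<lambda>x. \<Sum>b\<in>Basis. 1/2 * (G (of_coords x) \<bullet> b)\<^sup>2) = (\<lambda>x. 1/2 * (norm (G (of_coords x)))\<^sup>2)"
      by (simp add: norm_sq_Basis[of "G _"] sum_divide_distrib)
    also have "(\<lambda>x. \<Sum>b\<in>Basis. 1/2 * (x b)\<^sup>2 * \<sigma> (of_coords x)) = (\<lambda>x. 1/2 * ((norm (of_coords x))\<^sup>2 * \<sigma> (of_coords x)))"
      unfolding norm_of_coords by (simp add: sum_distrib_right sum_divide_distrib)
    finally have "(\<integral>\<^sup>+y. ennreal (?c * u y) \<partial>lborel) \<le>
      (\<integral>\<^sup>+y. ennreal (1/2 * (norm (G y))\<^sup>2) \<partial>lborel) + (\<integral>\<^sup>+y. ennreal (1/2 * ((norm y)\<^sup>2 * \<sigma> y)) \<partial>lborel)"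
      using nn_integral_of_coords[of "\<lambda>y. ennreal (?c * u y)"]
        nn_integral_of_coords[of "\<lambda>y. ennreal (1/2 * (norm (G y))\<^sup>2)"]
        nn_integral_of_coords[of "\<lambda>y. ennreal (1/2 * ((norm y)\<^sup>2 * \<sigma> y))"] by simp
    moreover have "(\<integral>\<^sup>+y. ennreal (?c * u y) \<partial>lborel) = ennreal (\<integral>y. ?c * u y \<partial>lborel)"
      by (rule nn_integral_eq_integral) (use int True u(3) in auto)
    moreover have "(\<integral>\<^sup>+y. ennreal (1/2 * (norm (G y))\<^sup>2) \<partial>lborel) = ennreal (\<integral>y. 1/2 * (norm (G y))\<^sup>2 \<partial>lborel)"
      by (rule nn_integral_eq_integral) (use int in auto)
    moreover have "(\<integral>\<^sup>+y. ennreal (1/2 * ((norm y)\<^sup>2 * \<sigma> y)) \<partial>lborel) = ennreal (\<integral>y. 1/2 * ((norm y)\<^sup>2 * \<sigma> y) \<partial>lborel)"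
      by (rule nn_integral_eq_integral) (use int\<sigma> \<sigma>(2) in \<open>auto simp: less_imp_le\<close>)
    ultimately have "ennreal (?c * (\<integral>y. u y \<partial>lborel)) \<le>
        ennreal (1/2 * (\<integral>y. (norm (G y))\<^sup>2 \<partial>lborel)) + ennreal (1/2 * (\<integral>y. (norm y)\<^sup>2 * \<sigma> y \<partial>lborel))"
      by simp
    also have "\<dots> = ennreal (1/2 * (\<integral>y. (norm (G y))\<^sup>2 \<partial>lborel) + 1/2 * (\<integral>y. (norm y)\<^sup>2 * \<sigma> y \<partial>lborel))"
      by (intro ennreal_plus[symmetric] mult_nonneg_nonneg Bochner_Integration.integral_nonneg)
         (use \<sigma>(2) in \<open>auto simp: less_imp_le\<close>)
    finally show ?thesis
      by (subst (asm) ennreal_le_iff)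
         (auto intro!: add_nonneg_nonneg mult_nonneg_nonneg Bochner_Integration.integral_nonneg simp: \<sigma>(2) less_imp_le)
  qed
qed

section \<open>The second moment of the unit ball and smooth approximation of its indicator\<close>

lemma ball_second_moment:
  "(\<integral>y. (norm y)\<^sup>2 * indicator (ball (0::'a::euclidean_space) 1) y \<partial>lborel) =
    real DIM('a) / (real DIM('a) + 2) * measure lborel (ball (0::'a) 1)"
proof -
  let ?d = "DIM('a)" and ?\<omega> = "unit_ball_vol (real DIM('a))"
  \<comment> \<open>This is the integral of \<open>1 - |y|^2\<close> over the unit ball. That
    function is the integral of \<open>2 r\<close> over \<open>|y| \<le> r \<le> 1\<close>, so
    exchanging the integrals leaves the integral of \<open>2 r * \<omega> r^d\<close> over
    \<open>[0, 1]\<close>.\<close>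
  let ?c = "2 * ?\<omega> / (real ?d + 2)"
  have emc: "emeasure lborel (cball (0::'a) r) = ennreal (?\<omega> * r ^ ?d)" if "0 \<le> r" for r
    using emeasure_cball[OF that, of "0::'a"] by simp
  have "(\<integral>\<^sup>+(y::'a). ennreal ((1 - (norm y)\<^sup>2) * indicator (cball 0 1) y) \<partial>lborel) =
    (\<integral>\<^sup>+(y::'a). (\<integral>\<^sup>+r. ennreal (2 * r) * indicator {0..1} r * indicator (cball 0 r) y \<partial>lborel) \<partial>lborel)"
  proof (rule nn_integral_cong)
    fix y :: 'a
    show "ennreal ((1 - (norm y)\<^sup>2) * indicator (cball 0 1) y) =
        (\<integral>\<^sup>+r. ennreal (2 * r) * indicator {0..1} r * indicator (cball 0 r) y \<partial>lborel)"
    proof (cases "norm y \<le> 1")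
      case True
      have "(\<integral>\<^sup>+r. ennreal (2 * r) * indicator {0..1} r * indicator (cball 0 r) y \<partial>lborel) =
          (\<integral>\<^sup>+r. ennreal (2 * r) * indicator {norm y..1} r \<partial>lborel)"
        by (intro nn_integral_cong) (auto simp: indicator_def dest: order_trans[OF norm_ge_zero])
      also have "\<dots> = ennreal (1\<^sup>2 - (norm y)\<^sup>2)"
        by (rule nn_integral_FTC_Icc[where F="\<lambda>r. r\<^sup>2"])
           (use True in \<open>auto intro!: derivative_eq_intros order_trans[OF norm_ge_zero]
              simp: has_real_derivative_iff_has_vector_derivative[symmetric]\<close>)
      finally show ?thesis using True by simp
    next
      case False
      then have "(\<integral>\<^sup>+r. ennreal (2 * r) * indicator {0..1} r * indicator (cball 0 r) y \<partial>lborel) = (\<integral>\<^sup>+r. 0 \<partial>(lborel::real measure))"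
        by (intro nn_integral_cong) (auto simp: indicator_def)
      then show ?thesis using False by simp
    qed
  qed
  also have "\<dots> = (\<integral>\<^sup>+r. (\<integral>\<^sup>+(y::'a). ennreal (2 * r) * indicator {0..1} r * indicator (cball 0 r) y \<partial>lborel) \<partial>lborel)"
  proof (rule lborel_pair.Fubini')
    have "(\<lambda>(r, y::'a). ennreal (2 * r) * indicator {0..1} r * indicator {p. norm (snd p) \<le> fst p} (r, y))
        \<in> borel_measurable (lborel \<Otimes>\<^sub>M lborel)"
      by measurable
    also have "(\<lambda>(r, y::'a). ennreal (2 * r) * indicator {0..1} r * indicator {p. norm (snd p) \<le> fst p} (r, y)) =
        (\<lambda>(r, y). ennreal (2 * r) * indicator {0..1} r * indicator (cball 0 r) y)"
      by (auto simp: fun_eq_iff indicator_def)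
    finally show "(\<lambda>(r, y::'a). ennreal (2 * r) * indicator {0..1} r * indicator (cball 0 r) y)
        \<in> borel_measurable (lborel \<Otimes>\<^sub>M lborel)" .
  qed
  also have "\<dots> = (\<integral>\<^sup>+r. ennreal (2 * r * (?\<omega> * r ^ ?d)) * indicator {0..1} r \<partial>lborel)"
  proof (rule nn_integral_cong)
    fix r :: real
    show "(\<integral>\<^sup>+(y::'a). ennreal (2 * r) * indicator {0..1} r * indicator (cball 0 r) y \<partial>lborel) =
        ennreal (2 * r * (?\<omega> * r ^ ?d)) * indicator {0..1} r"
    proof (cases "r \<in> {0..1}")
      case True
      then have "(\<integral>\<^sup>+(y::'a). ennreal (2 * r) * indicator {0..1} r * indicator (cball 0 r) y \<partial>lborel) =
          ennreal (2 * r) * emeasure lborel (cball (0::'a) r)"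
        by (simp add: nn_integral_cmult_indicator del: emeasure_cball)
      then show ?thesis using True by (subst (asm) emc) (auto simp: ennreal_mult')
    qed simp
  qed
  also have "\<dots> = ennreal (?c * 1 ^ Suc (Suc ?d) - ?c * 0 ^ Suc (Suc ?d))"
  proof (rule nn_integral_FTC_Icc[where F="\<lambda>r. ?c * r ^ Suc (Suc ?d)"])
    fix r :: real
    have "((\<lambda>r. ?c * r ^ Suc (Suc ?d)) has_real_derivative ?c * (real (Suc (Suc ?d)) * r ^ Suc ?d)) (at r)"
      by (rule DERIV_cong[OF DERIV_cmult[OF DERIV_pow]]) simp
    also have "?c * (real (Suc (Suc ?d)) * r ^ Suc ?d) = 2 * r * (?\<omega> * r ^ ?d)"
      by (simp add: field_simps)
    finally show "((\<lambda>r. ?c * r ^ Suc (Suc ?d)) has_real_derivative 2 * r * (?\<omega> * r ^ ?d)) (at r)" .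
  qed (auto simp: unit_ball_vol_nonneg)
  finally have nn: "(\<integral>\<^sup>+(y::'a). ennreal ((1 - (norm y)\<^sup>2) * indicator (cball 0 1) y) \<partial>lborel) = ennreal ?c"
    by simp
  have "0 \<le> (1 - (norm y)\<^sup>2) * indicator (cball 0 1) y" for y :: 'a
    by (cases "norm y \<le> 1") (auto simp: power_le_one)
  moreover have "(\<lambda>y::'a. (1 - (norm y)\<^sup>2) * indicator (cball 0 1) y) \<in> borel_measurable lborel"
    by (intro borel_measurable_times borel_measurable_diff borel_measurable_power borel_measurable_norm
        borel_measurable_indicator) auto
  ultimately have "(\<integral>(y::'a). (1 - (norm y)\<^sup>2) * indicator (cball 0 1) y \<partial>lborel) = ?c"
    using nn by (subst integral_eq_nn_integral) (auto simp: unit_ball_vol_nonneg)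
  moreover have "(\<integral>(y::'a). (1 - (norm y)\<^sup>2) * indicator (cball 0 1) y \<partial>lborel) =
      ?\<omega> - (\<integral>y. (norm y)\<^sup>2 * indicator (ball (0::'a) 1) y \<partial>lborel)"
  proof -
    have 1: "integrable lborel (indicator (ball (0::'a) 1) :: 'a \<Rightarrow> real)"
      by (rule integrable_real_indicator) (use emeasure_lborel_ball_finite[of "0::'a" 1] in auto)
    have 2: "integrable lborel (\<lambda>y::'a. (norm y)\<^sup>2 * indicator (ball 0 1) y)"
      by (rule Bochner_Integration.integrable_bound[OF 1])
         (auto simp: indicator_def power_le_one)
    have "(\<integral>(y::'a). (1 - (norm y)\<^sup>2) * indicator (cball 0 1) y \<partial>lborel) =
      (\<integral>(y::'a). indicator (ball 0 1) y - (norm y)\<^sup>2 * indicator (ball 0 1) y \<partial>lborel)"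
    proof (rule Bochner_Integration.integral_cong[OF refl])
      \<comment> \<open>The weight \<open>1 - |y|^2\<close> vanishes on the sphere, so the identity
        between closed and open ball holds at every point.\<close>
      fix y :: 'a
      show "(1 - (norm y)\<^sup>2) * indicator (cball 0 1) y = indicator (ball 0 1) y - (norm y)\<^sup>2 * indicator (ball 0 1) y"
        by (cases "norm y = 1") (auto simp: indicator_def)
    qed
    also have "\<dots> = measure lborel (ball (0::'a) 1) - (\<integral>y. (norm y)\<^sup>2 * indicator (ball (0::'a) 1) y \<partial>lborel)"
      by (subst Bochner_Integration.integral_diff[OF 1 2]) simp
    also have "measure lborel (ball (0::'a) 1) = ?\<omega>"
      using content_ball[of 1 "0::'a"] by simp
    finally show ?thesis .
  qed
  ultimately have "(\<integral>y. (norm y)\<^sup>2 * indicator (ball (0::'a) 1) y \<partial>lborel) = ?\<omega> - ?c"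
    by linarith
  also have "\<dots> = real ?d / (real ?d + 2) * ?\<omega>"
    by (simp add: divide_simps) (simp add: algebra_simps)
  also have "?\<omega> = measure lborel (ball (0::'a) 1)"
    using content_ball[of 1 "0::'a"] by simp
  finally show ?thesis .
qed

text \<open>With \<open>t = |y|^2\<close> this dominates the approximating densities and their
  second moments by one Gaussian for all \<open>n\<close>. Exponents of at least 2 are used so that
  \<open>2 t - 1 \<le> t^2\<close> controls the power for \<open>t \<ge> 1\<close>, which leaves
  room to absorb the factor \<open>t \<le> exp t\<close>.\<close>

lemma power_exp_gauss_bound:
  fixes t :: real
  assumes "0 \<le> t"
  shows "exp (- (t ^ (n + 2))) \<le> exp 1 * exp (- t)" "t * exp (- (t ^ (n + 2))) \<le> exp 1 * exp (- t)"
proof -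
  have sq: "0 \<le> (t - 1)\<^sup>2" by simp
  have pow: "t ^ 2 \<le> t ^ (n + 2)" if "1 \<le> t" using that by (intro power_increasing) auto
  have "t - 1 \<le> t ^ (n + 2)"
  proof (cases "1 \<le> t")
    case True
    have "t - 1 \<le> t ^ 2" using sq assms by (simp add: power2_eq_square algebra_simps)
    then show ?thesis using pow[OF True] by simp
  next
    case False
    then have "t - 1 \<le> 0" by simp
    then show ?thesis using assms by (meson order_trans zero_le_power)
  qed
  then show "exp (- (t ^ (n + 2))) \<le> exp 1 * exp (- t)"
    by (simp flip: exp_add)
  show "t * exp (- (t ^ (n + 2))) \<le> exp 1 * exp (- t)"
  proof (cases "1 \<le> t")
    case True
    have "t * exp (- (t ^ (n + 2))) \<le> exp t * exp (- (t ^ (n + 2)))"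
    proof (rule mult_right_mono)
      show "t \<le> exp t" using exp_ge_add_one_self[of t] by linarith
    qed simp
    also have "\<dots> \<le> exp (1 - t)"
      using sq pow[OF True] by (simp add: power2_eq_square algebra_simps flip: exp_add)
    finally show ?thesis by (simp add: exp_diff exp_minus field_simps)
  next
    case False
    have "t * exp (- (t ^ (n + 2))) \<le> 1 * 1"
      using False assms by (intro mult_mono) auto
    also have "\<dots> \<le> exp (1 - t)" using False by simp
    finally show ?thesis by (simp add: exp_diff exp_minus field_simps)
  qed
qed

text \<open>The powers of \<open>|y|^2\<close> tend to 0 inside the ball and to infinity outside;
  there \<open>s \<le> exp s\<close> gives a geometric majorant. On the sphere the sequence is
  constantly \<open>exp (- 1)\<close>, hence the exclusion.\<close>

lemma power_exp_ball_limit: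
  fixes y :: "'a::euclidean_space"
  assumes "norm y \<noteq> 1"
  shows "(\<lambda>n. exp (- (((norm y)\<^sup>2) ^ (n + 2)))) \<longlonglongrightarrow> indicator (ball 0 1) y"
proof (cases "norm y < 1")
  case True
  then have "(norm y)\<^sup>2 < 1" by (simp add: power_less_one_iff abs_square_less_1)
  then have "(\<lambda>n. ((norm y)\<^sup>2) ^ (n + 2)) \<longlonglongrightarrow> 0"
    by (intro LIMSEQ_ignore_initial_segment LIMSEQ_power_zero) simp
  then have "(\<lambda>n. exp (- (((norm y)\<^sup>2) ^ (n + 2)))) \<longlonglongrightarrow> exp (- 0)"
    by (intro tendsto_intros)
  then show ?thesis using True by simp
next
  case False
  then have t: "1 < (norm y)\<^sup>2" using assms by (intro one_less_power) auto
  have lim0: "(\<lambda>n. inverse ((norm y)\<^sup>2) ^ (n + 2)) \<longlonglongrightarrow> 0"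
  proof (intro LIMSEQ_ignore_initial_segment LIMSEQ_power_zero)
    have "inverse T < 1" if "1 < T" for T :: real using that by (simp add: inverse_less_1_iff)
    from this[OF t] show "norm (inverse ((norm y)\<^sup>2)) < 1" by simp
  qed
  have le: "exp (- (((norm y)\<^sup>2) ^ (n + 2))) \<le> inverse ((norm y)\<^sup>2) ^ (n + 2)" for n
  proof -
    have "0 < ((norm y)\<^sup>2) ^ (n + 2)" by (rule zero_less_power) (use t in linarith)
    moreover have "((norm y)\<^sup>2) ^ (n + 2) \<le> exp (((norm y)\<^sup>2) ^ (n + 2))"
      using exp_ge_add_one_self[of "((norm y)\<^sup>2) ^ (n + 2)"] by linarith
    ultimately show ?thesis
      by (simp only: exp_minus power_inverse) (rule le_imp_inverse_le)
  qed
  have "(\<lambda>n. exp (- (((norm y)\<^sup>2) ^ (n + 2)))) \<longlonglongrightarrow> 0"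
    by (rule tendsto_sandwich[OF always_eventually always_eventually tendsto_const lim0])
       (use le in auto)
  then show ?thesis using False by simp
qed

lemma AE_norm_neq_1: "AE y::'a::euclidean_space in lborel. norm y \<noteq> 1"
proof -
  have "sphere (0::'a) 1 \<in> null_sets lborel"
    using negligible_sphere[of "0::'a" 1] by (auto simp: null_sets_completion_iff negligible_iff_null_sets)
  from AE_not_in[OF this] show ?thesis by simp
qed

lemma measure_lborel_open_pos:
  fixes \<Omega> :: "'a::euclidean_space set"
  assumes \<Omega>: "open \<Omega>" "bounded \<Omega>" "\<Omega> \<noteq> {}"
  shows "0 < measure lborel \<Omega>"
proof -
  obtain x e where "0 < e" "ball x e \<subseteq> \<Omega>" using \<Omega>(1,3) open_contains_ball by blast
  have fm: "\<Omega> \<in> fmeasurable lborel"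
    using \<Omega> emeasure_bounded_finite[OF \<Omega>(2)] by (intro fmeasurableI) auto
  have "0 < measure lborel (ball x e)" using content_ball_pos[OF \<open>0 < e\<close>, of x] by (simp add: measure_completion)
  also have "\<dots> \<le> measure lborel \<Omega>"
    by (rule measure_mono_fmeasurable[OF \<open>ball x e \<subseteq> \<Omega>\<close> _ fm]) simp
  finally show ?thesis .
qed

text \<open>
  The source density approximates the indicator of \<open>\<Omega>\<close>, the target density is a multiple of
  \<open>exp (- |y|\<^sup>2\<^sup>n)\<close>, which approximates the indicator of the unit ball; letting \<open>n\<close> tend to infinity
  gives the inequality with the constant of the ball.
\<close>

lemma saint_venant_nonneg:
  fixes \<Omega> :: "'a::euclidean_space set" and u :: "'a \<Rightarrow> real" and G :: "'a \<Rightarrow> 'a"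
  defines "d \<equiv> real DIM('a)" and "\<omega> \<equiv> measure lborel (ball (0::'a) 1)"
  defines "\<kappa> \<equiv> measure lborel \<Omega> / \<omega>"
  defines "a \<equiv> \<kappa> powr (- 1 / d)"
  assumes \<Omega>: "open \<Omega>" "bounded \<Omega>" "\<Omega> \<noteq> {}"
    and u: "\<And>y. (u has_derivative (\<lambda>h. G y \<bullet> h)) (at y)" "continuous_on UNIV G" "\<And>y. 0 \<le> u y"
    and K: "compact K" "K \<subseteq> \<Omega>" "\<And>y. y \<notin> K \<Longrightarrow> u y = 0 \<and> G y = 0"
    and int: "integrable lborel u" "integrable lborel (\<lambda>y. (norm (G y))\<^sup>2)"
  shows "d * a * (\<integral>y. u y \<partial>lborel) \<le> 1/2 * (\<integral>y. (norm (G y))\<^sup>2 \<partial>lborel) + 1/2 * \<kappa> * (d / (d + 2) * \<omega>)"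
proof -
  have d: "0 < d" unfolding d_def by simp
  have \<omega>: "0 < \<omega>" unfolding \<omega>_def using content_ball_pos[of 1 "0::'a"] by (simp add: measure_completion)
  have m\<Omega>: "0 < measure lborel \<Omega>"
    by (rule measure_lborel_open_pos[OF \<Omega>])
  have \<kappa>: "0 < \<kappa>" unfolding \<kappa>_def using \<omega> m\<Omega> by simp
  have a: "0 < a" unfolding a_def using \<kappa> by simp
  obtain R where R: "\<And>x. x \<in> \<Omega> \<Longrightarrow> norm x \<le> R" "0 < R"
    using \<Omega>(2) bounded_pos by metis
  have ne: "- \<Omega> \<noteq> {}" using \<Omega>(2) not_bounded_UNIV by (metis double_compl Compl_empty_eq)
  \<comment> \<open>The distance to the complement is continuous, positive exactly on \<Omega>, and
    bounded below on the compact set \<open>K\<close>.\<close>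
  define h where "h = (\<lambda>x. infdist x (- \<Omega>))"
  have ch: "continuous_on S h" for S unfolding h_def by (intro continuous_intros)
  have h_out: "h x = 0" if "x \<notin> \<Omega>" for x unfolding h_def using that by simp
  have h_in: "0 < h x" if "x \<in> \<Omega>" for x
  proof -
    have "h x \<noteq> 0"
      unfolding h_def using in_closed_iff_infdist_zero[of "- \<Omega>" x] ne \<Omega>(1) that by (auto simp: closed_def)
    then show ?thesis unfolding h_def using infdist_nonneg[of x "- \<Omega>"] by simp
  qed
  obtain \<delta> where \<delta>: "0 < \<delta>" "\<And>x. x \<in> K \<Longrightarrow> \<delta> \<le> h x"
  proof (cases "K = {}")
    case True
    then show ?thesis using that[of 1] by simp
  next
    case False
    then obtain x0 where "x0 \<in> K" "\<And>x. x \<in> K \<Longrightarrow> h x0 \<le> h x"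
      using continuous_attains_inf[OF K(1) False ch] by blast
    then show ?thesis using that[of "h x0"] h_in K(2) by blast
  qed
  \<comment> \<open>The truncated part tends to the indicator of \<Omega> and equals 1 on
    \<open>K\<close> as soon as \<open>n * \<delta> \<ge> 1\<close>, so that
    \<open>\<rho> < 1\<close> occurs only where \<open>u\<close> and \<open>G\<close> vanish. The
    Gaussian part keeps the density positive on the whole space and disappears in the limit.\<close>
  define \<rho> where "\<rho> = (\<lambda>n::nat. \<lambda>x::'a. min 1 (real n * h x) + exp (- (norm x)\<^sup>2) / real (Suc n))"
  define \<eta> where "\<eta> = (\<lambda>n::nat. \<lambda>y::'a. exp (- (((norm y)\<^sup>2) ^ (n + 2))))"
  have c\<rho>: "continuous_on UNIV (\<rho> n)" for n unfolding \<rho>_def by (intro continuous_intros ch) auto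
  have c\<eta>: "continuous_on UNIV (\<eta> n)" for n unfolding \<eta>_def by (intro continuous_intros)
  have [measurable]: "\<rho> n \<in> borel_measurable borel" "\<eta> n \<in> borel_measurable borel" for n
    using c\<rho> c\<eta> by (auto intro: borel_measurable_continuous_onI)
  have h_nonneg: "0 \<le> h x" for x unfolding h_def by (rule infdist_nonneg)
  have \<rho>_pos: "0 < \<rho> n x" for n x
    unfolding \<rho>_def using h_nonneg[of x] by (intro add_nonneg_pos) auto
  have \<rho>_le: "\<rho> n x \<le> indicator \<Omega> x + exp (- (norm x)\<^sup>2)" for n x
  proof -
    have "min 1 (real n * h x) \<le> indicator \<Omega> x" using h_out[of x] by (auto simp: indicator_def)
    moreover have "exp (- (norm x)\<^sup>2) / real (Suc n) \<le> exp (- (norm x)\<^sup>2) / 1"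
      by (intro divide_left_mono) auto
    ultimately show ?thesis unfolding \<rho>_def by simp
  qed
  \<comment> \<open>On \<Omega> the norm is at most \<open>R\<close>, so a bounded set already
    satisfies a Gaussian bound.\<close>
  have ind_le: "indicator \<Omega> x \<le> exp (R\<^sup>2) * exp (- (norm x)\<^sup>2)" for x
    using R(1)[of x] power_mono[of "norm x" R 2] by (auto simp: indicator_def simp flip: exp_add)
  have \<rho>_bound: "\<rho> n x \<le> (exp (R\<^sup>2) + 1) * exp (- (norm x)\<^sup>2)" for n x
    using \<rho>_le[of n x] ind_le[of x] by (simp add: distrib_right)
  have \<eta>_bound: "0 < \<eta> n y" "\<eta> n y \<le> 1" "\<eta> n y \<le> exp 1 * exp (- (norm y)\<^sup>2)"
    "(norm y)\<^sup>2 * \<eta> n y \<le> exp 1 * exp (- (norm y)\<^sup>2)" for n y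
    unfolding \<eta>_def using power_exp_gauss_bound[of "(norm y)\<^sup>2" n] by auto
  have gb: "integrable lborel (\<lambda>x::'a. C * exp (- (norm x)\<^sup>2))" for C
    by (intro integrable_mult_right integrable_exp_minus_norm_square)
  have lim\<rho>: "(\<lambda>n. \<integral>x. \<rho> n x \<partial>lborel) \<longlonglongrightarrow> measure lborel \<Omega>"
  proof -
    have "(\<lambda>n. \<integral>x. \<rho> n x \<partial>lborel) \<longlonglongrightarrow> (\<integral>x. indicator \<Omega> x \<partial>lborel)"
    proof (rule integral_dominated_convergence[OF _ _ gb[of "exp (R\<^sup>2) + 1"]])
      show "AE x in lborel. norm (\<rho> n x) \<le> (exp (R\<^sup>2) + 1) * exp (- (norm x)\<^sup>2)" for n
        using \<rho>_bound \<rho>_pos by (auto simp: less_imp_le abs_of_pos)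
      show "AE x in lborel. (\<lambda>n. \<rho> n x) \<longlonglongrightarrow> indicator \<Omega> x"
      proof (rule AE_I2)
        fix x :: 'a
        have 1: "(\<lambda>n. exp (- (norm x)\<^sup>2) / real (Suc n)) \<longlonglongrightarrow> 0"
          by (rule LIMSEQ_Suc) (rule lim_const_over_n)
        have 2: "(\<lambda>n. min 1 (real n * h x)) \<longlonglongrightarrow> indicator \<Omega> x"
        proof (cases "x \<in> \<Omega>")
          case True
          have "eventually (\<lambda>n. 1 / h x \<le> real n) sequentially"
            using filterlim_real_sequentially by (simp add: filterlim_at_top)
          then have "eventually (\<lambda>n. min 1 (real n * h x) = 1) sequentially"
            by eventually_elim (use h_in[OF True] in \<open>simp add: field_simps\<close>)
          then show ?thesis using True by (auto intro: tendsto_eventually)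
        next
          case False
          then show ?thesis using h_out by simp
        qed
        show "(\<lambda>n. \<rho> n x) \<longlonglongrightarrow> indicator \<Omega> x"
          unfolding \<rho>_def using tendsto_add[OF 2 1] by simp
      qed
    qed (use \<Omega>(1) in auto)
    then show ?thesis using \<Omega>(1) by simp
  qed
  have AE\<eta>: "AE y in lborel. (\<lambda>n. \<eta> n y) \<longlonglongrightarrow> indicator (ball 0 1) y"
    using AE_norm_neq_1 by eventually_elim (unfold \<eta>_def, rule power_exp_ball_limit)
  have lim\<eta>: "(\<lambda>n. \<integral>y. \<eta> n y \<partial>lborel) \<longlonglongrightarrow> \<omega>"
  proof -
    have "(\<lambda>n. \<integral>y. \<eta> n y \<partial>lborel) \<longlonglongrightarrow> (\<integral>(y::'a). indicator (ball 0 1) y \<partial>lborel)"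
    proof (rule integral_dominated_convergence[OF _ _ gb[of "exp 1"]])
      show "AE y in lborel. (\<lambda>n. \<eta> n y) \<longlonglongrightarrow> indicator (ball 0 1) y" by (rule AE\<eta>)
    qed (use \<eta>_bound in \<open>auto simp: less_imp_le abs_of_pos intro!: borel_measurable_indicator\<close>)
    then show ?thesis by (simp add: \<omega>_def)
  qed
  have limE: "(\<lambda>n. \<integral>y. (norm y)\<^sup>2 * \<eta> n y \<partial>lborel) \<longlonglongrightarrow> d / (d + 2) * \<omega>"
  proof -
    have "(\<lambda>n. \<integral>y. (norm y)\<^sup>2 * \<eta> n y \<partial>lborel) \<longlonglongrightarrow> (\<integral>(y::'a). (norm y)\<^sup>2 * indicator (ball 0 1) y \<partial>lborel)"
    proof (rule integral_dominated_convergence[OF _ _ gb[of "exp 1"]])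
      show "AE y in lborel. (\<lambda>n. (norm y)\<^sup>2 * \<eta> n y) \<longlonglongrightarrow> (norm y)\<^sup>2 * indicator (ball 0 1) y"
        using AE\<eta> by eventually_elim (intro tendsto_intros)
    qed (use \<eta>_bound in \<open>auto simp: less_imp_le abs_of_pos abs_mult
        intro!: borel_measurable_times borel_measurable_indicator\<close>)
    then show ?thesis unfolding ball_second_moment by (simp add: d_def \<omega>_def)
  qed
  \<comment> \<open>The quotient of the masses makes \<open>\<kappa>n n * \<eta> n\<close> a target
    of the same mass as \<open>\<rho> n\<close>. As \<open>\<eta> n\<close> is at most 1, it is also
    the pointwise upper bound of that target.\<close>
  define \<kappa>n where "\<kappa>n = (\<lambda>n. (\<integral>x. \<rho> n x \<partial>lborel) / (\<integral>y. \<eta> n y \<partial>lborel))"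
  have lim\<kappa>: "\<kappa>n \<longlonglongrightarrow> \<kappa>"
    unfolding \<kappa>n_def \<kappa>_def using \<omega> by (intro tendsto_divide lim\<rho> lim\<eta>) auto
  obtain B where B: "\<And>y. y \<in> K \<Longrightarrow> norm y \<le> B"
    using compact_imp_bounded[OF K(1)] bounded_iff by metis
  have ev: "eventually (\<lambda>n. (d * (a - a * ln a) - a * ln (\<kappa>n n)) * (\<integral>y. u y \<partial>lborel) \<le>
      1/2 * (\<integral>y. (norm (G y))\<^sup>2 \<partial>lborel) + 1/2 * (\<kappa>n n * (\<integral>y. (norm y)\<^sup>2 * \<eta> n y \<partial>lborel))) sequentially"
  proof -
    have "eventually (\<lambda>n. 0 < (\<integral>y. \<eta> n y \<partial>lborel)) sequentially"
      using order_tendstoD(1)[OF lim\<eta> \<omega>] .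
    moreover have "eventually (\<lambda>n. 0 < \<kappa>n n) sequentially"
      using order_tendstoD(1)[OF lim\<kappa> \<kappa>] .
    moreover have "eventually (\<lambda>n. 1 / \<delta> \<le> real n) sequentially"
      using filterlim_real_sequentially by (simp add: filterlim_at_top)
    ultimately show ?thesis
    proof eventually_elim
      case (elim n)
      have "(d * (a - a * ln a) - a * ln (\<kappa>n n)) * (\<integral>y. u y \<partial>lborel) \<le>
        1/2 * (\<integral>y. (norm (G y))\<^sup>2 \<partial>lborel) + 1/2 * (\<integral>y. (norm y)\<^sup>2 * (\<kappa>n n * \<eta> n y) \<partial>lborel)"
        unfolding d_def
      proof (rule euclidean_transport_inequality[OF a elim(2) c\<rho> \<rho>_pos \<rho>_bound])
        show "continuous_on UNIV (\<lambda>y. \<kappa>n n * \<eta> n y)" by (intro continuous_intros c\<eta>)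
        show "0 < \<kappa>n n * \<eta> n y" for y using elim(2) \<eta>_bound(1) by simp
        show "\<kappa>n n * \<eta> n y \<le> (\<kappa>n n * exp 1) * exp (- (norm y)\<^sup>2)" for y
          using mult_left_mono[OF \<eta>_bound(3)[of n y], of "\<kappa>n n"] elim(2) by (simp add: mult.assoc)
        show "(norm y)\<^sup>2 * (\<kappa>n n * \<eta> n y) \<le> (\<kappa>n n * exp 1) * exp (- (norm y)\<^sup>2)" for y
          using mult_left_mono[OF \<eta>_bound(4)[of y n], of "\<kappa>n n"] elim(2) by (simp add: mult.assoc mult.left_commute)
        show "\<kappa>n n * \<eta> n y \<le> \<kappa>n n" for y using elim(2) \<eta>_bound(2)[of n y] by (simp add: mult_left_le)
        show "(\<integral>x. \<rho> n x \<partial>lborel) = (\<integral>y. \<kappa>n n * \<eta> n y \<partial>lborel)"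
          using elim(1) by (simp add: \<kappa>n_def)
        show "u y = 0" if "B < norm y" for y using B[of y] K(3)[of y] that by force
        show "u y = 0 \<and> G y = 0" if "\<rho> n y < 1" for y
        proof (rule K(3), rule notI)
          assume "y \<in> K"
          have "1 \<le> real n * \<delta>" using elim(3) \<delta>(1) by (simp add: field_simps)
          also have "\<dots> \<le> real n * h y" by (intro mult_left_mono \<delta>(2) \<open>y \<in> K\<close>) simp
          finally have "1 \<le> \<rho> n y" by (simp add: \<rho>_def)
          with that show False by simp
        qed
      qed (use u int in auto)
      also have "(\<integral>y. (norm y)\<^sup>2 * (\<kappa>n n * \<eta> n y) \<partial>lborel) = \<kappa>n n * (\<integral>y. (norm y)\<^sup>2 * \<eta> n y \<partial>lborel)"
        by (simp add: mult.left_commute)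
      finally show ?case .
    qed
  qed
  have "(d * (a - a * ln a) - a * ln \<kappa>) * (\<integral>y. u y \<partial>lborel) \<le>
      1/2 * (\<integral>y. (norm (G y))\<^sup>2 \<partial>lborel) + 1/2 * (\<kappa> * (d / (d + 2) * \<omega>))"
  proof (rule tendsto_le[OF sequentially_bot _ _ ev])
    have "\<kappa> \<noteq> 0" using \<kappa> by simp
    then show "(\<lambda>n. (d * (a - a * ln a) - a * ln (\<kappa>n n)) * (\<integral>y. u y \<partial>lborel)) \<longlonglongrightarrow>
        (d * (a - a * ln a) - a * ln \<kappa>) * (\<integral>y. u y \<partial>lborel)"
      by (intro tendsto_mult tendsto_diff tendsto_const tendsto_ln lim\<kappa>)
  qed (intro tendsto_add tendsto_mult tendsto_const lim\<kappa> limE)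
  \<comment> \<open>Here the choice of \<open>a\<close> enters:
    \<open>ln \<kappa> = - d * ln a\<close>, so the logarithms cancel. It is the value of
    \<open>a\<close> that maximizes the coefficient. It is fixed by the limit \<kappa>, not by the
    approximations \<open>\<kappa>n\<close>.\<close>
  moreover have "d * (a - a * ln a) - a * ln \<kappa> = d * a"
    using d \<kappa> unfolding a_def by (simp add: ln_powr field_simps)
  ultimately show ?thesis by simp
qed

text \<open>To remove the sign condition, \<open>c * u\<close> is replaced by
  \<open>sqrt ((c * u)^2 + \<epsilon>^2) - \<epsilon>\<close>, a differentiable substitute for its
  absolute value: it is nonnegative, vanishes where \<open>u\<close> does, has no larger gradient,
  and falls short of \<open>c * u\<close> by at most \<epsilon>. The scaling
  \<open>c = d * a\<close> gives both integrals the same factor \<open>c^2\<close>, so that dividing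
  by it leaves the torsion energy.\<close>

lemma saint_venant_test:
  fixes \<Omega> :: "'a::euclidean_space set" and u :: "'a \<Rightarrow> real" and G :: "'a \<Rightarrow> 'a"
  defines "d \<equiv> real DIM('a)" and "\<omega> \<equiv> measure lborel (ball (0::'a) 1)"
  assumes \<Omega>: "open \<Omega>" "bounded \<Omega>" "\<Omega> \<noteq> {}"
    and u: "\<And>y. (u has_derivative (\<lambda>h. G y \<bullet> h)) (at y)" "continuous_on UNIV G"
    and K: "compact K" "K \<subseteq> \<Omega>" "\<And>y. y \<notin> K \<Longrightarrow> u y = 0 \<and> G y = 0"
    and int: "integrable lborel u" "integrable lborel (\<lambda>y. (norm (G y))\<^sup>2)"
  shows "(\<integral>y. u y \<partial>lborel) \<le> 1/2 * (\<integral>y. (norm (G y))\<^sup>2 \<partial>lborel) +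
    1/2 * (measure lborel \<Omega> powr ((d + 2) / d) / (d * (d + 2) * \<omega> powr (2 / d)))"
proof -
  define \<kappa> where "\<kappa> = measure lborel \<Omega> / \<omega>"
  define a where "a = \<kappa> powr (- 1 / d)"
  have d: "0 < d" unfolding d_def by simp
  have \<omega>: "0 < \<omega>" unfolding \<omega>_def using content_ball_pos[of 1 "0::'a"] by (simp add: measure_completion)
  have fm: "\<Omega> \<in> fmeasurable lborel"
    using \<Omega> emeasure_bounded_finite[OF \<Omega>(2)] by (intro fmeasurableI) auto
  have m\<Omega>: "0 < measure lborel \<Omega>"
    by (rule measure_lborel_open_pos[OF \<Omega>])
  have \<kappa>: "0 < \<kappa>" unfolding \<kappa>_def using \<omega> m\<Omega> by simp
  have a: "0 < a" unfolding a_def using \<kappa> by simp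
  define c where "c = d * a"
  have c: "0 < c" unfolding c_def using d a by simp
  have cu: "continuous_on UNIV u"
    by (intro continuous_at_imp_continuous_on ballI has_derivative_continuous[OF u(1)])
  have [measurable]: "u \<in> borel_measurable borel" "G \<in> borel_measurable borel"
    using cu u(2) by (auto intro: borel_measurable_continuous_onI)
  have key: "c * (\<integral>y. c * u y \<partial>lborel) \<le> 1/2 * (\<integral>y. (norm (c *\<^sub>R G y))\<^sup>2 \<partial>lborel) +
      1/2 * \<kappa> * (d / (d + 2) * \<omega>) + \<epsilon> * (c * measure lborel \<Omega>)"
    if \<epsilon>: "0 < \<epsilon>" for \<epsilon>
  proof -
    define s where "s = (\<lambda>y. sqrt ((c * u y)\<^sup>2 + \<epsilon>\<^sup>2))"
    define v where "v = (\<lambda>y. s y - \<epsilon>)"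
    define H where "H = (\<lambda>y. (c * u y / s y * c) *\<^sub>R G y)"
    have s_pos: "0 < s y" for y unfolding s_def using \<epsilon> by (simp add: add_nonneg_pos)
    have s_ge: "\<bar>c * u y\<bar> \<le> s y" "\<epsilon> \<le> s y" for y
      unfolding s_def using \<epsilon> by (auto intro!: real_le_rsqrt)
    have s_le: "s y \<le> \<bar>c * u y\<bar> + \<epsilon>" for y
      unfolding s_def using sqrt_sum_squares_le_sum_abs[of "c * u y" \<epsilon>] \<epsilon> by simp
    have cs: "continuous_on UNIV s" unfolding s_def by (intro continuous_intros cu)
    have cH: "continuous_on UNIV H"
      unfolding H_def by (intro continuous_intros cu cs u(2)) (use s_pos in \<open>auto simp: less_le\<close>)
    have cv: "continuous_on UNIV v" unfolding v_def by (intro continuous_intros cs)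
    have [measurable]: "v \<in> borel_measurable borel" "H \<in> borel_measurable borel"
      using cv cH by (auto intro: borel_measurable_continuous_onI)
    have dv: "(v has_derivative (\<lambda>h. H y \<bullet> h)) (at y)" for y
    proof -
      have "(v has_derivative (\<lambda>h. (2 * (c * u y) * (c * (G y \<bullet> h))) * (inverse (s y) / 2))) (at y)"
        unfolding v_def s_def using \<epsilon>
        by (auto intro!: derivative_eq_intros u(1) simp: add_nonneg_pos power2_eq_square)
      also have "(\<lambda>h. (2 * (c * u y) * (c * (G y \<bullet> h))) * (inverse (s y) / 2)) = (\<lambda>h. H y \<bullet> h)"
        by (simp add: H_def field_simps fun_eq_iff)
      finally show ?thesis .
    qed
    have HG: "norm (H y) \<le> norm (c *\<^sub>R G y)" for y
    proof -
      have "norm (H y) = (\<bar>c * u y\<bar> / s y) * norm (c *\<^sub>R G y)"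
        using s_pos[of y] c by (simp add: H_def abs_mult)
      also have "\<dots> \<le> 1 * norm (c *\<^sub>R G y)"
        by (intro mult_right_mono) (use s_pos[of y] s_ge(1)[of y] in \<open>auto simp: divide_le_eq_1\<close>)
      finally show ?thesis by simp
    qed
    have HG2: "(norm (H y))\<^sup>2 \<le> c\<^sup>2 * (norm (G y))\<^sup>2" for y
      using power_mono[OF HG, of y 2] by (simp add: power_mult_distrib)
    have intv: "integrable lborel v"
    proof (rule Bochner_Integration.integrable_bound)
      show "integrable lborel (\<lambda>y. c * u y)" using int by simp
      show "AE y in lborel. norm (v y) \<le> norm (c * u y)"
      proof (rule AE_I2)
        show "norm (v y) \<le> norm (c * u y)" for y
          using s_le[of y] s_ge(2)[of y] by (simp add: v_def)
      qed
    qed simp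
    have intH: "integrable lborel (\<lambda>y. (norm (H y))\<^sup>2)"
    proof (rule Bochner_Integration.integrable_bound)
      show "integrable lborel (\<lambda>y. c\<^sup>2 * (norm (G y))\<^sup>2)" using int by simp
      show "AE y in lborel. norm ((norm (H y))\<^sup>2) \<le> norm (c\<^sup>2 * (norm (G y))\<^sup>2)"
        using HG2 by (auto intro!: AE_I2)
    qed simp
    have "d * a * (\<integral>y. v y \<partial>lborel) \<le> 1/2 * (\<integral>y. (norm (H y))\<^sup>2 \<partial>lborel) + 1/2 * \<kappa> * (d / (d + 2) * \<omega>)"
      unfolding d_def a_def \<kappa>_def \<omega>_def
    proof (rule saint_venant_nonneg[OF \<Omega> dv cH _ K(1,2) _ intv intH])
      show "0 \<le> v y" for y unfolding v_def using s_ge(2) by simp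
      show "v y = 0 \<and> H y = 0" if "y \<notin> K" for y
        using K(3)[OF that] \<epsilon> by (simp add: v_def H_def s_def)
    qed
    moreover have "(\<integral>y. (norm (H y))\<^sup>2 \<partial>lborel) \<le> (\<integral>y. (norm (c *\<^sub>R G y))\<^sup>2 \<partial>lborel)"
      using HG2 int intH by (intro integral_mono) (auto simp: power_mult_distrib)
    \<comment> \<open>Outside \<Omega> nothing is lost, so the error is \<epsilon> times a finite
      measure.\<close>
    moreover have "(\<integral>y. c * u y \<partial>lborel) \<le> (\<integral>y. v y + \<epsilon> * indicator \<Omega> y \<partial>lborel)"
    proof (rule integral_mono)
      show "integrable lborel (\<lambda>y. v y + \<epsilon> * indicator \<Omega> y)"
        using intv fm by (intro Bochner_Integration.integrable_add integrable_mult_right)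
          (auto simp: fmeasurable_def)
      fix y show "c * u y \<le> v y + \<epsilon> * indicator \<Omega> y"
      proof (cases "y \<in> \<Omega>")
        case True
        then show ?thesis using s_ge(1)[of y] by (simp add: v_def)
      next
        case False
        then have "u y = 0" using K(2,3) by blast
        then show ?thesis using False s_ge(2)[of y] by (simp add: v_def)
      qed
    qed (use int in simp)
    moreover have "(\<integral>y. v y + \<epsilon> * indicator \<Omega> y \<partial>lborel) = (\<integral>y. v y \<partial>lborel) + \<epsilon> * measure lborel \<Omega>"
      using intv fm by (subst Bochner_Integration.integral_add) (auto simp: fmeasurable_def)
    ultimately have "c * (\<integral>y. c * u y \<partial>lborel) \<le> c * ((\<integral>y. v y \<partial>lborel) + \<epsilon> * measure lborel \<Omega>)"
      "c * (\<integral>y. v y \<partial>lborel) \<le> 1/2 * (\<integral>y. (norm (c *\<^sub>R G y))\<^sup>2 \<partial>lborel) + 1/2 * \<kappa> * (d / (d + 2) * \<omega>)"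
      using c unfolding c_def[symmetric] by (auto intro: mult_left_mono)
    then show ?thesis by (simp add: algebra_simps)
  qed
  have "c * (\<integral>y. c * u y \<partial>lborel) \<le> 1/2 * (\<integral>y. (norm (c *\<^sub>R G y))\<^sup>2 \<partial>lborel) +
      1/2 * \<kappa> * (d / (d + 2) * \<omega>)"
  proof (rule field_le_epsilon)
    fix e :: real assume "0 < e"
    then show "c * (\<integral>y. c * u y \<partial>lborel) \<le> 1/2 * (\<integral>y. (norm (c *\<^sub>R G y))\<^sup>2 \<partial>lborel) +
      1/2 * \<kappa> * (d / (d + 2) * \<omega>) + e"
      using key[of "e / (c * measure lborel \<Omega>)"] c m\<Omega> by simp
  qed
  then have "c\<^sup>2 * (\<integral>y. u y \<partial>lborel) \<le> c\<^sup>2 * (1/2 * (\<integral>y. (norm (G y))\<^sup>2 \<partial>lborel)) + 1/2 * \<kappa> * (d / (d + 2) * \<omega>)"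
    using c by (simp add: power_mult_distrib power2_eq_square mult_ac)
  also have "\<dots> = c\<^sup>2 * (1/2 * (\<integral>y. (norm (G y))\<^sup>2 \<partial>lborel) + 1/2 * (\<kappa> * (d / (d + 2) * \<omega>) / c\<^sup>2))"
  proof -
    have "1/2 * \<kappa> * E = c\<^sup>2 * (1/2 * (\<kappa> * E / c\<^sup>2))" for E using c by simp
    then show ?thesis by (simp only: distrib_left)
  qed
  finally have "(\<integral>y. u y \<partial>lborel) \<le> 1/2 * (\<integral>y. (norm (G y))\<^sup>2 \<partial>lborel) + 1/2 * (\<kappa> * (d / (d + 2) * \<omega>) / c\<^sup>2)"
    using c by (simp add: mult_le_cancel_left)
  \<comment> \<open>Since \<open>c^2 = d^2 \<kappa>^(-2/d)\<close> and
    \<open>\<kappa> = |\<Omega>| / \<omega>\<close>, the second moment term becomes the torsional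
    rigidity of the ball with the measure of \<Omega>.\<close>
  also have "\<kappa> * (d / (d + 2) * \<omega>) / c\<^sup>2 = measure lborel \<Omega> powr ((d + 2) / d) / (d * (d + 2) * \<omega> powr (2 / d))"
  proof -
    have "c\<^sup>2 = d\<^sup>2 * \<kappa> powr (- 2 / d)"
      unfolding c_def a_def using \<kappa> by (simp add: power_mult_distrib powr_power)
    moreover have "\<kappa> powr (- 2 / d) = \<omega> powr (2 / d) / measure lborel \<Omega> powr (2 / d)"
      unfolding \<kappa>_def using \<omega> m\<Omega> by (simp add: powr_divide powr_minus_divide)
    moreover have "measure lborel \<Omega> powr ((d + 2) / d) = measure lborel \<Omega> * measure lborel \<Omega> powr (2 / d)"
      using m\<Omega> d by (simp add: add_divide_distrib powr_add)
    moreover have "M / \<omega> * (d / (d + 2) * \<omega>) / (d\<^sup>2 * (Q / P)) = M * P / (d * (d + 2) * Q)"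
      if "0 < P" "0 < Q" for M P Q
      using \<omega> d that by (simp add: power2_eq_square divide_simps)
    ultimately show ?thesis
      using \<omega> m\<Omega> by (simp add: \<kappa>_def)
  qed
  finally show ?thesis .
qed

subsection \<open>Test functions\<close>

lemma C_k_SucI:
  assumes "\<And>x. (f has_derivative f' x) (at x)" "\<And>b. b \<in> Basis \<Longrightarrow> C_k k (\<lambda>x. f' x b)"
  shows "C_k (Suc k) f"
proof -
  have "frechet_derivative f (at x) = f' x" for x
    using frechet_derivative_at[OF assms(1)] by simp
  then show ?thesis using assms by (auto simp: differentiable_def)
qed

lemma C_k_SucD:
  assumes "C_k (Suc k) f"
  shows "(f has_derivative frechet_derivative f (at x)) (at x)"
    "b \<in> Basis \<Longrightarrow> C_k k (\<lambda>x. frechet_derivative f (at x) b)"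
  using assms frechet_derivative_works by auto

lemma C_k_continuous: "C_k k f \<Longrightarrow> continuous_on UNIV f"
  by (cases k) (auto intro!: continuous_at_imp_continuous_on differentiable_imp_continuous_within)

text \<open>The product rule keeps one factor undifferentiated, so that factor has to be available
  at the order of the derivative.\<close>

lemma C_k_lower: "C_k (Suc k) f \<Longrightarrow> C_k k f"
proof (induction k arbitrary: f)
  case 0
  then show ?case using C_k_continuous by (metis C_k.simps(1))
next
  case (Suc k)
  show ?case
    by (rule C_k_SucI[OF C_k_SucD(1)[OF Suc.prems]]) (rule Suc.IH[OF C_k_SucD(2)[OF Suc.prems]])
qed

lemma C_k_const: "C_k k (\<lambda>_. c)"
  by (induction k arbitrary: c) (auto intro!: C_k_SucI[where f'="\<lambda>_ _. 0"] continuous_intros simp del: C_k.simps(2))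

lemma C_k_add: "C_k k f \<Longrightarrow> C_k k g \<Longrightarrow> C_k k (\<lambda>x. f x + g x)"
proof (induction k arbitrary: f g)
  case (Suc k)
  show ?case
    by (rule C_k_SucI[OF has_derivative_add[OF C_k_SucD(1)[OF Suc.prems(1)] C_k_SucD(1)[OF Suc.prems(2)]]])
       (intro Suc.IH C_k_SucD(2) Suc.prems)
qed (auto intro: continuous_intros)

lemma C_k_mult: "C_k k f \<Longrightarrow> C_k k g \<Longrightarrow> C_k k (\<lambda>x. f x * g x)"
proof (induction k arbitrary: f g)
  case (Suc k)
  show ?case
    by (rule C_k_SucI[OF has_derivative_mult[OF C_k_SucD(1)[OF Suc.prems(1)] C_k_SucD(1)[OF Suc.prems(2)]]])
       (intro C_k_add Suc.IH C_k_SucD(2)[OF Suc.prems(1)] C_k_SucD(2)[OF Suc.prems(2)]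
          C_k_lower[OF Suc.prems(1)] C_k_lower[OF Suc.prems(2)])
qed (auto intro: continuous_intros)

lemma C_k_prod: "(\<And>i. i \<in> I \<Longrightarrow> C_k k (f i)) \<Longrightarrow> C_k k (\<lambda>x. \<Prod>i\<in>I. f i x)"
  by (induction I rule: infinite_finite_induct) (auto intro: C_k_const C_k_mult)

text \<open>The functions \<open>p(1/t) exp (-1/t)\<close> with \<open>p\<close> a polynomial are closed under differentiation.\<close>

definition flat_fun :: "real poly \<Rightarrow> real \<Rightarrow> real" where
  "flat_fun p t = (if 0 < t then poly p (1 / t) * exp (- (1 / t)) else 0)"

lemma poly_exp_minus_at_top: "((\<lambda>s. poly p s * exp (- s)) \<longlongrightarrow> 0) at_top" for p :: "real poly"
proof -
  have "((\<lambda>s. \<Sum>i\<le>degree p. coeff p i * (s ^ i / exp s)) \<longlongrightarrow> (\<Sum>i\<le>degree p. coeff p i * 0)) at_top"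
    by (intro tendsto_intros tendsto_power_div_exp_0)
  then show ?thesis
    by (simp add: poly_altdef sum_distrib_right exp_minus divide_inverse mult.assoc)
qed

text \<open>With \<open>s = 1 / t\<close> the derivative of \<open>p(s) exp (- s)\<close> in
  \<open>t\<close> carries the factor \<open>- s^2\<close>, which gives \<open>s^2 (p - p')\<close>.
  At 0 the quotient from the left is 0, and from the right it tends to 0 because the exponential
  beats every polynomial.\<close>

lemma flat_has_real_derivative:
  "(flat_fun p has_real_derivative flat_fun (monom 1 2 * (p - pderiv p)) t) (at t)"
proof -
  consider "t < 0" | "t = 0" | "0 < t" by linarith
  then show ?thesis
  proof cases
    case 1
    have "((\<lambda>_. 0) has_real_derivative 0) (at t)" by simp
    then have "(flat_fun p has_real_derivative 0) (at t)"
      by (rule has_field_derivative_transform_within_open[where S="{..<0}"]) (use 1 in \<open>auto simp: flat_fun_def\<close>)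
    then show ?thesis using 1 by (simp add: flat_fun_def)
  next
    case 2
    have "((\<lambda>y. flat_fun p y / y) \<longlongrightarrow> 0) (at 0)"
    proof (rule filterlim_split_at)
      have "\<forall>\<^sub>F y in at_left 0. flat_fun p y / y = 0"
        by (rule eventually_at_leftI[of "-1"]) (auto simp: flat_fun_def)
      then show "((\<lambda>y. flat_fun p y / y) \<longlongrightarrow> 0) (at_left 0)" by (rule tendsto_eventually)
      \<comment> \<open>Division by \<open>y\<close> is multiplication of the polynomial by its
        variable, evaluated at \<open>1 / y\<close>.\<close>
      have "((\<lambda>y. poly (monom 1 1 * p) (inverse y) * exp (- (inverse y))) \<longlongrightarrow> 0) (at_right (0::real))"
        by (rule filterlim_compose[OF poly_exp_minus_at_top filterlim_inverse_at_top_right])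
      moreover have "\<forall>\<^sub>F y in at_right 0. poly (monom 1 1 * p) (inverse y) * exp (- (inverse y)) = flat_fun p y / y"
        by (rule eventually_at_rightI[of 0 1]) (auto simp: flat_fun_def poly_monom field_simps)
      ultimately show "((\<lambda>y. flat_fun p y / y) \<longlongrightarrow> 0) (at_right 0)"
        by (rule Lim_transform_eventually)
    qed
    then show ?thesis using 2 by (simp add: has_field_derivative_iff flat_fun_def)
  next
    case 3
    have "((\<lambda>t. poly p (1 / t) * exp (- (1 / t))) has_real_derivative
        poly (monom 1 2 * (p - pderiv p)) (1 / t) * exp (- (1 / t))) (at t)"
      using 3 by (auto intro!: derivative_eq_intros DERIV_chain2[OF poly_DERIV] simp: poly_monom power2_eq_square field_simps)
    then have "(flat_fun p has_real_derivative poly (monom 1 2 * (p - pderiv p)) (1 / t) * exp (- (1 / t))) (at t)"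
      by (rule has_field_derivative_transform_within_open[where S="{0<..}"]) (use 3 in \<open>auto simp: flat_fun_def\<close>)
    then show ?thesis using 3 by (simp add: flat_fun_def)
  qed
qed

text \<open>Differentiation replaces \<open>p\<close> by another polynomial, so the induction runs
  over all polynomials at once. The affine argument serves lower and upper faces of a box
  alike.\<close>

lemma C_k_flat: "C_k k (\<lambda>x::'a::euclidean_space. flat_fun p (x \<bullet> v + c))"
proof (induction k arbitrary: p)
  case 0
  have "continuous_on UNIV (flat_fun p)"
    by (intro continuous_at_imp_continuous_on ballI) (rule DERIV_isCont[OF flat_has_real_derivative])
  then have "continuous_on UNIV (\<lambda>x::'a. flat_fun p (x \<bullet> v + c))"
    by (rule continuous_on_compose2) (auto intro!: continuous_intros)
  then show ?case by simp
next
  case (Suc k)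
  let ?q = "monom 1 2 * (p - pderiv p)"
  show ?case
  proof (rule C_k_SucI[where f'="\<lambda>x h. flat_fun ?q (x \<bullet> v + c) * (h \<bullet> v)"])
    fix x :: 'a
    have "((\<lambda>x. x \<bullet> v + c) has_derivative (\<lambda>h. h \<bullet> v)) (at x)"
      by (auto intro!: derivative_eq_intros)
    moreover have "(flat_fun p has_derivative (\<lambda>h. flat_fun ?q (x \<bullet> v + c) * h)) (at (x \<bullet> v + c))"
      using flat_has_real_derivative[of p "x \<bullet> v + c"] by (simp add: has_field_derivative_def)
    ultimately show "((\<lambda>x. flat_fun p (x \<bullet> v + c)) has_derivative (\<lambda>h. flat_fun ?q (x \<bullet> v + c) * (h \<bullet> v))) (at x)"
      by (rule has_derivative_compose)
  qed (intro C_k_mult Suc.IH C_k_const)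
qed

text \<open>There is one factor \<open>exp (- 1 / ((n + 1) t))\<close> for each face of the box,
  with \<open>t\<close> the signed distance to that face. For growing \<open>n\<close> every factor
  tends to 1 inside the box. The faces are written as inner products with scaled basis vectors to
  match \<open>C_k_flat\<close>.\<close>

definition bump :: "nat \<Rightarrow> 'a::euclidean_space \<Rightarrow> 'a \<Rightarrow> 'a \<Rightarrow> real" where
  "bump n a b x = (\<Prod>i\<in>Basis. flat_fun 1 (x \<bullet> (real (Suc n) *\<^sub>R i) + - real (Suc n) * (a \<bullet> i)) *
    flat_fun 1 (x \<bullet> (- real (Suc n) *\<^sub>R i) + real (Suc n) * (b \<bullet> i)))"

lemma flat_1: "flat_fun 1 t = (if 0 < t then exp (- (1 / t)) else 0)"
  by (simp add: flat_fun_def)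

lemma bump_eq:
  "bump n a b x = (\<Prod>i\<in>Basis. flat_fun 1 (real (Suc n) * (x \<bullet> i - a \<bullet> i)) * flat_fun 1 (real (Suc n) * (b \<bullet> i - x \<bullet> i)))"
  unfolding bump_def by (simp add: algebra_simps)

lemma bump_nonneg: "0 \<le> bump n a b x" and bump_le_1: "bump n a b x \<le> 1"
  unfolding bump_def by (auto intro!: prod_nonneg prod_le_1 mult_le_one simp: flat_1)

lemma bump_outside: "x \<notin> box a b \<Longrightarrow> bump n a b x = 0"
proof -
  assume "x \<notin> box a b"
  then obtain i where i: "i \<in> Basis" "x \<bullet> i - a \<bullet> i \<le> 0 \<or> b \<bullet> i - x \<bullet> i \<le> 0"
    by (force simp: box_def not_less)
  have "flat_fun 1 (real (Suc n) * t) = 0" if "t \<le> 0" for t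
    using mult_nonneg_nonpos[of "real (Suc n)" t] that by (simp add: flat_1)
  with i show "bump n a b x = 0"
    unfolding bump_eq by (intro prod_zero) (auto intro!: bexI[of _ i])
qed

lemma bump_pos: "x \<in> box a b \<Longrightarrow> 0 < bump n a b x"
  unfolding bump_eq by (auto intro!: prod_pos mult_pos_pos simp: box_def flat_1 zero_less_mult_iff)

lemma bump_limit:
  fixes a b x :: "'a::euclidean_space"
  shows "(\<lambda>n. bump n a b x) \<longlonglongrightarrow> indicator (box a b) x"
proof (cases "x \<in> box a b")
  case False
  then show ?thesis by (simp add: bump_outside)
next
  case True
  have lim: "(\<lambda>n. flat_fun 1 (real (Suc n) * t)) \<longlonglongrightarrow> 1" if "0 < t" for t
  proof -
    have "(\<lambda>n. exp (- ((1 / t) / real (Suc n)))) \<longlonglongrightarrow> exp (- 0)"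
      by (intro tendsto_intros LIMSEQ_Suc[OF lim_const_over_n])
    then show ?thesis using that by (simp add: flat_1 mult.commute)
  qed
  have "(\<lambda>n. bump n a b x) \<longlonglongrightarrow> (\<Prod>i\<in>(Basis::'a set). 1 * 1)"
    unfolding bump_eq by (intro tendsto_intros lim) (use True in \<open>auto simp: box_def\<close>)
  then show ?thesis using True by simp
qed

lemma C_k_bump: "C_k k (bump n a b)"
  unfolding bump_def[abs_def] by (intro C_k_prod C_k_mult C_k_flat)

lemma bump_test_function:
  assumes "cbox a b \<subseteq> \<Omega>"
  shows "bump n a b \<in> test_functions \<Omega>"
proof -
  have "{x. bump n a b x \<noteq> 0} \<subseteq> cbox a b"
    using bump_outside[of _ a b n] box_subset_cbox[of a b] by blast
  then have sub: "closure {x. bump n a b x \<noteq> 0} \<subseteq> cbox a b"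
    by (rule closure_minimal) (rule closed_cbox)
  then have "compact (closure {x. bump n a b x \<noteq> 0})"
    using compact_cbox by (metis bounded_subset bounded_cbox compact_eq_bounded_closed closed_closure)
  then show ?thesis
    unfolding test_functions_def using sub assms C_k_bump by blast
qed

section \<open>Gradients and supports of test functions\<close>

definition grad :: "('a::euclidean_space \<Rightarrow> real) \<Rightarrow> 'a \<Rightarrow> 'a" where
  "grad f x = (\<Sum>b\<in>Basis. frechet_derivative f (at x) b *\<^sub>R b)"

lemma grad_inner_Basis: "b \<in> Basis \<Longrightarrow> grad f x \<bullet> b = frechet_derivative f (at x) b"
  unfolding grad_def by (simp add: inner_sum_left_Basis)

lemma has_derivative_grad:
  assumes "f differentiable (at x)"
  shows "(f has_derivative (\<lambda>h. grad f x \<bullet> h)) (at x)"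
proof -
  have d: "(f has_derivative frechet_derivative f (at x)) (at x)"
    using assms frechet_derivative_works by blast
  interpret bounded_linear "frechet_derivative f (at x)" by (rule has_derivative_bounded_linear[OF d])
  have "frechet_derivative f (at x) h = grad f x \<bullet> h" for h
  proof -
    have "frechet_derivative f (at x) h = frechet_derivative f (at x) (\<Sum>b\<in>Basis. (h \<bullet> b) *\<^sub>R b)"
      by (simp add: euclidean_representation)
    also have "\<dots> = grad f x \<bullet> h"
    proof -
      have "frechet_derivative f (at x) (\<Sum>b\<in>Basis. (h \<bullet> b) *\<^sub>R b) =
          (\<Sum>b\<in>Basis. (h \<bullet> b) * frechet_derivative f (at x) b)"
        by (simp add: sum scale)
      also have "\<dots> = (\<Sum>b\<in>Basis. (grad f x \<bullet> b) * (h \<bullet> b))"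
        by (intro sum.cong refl) (simp add: grad_inner_Basis)
      also have "\<dots> = grad f x \<bullet> h" by (rule euclidean_inner[symmetric])
      finally show ?thesis .
    qed
    finally show ?thesis .
  qed
  then have "frechet_derivative f (at x) = (\<lambda>h. grad f x \<bullet> h)" by (rule ext)
  with d show ?thesis by simp
qed

lemma grad_eqI:
  assumes "(f has_derivative (\<lambda>h. v \<bullet> h)) (at x)"
  shows "grad f x = v"
proof (rule euclidean_eqI)
  fix b :: 'a assume "b \<in> Basis"
  then show "grad f x \<bullet> b = v \<bullet> b"
    using fun_cong[OF frechet_derivative_at[OF assms], of b] by (simp add: grad_inner_Basis)
qed

lemma test_function_C_k: "\<phi> \<in> test_functions \<Omega> \<Longrightarrow> C_k k \<phi>"
  unfolding test_functions_def by blast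

lemma test_function_has_derivative:
  assumes "\<phi> \<in> test_functions \<Omega>"
  shows "(\<phi> has_derivative (\<lambda>h. grad \<phi> x \<bullet> h)) (at x)"
  by (rule has_derivative_grad) (use test_function_C_k[OF assms, of "Suc 0"] in auto)

lemma test_function_continuous:
  assumes "\<phi> \<in> test_functions \<Omega>"
  shows "continuous_on UNIV \<phi>" "continuous_on UNIV (grad \<phi>)"
proof -
  show "continuous_on UNIV \<phi>" using C_k_continuous test_function_C_k[OF assms] by blast
  have "continuous_on UNIV (\<lambda>x. frechet_derivative \<phi> (at x) b)" if "b \<in> Basis" for b
    using test_function_C_k[OF assms, of "Suc 0"] that by auto
  then show "continuous_on UNIV (grad \<phi>)"
    unfolding grad_def[abs_def] by (intro continuous_intros) auto
qed

lemma test_function_support: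
  assumes "\<phi> \<in> test_functions \<Omega>"
  obtains K where "compact K" "K \<subseteq> \<Omega>" "\<And>x. x \<notin> K \<Longrightarrow> \<phi> x = 0 \<and> grad \<phi> x = 0"
proof
  let ?K = "closure {x. \<phi> x \<noteq> 0}"
  show "compact ?K" "?K \<subseteq> \<Omega>" using assms unfolding test_functions_def by auto
  fix x assume x: "x \<notin> ?K"
  have "((\<lambda>_. 0) has_derivative (\<lambda>h. 0 \<bullet> h)) (at x)" by simp
  then have "(\<phi> has_derivative (\<lambda>h. 0 \<bullet> h)) (at x)"
  proof (rule has_derivative_transform_within_open)
    show "open (- ?K)" by (simp add: open_Compl)
    show "x \<in> - ?K" using x by simp
    show "0 = \<phi> y" if "y \<in> - ?K" for y
      using that closure_subset[of "{x. \<phi> x \<noteq> 0}"] by auto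
  qed
  then have "grad \<phi> x = 0" by (rule grad_eqI)
  moreover have "\<phi> x = 0" using x closure_subset[of "{x. \<phi> x \<noteq> 0}"] by auto
  ultimately show "\<phi> x = 0 \<and> grad \<phi> x = 0" by simp
qed

lemma test_function_lincomb:
  assumes "\<phi> \<in> test_functions \<Omega>" "\<psi> \<in> test_functions \<Omega>"
  shows "(\<lambda>x. a * \<phi> x + b * \<psi> x) \<in> test_functions \<Omega>"
    "grad (\<lambda>x. a * \<phi> x + b * \<psi> x) x = a *\<^sub>R grad \<phi> x + b *\<^sub>R grad \<psi> x"
proof -
  let ?S = "\<lambda>f::'a \<Rightarrow> real. {x. f x \<noteq> 0}"
  let ?f = "\<lambda>x. a * \<phi> x + b * \<psi> x"
  have sub: "closure (?S ?f) \<subseteq> closure (?S \<phi>) \<union> closure (?S \<psi>)"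
    unfolding closure_Un[symmetric] by (rule closure_mono) auto
  have c: "compact (closure (?S \<phi>))" "compact (closure (?S \<psi>))" "closure (?S \<phi>) \<subseteq> \<Omega>" "closure (?S \<psi>) \<subseteq> \<Omega>"
    using assms unfolding test_functions_def by blast+
  have "compact ((closure (?S \<phi>) \<union> closure (?S \<psi>)) \<inter> closure (?S ?f))"
    by (rule compact_Int_closed[OF compact_Un[OF c(1,2)] closed_closure])
  then have "compact (closure (?S ?f))" by (simp only: Int_absorb1[OF sub])
  moreover have "closure (?S ?f) \<subseteq> \<Omega>" using sub c(3,4) by blast
  moreover have "C_k k ?f" for k
    by (rule C_k_add[OF C_k_mult[OF C_k_const test_function_C_k[OF assms(1)]]
          C_k_mult[OF C_k_const test_function_C_k[OF assms(2)]]])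
  ultimately show "?f \<in> test_functions \<Omega>"
    unfolding test_functions_def by blast
  have "(?f has_derivative (\<lambda>h. a * (grad \<phi> x \<bullet> h) + b * (grad \<psi> x \<bullet> h))) (at x)"
    by (rule has_derivative_add[OF has_derivative_mult_right[OF test_function_has_derivative[OF assms(1)]]
          has_derivative_mult_right[OF test_function_has_derivative[OF assms(2)]]])
  then show "grad ?f x = a *\<^sub>R grad \<phi> x + b *\<^sub>R grad \<psi> x"
    by (intro grad_eqI) (simp add: inner_add_left)
qed

subsection \<open>Weak gradients\<close>

lemma compact_support_bounded:
  fixes f :: "'a::euclidean_space \<Rightarrow> 'b::euclidean_space"
  assumes "continuous_on UNIV f" "compact K" "\<And>x. x \<notin> K \<Longrightarrow> f x = 0"
  obtains B where "0 < B" "\<And>x. norm (f x) \<le> B"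
proof -
  have "bounded (f ` K)"
    by (intro compact_imp_bounded compact_continuous_image continuous_on_subset[OF assms(1)] assms(2)) auto
  then obtain B where "0 < B" "\<And>x. x \<in> K \<Longrightarrow> norm (f x) \<le> B" unfolding bounded_pos by auto
  then show ?thesis using that[of B] assms(3) by (metis less_imp_le norm_zero)
qed

lemma compact_support_integral:
  fixes f :: "'a::euclidean_space \<Rightarrow> 'b::euclidean_space"
  assumes f: "continuous_on UNIV f" and K: "compact K" "\<And>x. x \<notin> K \<Longrightarrow> f x = 0"
  shows "integrable lborel f"
    "open \<Omega> \<Longrightarrow> K \<subseteq> \<Omega> \<Longrightarrow> integrable (lebesgue_on \<Omega>) f"
    "open \<Omega> \<Longrightarrow> K \<subseteq> \<Omega> \<Longrightarrow> (LINT x|lebesgue_on \<Omega>. f x) = (LINT x|lborel. f x)"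
proof -
  have m: "f \<in> borel_measurable lborel" using borel_measurable_continuous_onI[OF f] by simp
  have "(\<lambda>x. indicator K x *\<^sub>R f x) = f" using K(2) by (auto simp: indicator_def fun_eq_iff)
  then show 1: "integrable lborel f"
    using borel_integrable_compact[OF K(1) continuous_on_subset[OF f subset_UNIV]] by simp
  assume \<Omega>: "open \<Omega>" "K \<subseteq> \<Omega>"
  have eq: "(\<lambda>x. indicator \<Omega> x *\<^sub>R f x) = f" using K(2) \<Omega>(2) by (auto simp: indicator_def fun_eq_iff)
  have s: "\<Omega> \<inter> space lebesgue \<in> sets lebesgue" using \<Omega>(1) by simp
  show "integrable (lebesgue_on \<Omega>) f"
    by (subst integrable_restrict_space[OF s]) (simp add: eq integrable_completion[OF m] 1)
  show "(LINT x|lebesgue_on \<Omega>. f x) = (LINT x|lborel. f x)"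
    by (subst integral_restrict_space[OF s]) (simp only: eq integral_completion[OF m])
qed

lemma locally_integrable_indicator:
  assumes "locally_integrable_on u \<Omega>" "compact K" "K \<subseteq> \<Omega>"
  shows "integrable lebesgue (\<lambda>x. indicator K x *\<^sub>R u x)"
proof -
  have sK: "K \<inter> space lebesgue \<in> sets lebesgue" using borel_compact[OF assms(2)] by simp
  show ?thesis
    using assms unfolding locally_integrable_on_def by (simp add: integrable_restrict_space[OF sK, symmetric])
qed

lemma locally_integrable_times:
  fixes u :: "'a::euclidean_space \<Rightarrow> 'b::euclidean_space" and f :: "'a \<Rightarrow> real"
  assumes u: "locally_integrable_on u \<Omega>" and \<Omega>: "open \<Omega>"
    and f: "continuous_on UNIV f" and K: "compact K" "K \<subseteq> \<Omega>" "\<And>x. x \<notin> K \<Longrightarrow> f x = 0"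
  shows "integrable (lebesgue_on \<Omega>) (\<lambda>x. f x *\<^sub>R u x)"
proof -
  obtain B where B: "0 < B" "\<And>x. norm (f x) \<le> B" using compact_support_bounded[OF f K(1,3)] by blast
  have uK: "integrable lebesgue (\<lambda>x. indicator K x *\<^sub>R u x)"
    by (rule locally_integrable_indicator[OF u K(1,2)])
  have "integrable lebesgue (\<lambda>x. f x *\<^sub>R (indicator K x *\<^sub>R u x))"
  proof (rule Bochner_Integration.integrable_bound)
    show "integrable lebesgue (\<lambda>x. B *\<^sub>R (indicator K x *\<^sub>R u x))"
      by (rule integrable_scaleR_right) (rule uK)
    have "f \<in> borel_measurable lebesgue"
      using borel_measurable_continuous_onI[OF f] by (simp add: measurable_completion)
    then show "(\<lambda>x. f x *\<^sub>R (indicator K x *\<^sub>R u x)) \<in> borel_measurable lebesgue"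
      by (rule borel_measurable_scaleR[OF _ borel_measurable_integrable[OF uK]])
    show "AE x in lebesgue. norm (f x *\<^sub>R indicator K x *\<^sub>R u x) \<le> norm (B *\<^sub>R indicator K x *\<^sub>R u x)"
      using B by (intro AE_I2) (auto simp: indicator_def intro!: mult_right_mono)
  qed
  moreover have "(\<lambda>x. f x *\<^sub>R (indicator K x *\<^sub>R u x)) = (\<lambda>x. indicator \<Omega> x *\<^sub>R (f x *\<^sub>R u x))"
    using K(2,3) by (auto simp: indicator_def fun_eq_iff)
  moreover have "\<Omega> \<inter> space lebesgue \<in> sets lebesgue" using \<Omega> by simp
  ultimately show ?thesis by (subst integrable_restrict_space) auto
qed

lemma locally_integrable_component:
  "locally_integrable_on g \<Omega> \<Longrightarrow> locally_integrable_on (\<lambda>x. g x \<bullet> b) \<Omega>"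
  unfolding locally_integrable_on_def by auto

text \<open>The bumps on a closed box are admissible test functions, are bounded by 1 and converge
  to the indicator of the open box. Dominated convergence therefore carries the hypothesis over to
  boxes; their frontiers are null sets.\<close>

lemma integrals_box_zero:
  fixes g :: "'a::euclidean_space \<Rightarrow> real"
  assumes \<Omega>: "open \<Omega>" and g: "locally_integrable_on g \<Omega>"
    and zero: "\<And>\<phi>. \<phi> \<in> test_functions \<Omega> \<Longrightarrow> (LINT x|lebesgue_on \<Omega>. g x * \<phi> x) = 0"
    and ab: "cbox a b \<subseteq> \<Omega>"
  shows "(LINT x|lebesgue. indicator (cbox a b) x * g x) = 0"
proof -
  have int: "integrable lebesgue (\<lambda>x. indicator (cbox a b) x * g x)"
    using locally_integrable_indicator[OF g compact_cbox ab] by simp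
  have m: "(\<lambda>x. indicator (cbox a b) x * g x) \<in> borel_measurable lebesgue" using int by auto
  have mb: "bump n a b \<in> borel_measurable lebesgue" for n
    by (intro measurable_completion) (simp add: borel_measurable_continuous_onI C_k_continuous[OF C_k_bump])
  have sub: "box a b \<subseteq> cbox a b" by (rule box_subset_cbox)
  have lim: "(\<lambda>n. LINT x|lebesgue. (indicator (cbox a b) x * g x) * bump n a b x) \<longlonglongrightarrow>
      (LINT x|lebesgue. (indicator (cbox a b) x * g x) * indicator (box a b) x)"
  proof (rule integral_dominated_convergence[where w="\<lambda>x. norm (indicator (cbox a b) x * g x)"])
    show "AE x in lebesgue. (\<lambda>n. indicator (cbox a b) x * g x * bump n a b x) \<longlonglongrightarrow>
        indicator (cbox a b) x * g x * indicator (box a b) x"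
      by (intro AE_I2 tendsto_intros bump_limit)
    show "AE x in lebesgue. norm (indicator (cbox a b) x * g x * bump n a b x) \<le> norm (indicator (cbox a b) x * g x)" for n
      using bump_nonneg[of n a b] bump_le_1[of n a b]
      by (intro AE_I2) (auto simp: abs_mult intro!: mult_left_le)
    show "(\<lambda>x. indicator (cbox a b) x * g x * indicator (box a b) x) \<in> borel_measurable lebesgue"
      by (intro borel_measurable_times m borel_measurable_indicator) simp
    show "(\<lambda>x. indicator (cbox a b) x * g x * bump n a b x) \<in> borel_measurable lebesgue" for n
      by (intro borel_measurable_times m mb)
  qed (use int in auto)
  have z: "(LINT x|lebesgue. (indicator (cbox a b) x * g x) * bump n a b x) = 0" for n
  proof -
    have "(\<lambda>x. indicator (cbox a b) x * g x * bump n a b x) = (\<lambda>x. indicator \<Omega> x *\<^sub>R (g x * bump n a b x))"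
    proof
      fix x
      show "indicator (cbox a b) x * g x * bump n a b x = indicator \<Omega> x *\<^sub>R (g x * bump n a b x)"
      proof (cases "x \<in> box a b")
        case True
        then have "x \<in> cbox a b" "x \<in> \<Omega>" using sub ab by blast+
        then show ?thesis by simp
      qed (simp add: bump_outside)
    qed
    then have "(LINT x|lebesgue. (indicator (cbox a b) x * g x) * bump n a b x) = (LINT x|lebesgue_on \<Omega>. g x * bump n a b x)"
      using \<Omega> by (subst integral_restrict_space) auto
    then show ?thesis using zero[OF bump_test_function[OF ab]] by simp
  qed
  have "(LINT x|lebesgue. (indicator (cbox a b) x * g x) * indicator (box a b) x) = 0"
    by (rule LIMSEQ_unique[OF lim]) (simp only: z tendsto_const)
  moreover have "(LINT x|lebesgue. (indicator (cbox a b) x * g x) * indicator (box a b) x) =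
      (LINT x|lebesgue. indicator (cbox a b) x * g x)"
  proof (rule integral_cong_AE)
    have "negligible (cbox a b - box a b)"
      by (rule negligible_subset[OF negligible_frontier_interval]) auto
    then have "AE x in lebesgue. x \<notin> cbox a b - box a b"
      by (intro AE_not_in) (simp add: negligible_iff_null_sets)
    then show "AE x in lebesgue. indicator (cbox a b) x * g x * indicator (box a b) x = indicator (cbox a b) x * g x"
      by eventually_elim (auto simp: indicator_def)
    show "(\<lambda>x. indicator (cbox a b) x * g x * indicator (box a b) x) \<in> borel_measurable lebesgue"
      by (intro borel_measurable_times m borel_measurable_indicator) simp
  qed (rule m)
  ultimately show ?thesis by simp
qed

text \<open>A locally integrable function is almost everywhere the limit of its averages over
  shrinking cubes, and by \<open>integrals_box_zero\<close> these averages vanish. The argument is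
  run separately on countably many closed boxes that cover \<Omega>, where the function cut off to
  the box is integrable on the whole space.\<close>

lemma fundamental_lemma_calculus_of_variations:
  fixes g :: "'a::euclidean_space \<Rightarrow> real"
  assumes \<Omega>: "open \<Omega>" and g: "locally_integrable_on g \<Omega>"
    and zero: "\<And>\<phi>. \<phi> \<in> test_functions \<Omega> \<Longrightarrow> (LINT x|lebesgue_on \<Omega>. g x * \<phi> x) = 0"
  shows "AE x in lebesgue_on \<Omega>. g x = 0"
proof -
  obtain \<D> where \<D>: "countable \<D>" "\<D> \<subseteq> Pow \<Omega>" "\<And>X. X \<in> \<D> \<Longrightarrow> \<exists>a b. X = cbox a b" "\<Union>\<D> = \<Omega>"
    using open_countable_Union_open_cbox[OF \<Omega>] by metis
  have "AE x in lebesgue. x \<in> C \<longrightarrow> g x = 0" if C: "C \<in> \<D>" for C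
  proof -
    obtain a b where ab: "C = cbox a b" using \<D>(3)[OF C] by blast
    have sub: "cbox a b \<subseteq> \<Omega>" using \<D>(2) C ab by blast
    define h where "h = (\<lambda>x. indicator (cbox a b) x * g x)"
    have inth: "integrable lebesgue h"
      using locally_integrable_indicator[OF g compact_cbox sub] unfolding h_def by simp
    have si: "set_integrable lebesgue (cbox c d) h" for c d
      using integrable_mult_indicator[OF _ inth, of "cbox c d"] unfolding set_integrable_def by simp
    have h0: "integral (cbox c d) h = 0" for c d
    proof -
      \<comment> \<open>Boxes are closed under intersection, so the cut-off function has integral 0
        over every box, not just over those inside \<Omega>.\<close>
      obtain p q where pq: "cbox c d \<inter> cbox a b = cbox p q" using Int_interval[of c d a b] by blast
      have "integral (cbox c d) h = (LINT x:cbox c d|lebesgue. h x)"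
        using set_lebesgue_integral_eq_integral(2)[OF si] by simp
      also have "\<dots> = (LINT x|lebesgue. indicator (cbox p q) x * g x)"
        unfolding set_lebesgue_integral_def h_def pq[symmetric]
        by (intro Bochner_Integration.integral_cong) (auto simp: indicator_def)
      also have "\<dots> = 0"
        by (rule integrals_box_zero[OF \<Omega> g zero]) (use pq sub in auto)
      finally show ?thesis .
    qed
    have "h integrable_on cbox c d" for c d
      by (rule set_lebesgue_integral_eq_integral(1)[OF si])
    then obtain N where N: "negligible N"
      "\<And>x e. x \<notin> N \<Longrightarrow> 0 < e \<Longrightarrow> \<exists>d>0. \<forall>k. 0 < k \<and> k < d \<longrightarrow>
        norm (integral (cbox x (x + k *\<^sub>R One)) h /\<^sub>R k ^ DIM('a) - h x) < e"
      using integrable_ccontinuous_explicit[of h] by blast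
    have "h x = 0" if "x \<notin> N" for x
    proof (rule ccontr)
      assume "h x \<noteq> 0"
      then have "0 < \<bar>h x\<bar>" by simp
      from N(2)[OF that this] obtain d where d: "0 < d"
        "\<And>k. 0 < k \<Longrightarrow> k < d \<Longrightarrow> norm (integral (cbox x (x + k *\<^sub>R One)) h /\<^sub>R k ^ DIM('a) - h x) < \<bar>h x\<bar>"
        by blast
      \<comment> \<open>The average is 0, so its distance to \<open>h x\<close> is exactly
        \<open>\<bar>h x\<bar>\<close> and cannot be smaller.\<close>
      from d(2)[of "d/2"] d(1) show False by (simp add: h0)
    qed
    moreover have "AE x in lebesgue. x \<notin> N"
      using N(1) by (intro AE_not_in) (simp add: negligible_iff_null_sets)
    ultimately have "AE x in lebesgue. h x = 0" by (auto elim: eventually_mono)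
    then show ?thesis by eventually_elim (auto simp: h_def ab)
  qed
  then have "AE x in lebesgue. \<forall>C\<in>\<D>. x \<in> C \<longrightarrow> g x = 0"
    using \<D>(1) by (subst AE_ball_countable) auto
  then have "AE x in lebesgue. x \<in> \<Omega> \<longrightarrow> g x = 0"
    by eventually_elim (use \<D>(4) in auto)
  then show ?thesis
    using \<Omega> by (subst AE_restrict_space_iff) auto
qed

text \<open>Each component of the difference is orthogonal to all test functions. This is what makes
  statements about the choice \<open>weak_grad\<close> independent of the representative.\<close>

lemma weak_gradient_unique:
  fixes u :: "'a::euclidean_space \<Rightarrow> real"
  assumes \<Omega>: "open \<Omega>" and g: "has_weak_gradient u g \<Omega>" and h: "has_weak_gradient u h \<Omega>"
  shows "AE x in lebesgue_on \<Omega>. g x = h x"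
proof -
  have loc: "locally_integrable_on g \<Omega>" "locally_integrable_on h \<Omega>"
    using g h unfolding has_weak_gradient_def by blast+
  have "AE x in lebesgue_on \<Omega>. (g x - h x) \<bullet> b = 0" if b: "b \<in> Basis" for b
  proof (rule fundamental_lemma_calculus_of_variations[OF \<Omega>])
    show "locally_integrable_on (\<lambda>x. (g x - h x) \<bullet> b) \<Omega>"
      using loc unfolding locally_integrable_on_def by auto
    fix \<phi> assume \<phi>: "\<phi> \<in> test_functions \<Omega>"
    obtain K where K: "compact K" "K \<subseteq> \<Omega>" "\<And>x. x \<notin> K \<Longrightarrow> \<phi> x = 0 \<and> grad \<phi> x = 0"
      using test_function_support[OF \<phi>] by blast
    have int: "integrable (lebesgue_on \<Omega>) (\<lambda>x. (k x \<bullet> b) * \<phi> x)" if "locally_integrable_on k \<Omega>" for k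
      using locally_integrable_times[OF locally_integrable_component[OF that, of b] \<Omega> test_function_continuous(1)[OF \<phi>] K(1,2)] K(3)
      by (simp add: mult.commute)
    have "(LINT x|lebesgue_on \<Omega>. ((g x - h x) \<bullet> b) * \<phi> x) =
        (LINT x|lebesgue_on \<Omega>. (g x \<bullet> b) * \<phi> x) - (LINT x|lebesgue_on \<Omega>. (h x \<bullet> b) * \<phi> x)"
      using int[OF loc(1)] int[OF loc(2)] by (simp add: inner_diff_left left_diff_distrib)
    also have "\<dots> = 0"
    proof -
      have "- (LINT x|lebesgue_on \<Omega>. (g x \<bullet> b) * \<phi> x) = - (LINT x|lebesgue_on \<Omega>. (h x \<bullet> b) * \<phi> x)"
        using bspec[OF bspec[OF conjunct2[OF conjunct2[OF g[unfolded has_weak_gradient_def]]] \<phi>] b]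
          bspec[OF bspec[OF conjunct2[OF conjunct2[OF h[unfolded has_weak_gradient_def]]] \<phi>] b]
        by (rule trans[OF sym])
      then show ?thesis by simp
    qed
    finally show "(LINT x|lebesgue_on \<Omega>. ((g x - h x) \<bullet> b) * \<phi> x) = 0" .
  qed
  then have "AE x in lebesgue_on \<Omega>. \<forall>b\<in>Basis. (g x - h x) \<bullet> b = 0"
    by (intro AE_finite_allI) auto
  then show ?thesis
    by eventually_elim (rule euclidean_eqI, simp add: inner_diff_left)
qed

text \<open>Translation invariance of Lebesgue measure gives every difference quotient of
  \<open>f\<close> in direction \<open>b\<close> the integral 0. The quotients converge to the
  directional derivative and are dominated by the Lipschitz constant of \<open>f\<close> times the
  indicator of a fixed ball.\<close>

lemma integral_derivative_compact_support:
  fixes f :: "'a::euclidean_space \<Rightarrow> real"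
  assumes f: "\<And>x. (f has_derivative (\<lambda>h. G x \<bullet> h)) (at x)" and G: "continuous_on UNIV G"
    and K: "compact K" "\<And>x. x \<notin> K \<Longrightarrow> f x = 0 \<and> G x = 0"
  shows "(LINT x|lborel. G x \<bullet> b) = 0"
proof -
  have cf: "continuous_on UNIV f"
    by (intro continuous_at_imp_continuous_on ballI has_derivative_continuous[OF f])
  have [measurable]: "f \<in> borel_measurable borel" "G \<in> borel_measurable borel"
    using cf G by (auto intro: borel_measurable_continuous_onI)
  have intf: "integrable lborel f"
    by (rule compact_support_integral(1)[OF cf K(1)]) (use K(2) in blast)
  obtain L where L: "0 < L" "\<And>x. norm (G x) \<le> L"
    using compact_support_bounded[OF G K(1)] K(2) by blast
  obtain R where R: "0 < R" "\<And>x. x \<in> K \<Longrightarrow> norm x \<le> R"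
    using compact_imp_bounded[OF K(1)] bounded_pos by metis
  have lip: "\<bar>f x - f y\<bar> \<le> L * norm (x - y)" for x y
  proof -
    have "norm (f x - f y) \<le> L * norm (x - y)"
    proof (rule differentiable_bound[where S=UNIV and f'="\<lambda>x h. G x \<bullet> h"])
      show "onorm (\<lambda>h. G x \<bullet> h) \<le> L" for x
      proof (rule onorm_le)
        fix h
        have "norm (G x \<bullet> h) \<le> norm (G x) * norm h" using Cauchy_Schwarz_ineq2[of "G x" h] by simp
        also have "\<dots> \<le> L * norm h" by (intro mult_right_mono L) simp
        finally show "norm (G x \<bullet> h) \<le> L * norm h" .
      qed
    qed (use f in auto)
    then show ?thesis by simp
  qed
  define D where "D = (\<lambda>n x. (f (x + (1 / real (Suc n)) *\<^sub>R b) - f x) * real (Suc n))"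
  have lim_D: "(\<lambda>n. LINT x|lborel. D n x) \<longlonglongrightarrow> (LINT x|lborel. G x \<bullet> b)"
  \<comment> \<open>Each shift has length at most \<open>norm b\<close>, so all quotients vanish
    outside the ball whose radius exceeds the bound \<open>R\<close> of the support by
    \<open>norm b\<close>.\<close>
  proof (rule integral_dominated_convergence[where w="\<lambda>x. (L * norm b) * indicator (cball 0 (R + norm b)) x"])
    have "emeasure lborel (cball (0::'a) (R + norm b)) < \<infinity>"
      by (rule emeasure_bounded_finite) simp
    then show "integrable lborel (\<lambda>x::'a. (L * norm b) * indicator (cball 0 (R + norm b)) x)"
      by (intro integrable_mult_right integrable_real_indicator) auto
    show "AE x in lborel. norm (D n x) \<le> L * norm b * indicator (cball 0 (R + norm b)) x" for n
    proof (rule AE_I2)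
      fix x :: 'a
      let ?y = "x + (1 / real (Suc n)) *\<^sub>R b"
      have bn: "norm ((1 / real (Suc n)) *\<^sub>R b) \<le> norm b"
        by (simp add: divide_le_eq mult_le_cancel_left1)
      show "norm (D n x) \<le> L * norm b * indicator (cball 0 (R + norm b)) x"
      proof (cases "norm x \<le> R + norm b")
        case True
        have "norm (D n x) = \<bar>f ?y - f x\<bar> * real (Suc n)"
          unfolding D_def by (simp add: abs_mult)
        also have "\<dots> \<le> (L * norm (?y - x)) * real (Suc n)"
          by (intro mult_right_mono lip) simp
        also have "\<dots> = L * norm b" by simp
        finally show ?thesis using True by simp
      next
        case False
        have "x \<notin> K" using R(2)[of x] False norm_ge_zero[of b] by linarith
        moreover have "?y \<notin> K"
        proof
          assume "?y \<in> K"
          have "norm x \<le> norm ?y + norm ((1 / real (Suc n)) *\<^sub>R b)"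
            by (metis add_diff_cancel_right' norm_triangle_ineq4)
          then show False using R(2)[OF \<open>?y \<in> K\<close>] bn False by linarith
        qed
        ultimately show ?thesis using K(2) L(1) by (simp add: D_def)
      qed
    qed
    show "AE x in lborel. (\<lambda>n. D n x) \<longlonglongrightarrow> G x \<bullet> b"
    proof (rule AE_I2)
      fix x :: 'a
      have "((\<lambda>t. x + t *\<^sub>R b) has_derivative (\<lambda>t. t *\<^sub>R b)) (at 0)"
        by (auto intro!: derivative_eq_intros)
      then have "((\<lambda>t. f (x + t *\<^sub>R b)) has_derivative (\<lambda>t. G (x + 0 *\<^sub>R b) \<bullet> (t *\<^sub>R b))) (at 0)"
        by (rule has_derivative_compose[OF _ f])
      moreover have "(\<lambda>t. G (x + 0 *\<^sub>R b) \<bullet> (t *\<^sub>R b)) = (*) (G x \<bullet> b)" by (auto simp: fun_eq_iff)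
      ultimately have "((\<lambda>t. f (x + t *\<^sub>R b)) has_real_derivative G x \<bullet> b) (at 0)"
        by (simp add: has_field_derivative_def)
      then have lim: "((\<lambda>t. (f (x + t *\<^sub>R b) - f x) / t) \<longlongrightarrow> G x \<bullet> b) (at 0)"
        by (simp add: has_field_derivative_iff)
      have "filterlim (\<lambda>n. 1 / real (Suc n)) (at 0) sequentially"
        unfolding filterlim_at using LIMSEQ_Suc[OF lim_const_over_n[of 1]] by auto
      from filterlim_compose[OF lim this]
      show "(\<lambda>n. D n x) \<longlonglongrightarrow> G x \<bullet> b" by (simp add: D_def)
    qed
    show "D n \<in> borel_measurable lborel" for n unfolding D_def by measurable
  qed measurable
  have zero: "(LINT x|lborel. D n x) = 0" for n
  proof -
    define c where "c = (1 / real (Suc n)) *\<^sub>R b"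
    have Dc: "D n = (\<lambda>x. (f (c + x) - f x) * real (Suc n))"
      unfolding D_def c_def by (simp add: add.commute)
    have tr: "(LINT x|lborel. f (c + x)) = (LINT x|lborel. f x)"
      by (subst (2) lborel_distr_plus[of c, symmetric]) (simp add: integral_distr)
    have "integrable (distr lborel borel ((+) c)) f" using intf by (simp add: lborel_distr_plus)
    then have "integrable lborel (\<lambda>x. f (c + x))" by (simp add: integrable_distr_eq)
    then have "(LINT x|lborel. D n x) = ((LINT x|lborel. f (c + x)) - (LINT x|lborel. f x)) * real (Suc n)"
      using intf unfolding Dc by simp
    then show ?thesis using tr by simp
  qed
  show ?thesis by (rule LIMSEQ_unique[OF lim_D]) (simp only: zero tendsto_const)
qed

subsection \<open>Square-integrable functions\<close>

lemma test_function_integrals: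
  assumes \<Omega>: "open \<Omega>" and \<phi>: "\<phi> \<in> test_functions \<Omega>"
  shows "integrable lborel \<phi>" "integrable lborel (\<lambda>x. (norm (grad \<phi> x))\<^sup>2)"
    "integrable (lebesgue_on \<Omega>) \<phi>" "integrable (lebesgue_on \<Omega>) (\<lambda>x. (norm (grad \<phi> x))\<^sup>2)"
    "integrable (lebesgue_on \<Omega>) (\<lambda>x. (norm (\<phi> x))\<^sup>2)"
    "(LINT x|lebesgue_on \<Omega>. \<phi> x) = (LINT x|lborel. \<phi> x)"
    "(LINT x|lebesgue_on \<Omega>. (norm (\<phi> x))\<^sup>2) = (LINT x|lborel. (norm (\<phi> x))\<^sup>2)"
    "(LINT x|lebesgue_on \<Omega>. (norm (grad \<phi> x))\<^sup>2) = (LINT x|lborel. (norm (grad \<phi> x))\<^sup>2)"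
proof -
  obtain K where K: "compact K" "K \<subseteq> \<Omega>" "\<And>x. x \<notin> K \<Longrightarrow> \<phi> x = 0 \<and> grad \<phi> x = 0"
    using test_function_support[OF \<phi>] by blast
  note c = test_function_continuous[OF \<phi>]
  note I = compact_support_integral[OF _ K(1)]
  show "integrable lborel \<phi>" "integrable (lebesgue_on \<Omega>) \<phi>" "(LINT x|lebesgue_on \<Omega>. \<phi> x) = (LINT x|lborel. \<phi> x)"
    using I[OF c(1)] K \<Omega> by blast+
  have "continuous_on UNIV (\<lambda>x. (norm (grad \<phi> x))\<^sup>2)" by (intro continuous_intros c)
  from I[OF this] show "integrable lborel (\<lambda>x. (norm (grad \<phi> x))\<^sup>2)" "integrable (lebesgue_on \<Omega>) (\<lambda>x. (norm (grad \<phi> x))\<^sup>2)"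
    "(LINT x|lebesgue_on \<Omega>. (norm (grad \<phi> x))\<^sup>2) = (LINT x|lborel. (norm (grad \<phi> x))\<^sup>2)"
    using K \<Omega> by auto
  have "continuous_on UNIV (\<lambda>x. (norm (\<phi> x))\<^sup>2)" by (intro continuous_intros c)
  from I[OF this] show "integrable (lebesgue_on \<Omega>) (\<lambda>x. (norm (\<phi> x))\<^sup>2)"
    "(LINT x|lebesgue_on \<Omega>. (norm (\<phi> x))\<^sup>2) = (LINT x|lborel. (norm (\<phi> x))\<^sup>2)"
    using K \<Omega> by auto
qed

lemma continuous_borel_lebesgue_on:
  fixes f :: "'a::euclidean_space \<Rightarrow> 'b::euclidean_space"
  assumes "continuous_on UNIV f"
  shows "f \<in> borel_measurable (lebesgue_on \<Omega>)"
proof -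
  have "f \<in> borel_measurable lebesgue"
    by (intro measurable_completion) (simp add: borel_measurable_continuous_onI assms)
  then show ?thesis by (rule measurable_restrict_space1)
qed

lemma test_function_square_integrable:
  assumes \<Omega>: "open \<Omega>" and \<phi>: "\<phi> \<in> test_functions \<Omega>"
  shows "square_integrable_on \<phi> \<Omega>" "square_integrable_on (grad \<phi>) \<Omega>"
  unfolding square_integrable_on_def
  using test_function_integrals[OF assms] continuous_borel_lebesgue_on test_function_continuous[OF \<phi>] by auto

lemma continuous_locally_integrable:
  fixes f :: "'a::euclidean_space \<Rightarrow> 'b::euclidean_space"
  assumes f: "continuous_on UNIV f"
  shows "locally_integrable_on f \<Omega>"
  unfolding locally_integrable_on_def
proof (intro allI impI, elim conjE)
  fix K :: "'a set" assume K: "compact K"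
  have "integrable lborel (\<lambda>x. indicator K x *\<^sub>R f x)"
    by (rule borel_integrable_compact[OF K continuous_on_subset[OF f subset_UNIV]])
  then have "integrable lebesgue (\<lambda>x. indicator K x *\<^sub>R f x)"
    by (subst integrable_completion) auto
  then show "integrable (lebesgue_on K) f"
    by (subst integrable_restrict_space) (use borel_compact[OF K] in auto)
qed

text \<open>The product of two test functions has compact support, hence its derivative integrates
  to 0; the product rule is the rest.\<close>

lemma test_function_has_weak_gradient:
  assumes \<Omega>: "open \<Omega>" and \<phi>: "\<phi> \<in> test_functions \<Omega>"
  shows "has_weak_gradient \<phi> (grad \<phi>) \<Omega>"
  unfolding has_weak_gradient_def
proof (intro conjI ballI)
  show "locally_integrable_on \<phi> \<Omega>" "locally_integrable_on (grad \<phi>) \<Omega>"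
    by (intro continuous_locally_integrable test_function_continuous[OF \<phi>])+
  fix \<psi> b assume \<psi>: "\<psi> \<in> test_functions \<Omega>" and b: "b \<in> (Basis :: 'a set)"
  obtain K where K: "compact K" "K \<subseteq> \<Omega>" "\<And>x. x \<notin> K \<Longrightarrow> \<psi> x = 0 \<and> grad \<psi> x = 0"
    using test_function_support[OF \<psi>] by blast
  note c = test_function_continuous[OF \<phi>] test_function_continuous[OF \<psi>]
  have c1: "continuous_on UNIV (\<lambda>x. \<phi> x * (grad \<psi> x \<bullet> b))" and c2: "continuous_on UNIV (\<lambda>x. (grad \<phi> x \<bullet> b) * \<psi> x)"
    by (intro continuous_intros c)+
  note I1 = compact_support_integral[OF c1 K(1)] and I2 = compact_support_integral[OF c2 K(1)]
  have "(LINT x|lborel. (\<phi> x *\<^sub>R grad \<psi> x + \<psi> x *\<^sub>R grad \<phi> x) \<bullet> b) = 0"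
  proof (rule integral_derivative_compact_support[where f="\<lambda>x. \<phi> x * \<psi> x" and K=K])
    fix x
    show "((\<lambda>x. \<phi> x * \<psi> x) has_derivative (\<lambda>h. (\<phi> x *\<^sub>R grad \<psi> x + \<psi> x *\<^sub>R grad \<phi> x) \<bullet> h)) (at x)"
      using has_derivative_mult[OF test_function_has_derivative[OF \<phi>] test_function_has_derivative[OF \<psi>], of x]
      by (simp add: inner_add_left mult.commute)
  qed (use K in \<open>auto intro!: continuous_intros c\<close>)
  moreover have "(LINT x|lborel. (\<phi> x *\<^sub>R grad \<psi> x + \<psi> x *\<^sub>R grad \<phi> x) \<bullet> b) =
      (LINT x|lborel. \<phi> x * (grad \<psi> x \<bullet> b)) + (LINT x|lborel. (grad \<phi> x \<bullet> b) * \<psi> x)"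
  proof -
    have "(LINT x|lborel. \<phi> x * (grad \<psi> x \<bullet> b) + (grad \<phi> x \<bullet> b) * \<psi> x) =
      (LINT x|lborel. \<phi> x * (grad \<psi> x \<bullet> b)) + (LINT x|lborel. (grad \<phi> x \<bullet> b) * \<psi> x)"
      by (rule Bochner_Integration.integral_add) (use I1(1) I2(1) K(3) in auto)
    then show ?thesis by (simp add: inner_add_left mult.commute)
  qed
  ultimately have "(LINT x|lborel. \<phi> x * (grad \<psi> x \<bullet> b)) = - (LINT x|lborel. (grad \<phi> x \<bullet> b) * \<psi> x)"
    by simp
  then show "(LINT x|lebesgue_on \<Omega>. \<phi> x * frechet_derivative \<psi> (at x) b) = - (LINT x|lebesgue_on \<Omega>. (grad \<phi> x \<bullet> b) * \<psi> x)"
    using I1(3) I2(3) K \<Omega> by (simp flip: grad_inner_Basis[OF b])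
qed

text \<open>The derivative of \<open>(x \<bullet> b) * \<phi>^2\<close> in direction
  \<open>b\<close> integrates to 0 and contains \<open>\<phi>^2\<close>. The other term is split by
  Young's inequality with \<open>\<bar>x \<bullet> b\<bar> \<le> R\<close>. It is used to turn
  convergence of gradients into convergence of the functions.\<close>

lemma poincare_inequality:
  fixes \<Omega> :: "'a::euclidean_space set"
  assumes \<Omega>: "open \<Omega>" and \<phi>: "\<phi> \<in> test_functions \<Omega>" and R: "\<And>x. x \<in> \<Omega> \<Longrightarrow> norm x \<le> R"
  shows "(LINT x|lebesgue_on \<Omega>. (norm (\<phi> x))\<^sup>2) \<le> 4 * R\<^sup>2 * (LINT x|lebesgue_on \<Omega>. (norm (grad \<phi> x))\<^sup>2)"
proof -
  obtain K where K: "compact K" "K \<subseteq> \<Omega>" "\<And>x. x \<notin> K \<Longrightarrow> \<phi> x = 0 \<and> grad \<phi> x = 0"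
    using test_function_support[OF \<phi>] by blast
  note c = test_function_continuous[OF \<phi>]
  obtain b :: 'a where b: "b \<in> Basis" using nonempty_Basis by blast
  define A where "A = (\<lambda>x. (\<phi> x)\<^sup>2)"
  define P where "P = (\<lambda>x. 2 * (x \<bullet> b) * \<phi> x * (grad \<phi> x \<bullet> b))"
  define N where "N = (\<lambda>x. (norm (grad \<phi> x))\<^sup>2)"
  have cA: "continuous_on UNIV A" and cP: "continuous_on UNIV P" and cN: "continuous_on UNIV N"
    unfolding A_def P_def N_def by (intro continuous_intros c)+
  have int: "integrable lborel A" "integrable lborel P" "integrable lborel N"
    by (rule compact_support_integral(1)[OF _ K(1)], fact, use K(3) in \<open>simp add: A_def P_def N_def\<close>)+
  have "(LINT x|lborel. ((\<phi> x)\<^sup>2 *\<^sub>R b + (2 * (x \<bullet> b) * \<phi> x) *\<^sub>R grad \<phi> x) \<bullet> b) = 0"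
  proof (rule integral_derivative_compact_support[where f="\<lambda>x. (x \<bullet> b) * (\<phi> x * \<phi> x)" and K=K])
    fix x
    have "((\<lambda>x. x \<bullet> b) has_derivative (\<lambda>h. h \<bullet> b)) (at x)" by (auto intro!: derivative_eq_intros)
    from has_derivative_mult[OF this has_derivative_mult[OF test_function_has_derivative[OF \<phi>] test_function_has_derivative[OF \<phi>], of x]]
    show "((\<lambda>x. (x \<bullet> b) * (\<phi> x * \<phi> x)) has_derivative
        (\<lambda>h. ((\<phi> x)\<^sup>2 *\<^sub>R b + (2 * (x \<bullet> b) * \<phi> x) *\<^sub>R grad \<phi> x) \<bullet> h)) (at x)"
      by (simp add: inner_add_left power2_eq_square inner_commute algebra_simps)
  qed (use K in \<open>auto intro!: continuous_intros c\<close>)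
  moreover have "((\<phi> x)\<^sup>2 *\<^sub>R b + (2 * (x \<bullet> b) * \<phi> x) *\<^sub>R grad \<phi> x) \<bullet> b = A x + P x" for x
    using b by (simp add: A_def P_def inner_add_left)
  ultimately have "(LINT x|lborel. A x + P x) = 0" by simp
  then have "(LINT x|lborel. A x) = (LINT x|lborel. - P x)" using int by simp
  also have "\<dots> \<le> (LINT x|lborel. 1/2 * A x + 2 * R\<^sup>2 * N x)"
  proof (rule integral_mono)
    fix x
    show "- P x \<le> 1/2 * A x + 2 * R\<^sup>2 * N x"
    proof (cases "x \<in> \<Omega>")
      case False
      then have "x \<notin> K" using K(2) by blast
      from K(3)[OF this] show ?thesis by (simp add: A_def P_def N_def)
    next
      case True
      define g where "g = grad \<phi> x \<bullet> b"
      define t where "t = x \<bullet> b"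
      have "\<bar>t\<bar> \<le> R" unfolding t_def using Basis_le_norm[OF b, of x] R[OF True] by linarith
      then have "t\<^sup>2 \<le> R\<^sup>2" by (metis abs_le_square_iff abs_of_nonneg abs_ge_zero order_trans)
      moreover have "g\<^sup>2 \<le> N x"
        unfolding g_def N_def using Basis_le_norm[OF b, of "grad \<phi> x"] by (simp add: abs_le_square_iff[symmetric])
      ultimately have "t\<^sup>2 * g\<^sup>2 \<le> R\<^sup>2 * N x" by (intro mult_mono) auto
      \<comment> \<open>The weight 2 leaves one half of the square of \<phi> on the right, which is
        absorbed on the left and doubles \<open>2 * R^2\<close> to the final constant.\<close>
      moreover have "0 \<le> (\<phi> x + 2 * t * g)\<^sup>2" by simp
      then have "- (2 * t * \<phi> x * g) \<le> 1/2 * (\<phi> x)\<^sup>2 + 2 * (t\<^sup>2 * g\<^sup>2)"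
        by (simp add: power2_eq_square algebra_simps)
      ultimately show ?thesis unfolding P_def A_def g_def t_def by simp
    qed
  qed (use int in auto)
  also have "\<dots> = 1/2 * (LINT x|lborel. A x) + 2 * R\<^sup>2 * (LINT x|lborel. N x)" using int by simp
  finally have "(LINT x|lborel. A x) \<le> 4 * R\<^sup>2 * (LINT x|lborel. N x)" by simp
  then show ?thesis
    using test_function_integrals(7,8)[OF \<Omega> \<phi>] by (simp add: A_def N_def)
qed

section \<open>Pairings, convergence and completeness for square-integrable functions\<close>

lemma square_integrable_inner:
  assumes "square_integrable_on f \<Omega>" "square_integrable_on g \<Omega>"
  shows "integrable (lebesgue_on \<Omega>) (\<lambda>x. f x \<bullet> g x)"
proof (rule Bochner_Integration.integrable_bound)
  show "integrable (lebesgue_on \<Omega>) (\<lambda>x. (norm (f x))\<^sup>2 + (norm (g x))\<^sup>2)"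
    using assms unfolding square_integrable_on_def by (intro Bochner_Integration.integrable_add) auto
  show "(\<lambda>x. f x \<bullet> g x) \<in> borel_measurable (lebesgue_on \<Omega>)"
    using assms unfolding square_integrable_on_def by (intro borel_measurable_inner) auto
  show "AE x in lebesgue_on \<Omega>. norm (f x \<bullet> g x) \<le> norm ((norm (f x))\<^sup>2 + (norm (g x))\<^sup>2)"
  proof (rule AE_I2)
    fix x
    have "0 \<le> (norm (f x) - norm (g x))\<^sup>2" "0 \<le> norm (f x) * norm (g x)" by simp_all
    then have "norm (f x) * norm (g x) \<le> (norm (f x))\<^sup>2 + (norm (g x))\<^sup>2"
      unfolding power2_diff by linarith
    then show "norm (f x \<bullet> g x) \<le> norm ((norm (f x))\<^sup>2 + (norm (g x))\<^sup>2)"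
      using Cauchy_Schwarz_ineq2[of "f x" "g x"] by simp
  qed
qed

lemma norm_lincomb_sq:
  "(norm (a *\<^sub>R x + b *\<^sub>R y))\<^sup>2 = a\<^sup>2 * (norm x)\<^sup>2 + 2 * a * b * (x \<bullet> y) + b\<^sup>2 * (norm y)\<^sup>2"
  for x y :: "'a::real_inner"
  unfolding power2_norm_eq_inner
  by (simp add: inner_add_left inner_add_right inner_commute[of y x] power2_eq_square distrib_left)

lemma square_integrable_lincomb:
  assumes "square_integrable_on f \<Omega>" "square_integrable_on g \<Omega>"
  shows "square_integrable_on (\<lambda>x. a *\<^sub>R f x + b *\<^sub>R g x) \<Omega>"
    "(LINT x|lebesgue_on \<Omega>. (norm (a *\<^sub>R f x + b *\<^sub>R g x))\<^sup>2) =
      a\<^sup>2 * (LINT x|lebesgue_on \<Omega>. (norm (f x))\<^sup>2) + 2 * a * b * (LINT x|lebesgue_on \<Omega>. f x \<bullet> g x) +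
      b\<^sup>2 * (LINT x|lebesgue_on \<Omega>. (norm (g x))\<^sup>2)"
proof -
  note i = square_integrable_inner[OF assms]
  have m: "f \<in> borel_measurable (lebesgue_on \<Omega>)" "g \<in> borel_measurable (lebesgue_on \<Omega>)"
    and f: "integrable (lebesgue_on \<Omega>) (\<lambda>x. (norm (f x))\<^sup>2)" and g: "integrable (lebesgue_on \<Omega>) (\<lambda>x. (norm (g x))\<^sup>2)"
    using assms unfolding square_integrable_on_def by auto
  show "square_integrable_on (\<lambda>x. a *\<^sub>R f x + b *\<^sub>R g x) \<Omega>"
    unfolding square_integrable_on_def norm_lincomb_sq
    by (intro conjI borel_measurable_add borel_measurable_scaleR borel_measurable_const m
        Bochner_Integration.integrable_add integrable_mult_right i f g)
  show "(LINT x|lebesgue_on \<Omega>. (norm (a *\<^sub>R f x + b *\<^sub>R g x))\<^sup>2) =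
      a\<^sup>2 * (LINT x|lebesgue_on \<Omega>. (norm (f x))\<^sup>2) + 2 * a * b * (LINT x|lebesgue_on \<Omega>. f x \<bullet> g x) +
      b\<^sup>2 * (LINT x|lebesgue_on \<Omega>. (norm (g x))\<^sup>2)"
    unfolding norm_lincomb_sq using i f g by simp
qed

lemma square_integrable_diff:
  assumes "square_integrable_on f \<Omega>" "square_integrable_on g \<Omega>"
  shows "square_integrable_on (\<lambda>x. f x - g x) \<Omega>"
  using square_integrable_lincomb(1)[OF assms, of 1 "-1"] by simp

text \<open>The quadratic form \<open>s^2 A + 2 s t B + t^2 C\<close> is an integral of squares,
  hence nonnegative, and suitable arguments yield the discriminant inequality.\<close>

lemma square_integrable_Cauchy_Schwarz:
  assumes "square_integrable_on f \<Omega>" "square_integrable_on g \<Omega>"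
  shows "(LINT x|lebesgue_on \<Omega>. f x \<bullet> g x)\<^sup>2 \<le>
    (LINT x|lebesgue_on \<Omega>. (norm (f x))\<^sup>2) * (LINT x|lebesgue_on \<Omega>. (norm (g x))\<^sup>2)"
proof -
  define A where "A = (LINT x|lebesgue_on \<Omega>. (norm (f x))\<^sup>2)"
  define B where "B = (LINT x|lebesgue_on \<Omega>. f x \<bullet> g x)"
  define C where "C = (LINT x|lebesgue_on \<Omega>. (norm (g x))\<^sup>2)"
  have q: "0 \<le> s\<^sup>2 * A + 2 * s * t * B + t\<^sup>2 * C" for s t
  proof -
    have "0 \<le> (LINT x|lebesgue_on \<Omega>. (norm (s *\<^sub>R f x + t *\<^sub>R g x))\<^sup>2)" by simp
    then show ?thesis unfolding square_integrable_lincomb(2)[OF assms] A_def B_def C_def .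
  qed
  have C: "0 \<le> C" unfolding C_def by simp
  have "B\<^sup>2 \<le> A * C"
  proof (cases "C = 0")
    case False
    \<comment> \<open>At \<open>s = C\<close> and \<open>t = - B\<close> the form equals
      \<open>C * (A * C - B^2)\<close>.\<close>
    have "0 \<le> C * (A * C - B\<^sup>2)"
      using q[of C "- B"] by (simp add: power2_eq_square algebra_simps)
    then show ?thesis using C False by (simp add: zero_le_mult_iff)
  next
    case True
    \<comment> \<open>For \<open>C = 0\<close> the form is affine in \<open>t\<close>. If
      \<open>B\<close> were not 0, the value of \<open>t\<close> chosen next would make it equal to
      -1.\<close>
    have "0 \<le> A + 2 * t * B" for t using q[of 1 t] True by simp
    from this[of "- (A + 1) / (2 * B)"] have "B = 0" by (cases "B = 0") (auto simp: field_simps)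
    then show ?thesis using True by simp
  qed
  then show ?thesis unfolding A_def B_def C_def .
qed

text \<open>Cauchy-Schwarz bounds the error of the pairing by the error in the square norm. On a
  bounded domain \<open>g = 1\<close> is allowed, so this also yields convergence of plain
  integrals.\<close>

lemma square_integrable_inner_tendsto:
  assumes U: "\<And>n. square_integrable_on (U n) \<Omega>" and f: "square_integrable_on f \<Omega>" and g: "square_integrable_on g \<Omega>"
    and lim: "(\<lambda>n. LINT x|lebesgue_on \<Omega>. (norm (f x - U n x))\<^sup>2) \<longlonglongrightarrow> 0"
  shows "(\<lambda>n. LINT x|lebesgue_on \<Omega>. U n x \<bullet> g x) \<longlonglongrightarrow> (LINT x|lebesgue_on \<Omega>. f x \<bullet> g x)"
proof -
  define C where "C = (LINT x|lebesgue_on \<Omega>. (norm (g x))\<^sup>2)"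
  have "(\<lambda>n. sqrt ((LINT x|lebesgue_on \<Omega>. (norm (f x - U n x))\<^sup>2) * C)) \<longlonglongrightarrow> sqrt (0 * C)"
    by (intro tendsto_intros lim)
  then have "(\<lambda>n. sqrt ((LINT x|lebesgue_on \<Omega>. (norm (f x - U n x))\<^sup>2) * C)) \<longlonglongrightarrow> 0" by simp
  then have "(\<lambda>n. LINT x|lebesgue_on \<Omega>. (f x - U n x) \<bullet> g x) \<longlonglongrightarrow> 0"
  proof (rule Lim_null_comparison[rotated], intro always_eventually allI)
    fix n
    have "\<bar>LINT x|lebesgue_on \<Omega>. (f x - U n x) \<bullet> g x\<bar> \<le>
      sqrt ((LINT x|lebesgue_on \<Omega>. (norm (f x - U n x))\<^sup>2) * C)"
      unfolding C_def by (rule real_le_rsqrt)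
        (use square_integrable_Cauchy_Schwarz[OF square_integrable_diff[OF f U] g] in simp)
    then show "norm (LINT x|lebesgue_on \<Omega>. (f x - U n x) \<bullet> g x) \<le>
      sqrt ((LINT x|lebesgue_on \<Omega>. (norm (f x - U n x))\<^sup>2) * C)" by simp
  qed
  moreover have "(LINT x|lebesgue_on \<Omega>. (f x - U n x) \<bullet> g x) =
      (LINT x|lebesgue_on \<Omega>. f x \<bullet> g x) - (LINT x|lebesgue_on \<Omega>. U n x \<bullet> g x)" for n
    using square_integrable_inner[OF f g] square_integrable_inner[OF U g] by (simp add: inner_diff_left)
  ultimately have "(\<lambda>n. (LINT x|lebesgue_on \<Omega>. f x \<bullet> g x) - ((LINT x|lebesgue_on \<Omega>. f x \<bullet> g x) - (LINT x|lebesgue_on \<Omega>. U n x \<bullet> g x)))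
      \<longlonglongrightarrow> (LINT x|lebesgue_on \<Omega>. f x \<bullet> g x) - 0"
    by (intro tendsto_diff tendsto_const) simp
  then show ?thesis by simp
qed

lemma square_integrable_norm_tendsto:
  assumes U: "\<And>n. square_integrable_on (U n) \<Omega>" and f: "square_integrable_on f \<Omega>"
    and lim: "(\<lambda>n. LINT x|lebesgue_on \<Omega>. (norm (f x - U n x))\<^sup>2) \<longlonglongrightarrow> 0"
  shows "(\<lambda>n. LINT x|lebesgue_on \<Omega>. (norm (U n x))\<^sup>2) \<longlonglongrightarrow> (LINT x|lebesgue_on \<Omega>. (norm (f x))\<^sup>2)"
proof -
  let ?I = "\<lambda>h. LINT x|lebesgue_on \<Omega>. h x"
  have "?I (\<lambda>x. (norm (U n x))\<^sup>2) =
      ?I (\<lambda>x. (norm (f x - U n x))\<^sup>2) + 2 * ?I (\<lambda>x. U n x \<bullet> f x) - ?I (\<lambda>x. (norm (f x))\<^sup>2)" for n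
    using square_integrable_lincomb(2)[OF U[of n] f, of 1 "-1"]
    by (simp add: norm_minus_commute)
  moreover have "(\<lambda>n. ?I (\<lambda>x. (norm (f x - U n x))\<^sup>2) + 2 * ?I (\<lambda>x. U n x \<bullet> f x) - ?I (\<lambda>x. (norm (f x))\<^sup>2))
      \<longlonglongrightarrow> 0 + 2 * ?I (\<lambda>x. f x \<bullet> f x) - ?I (\<lambda>x. (norm (f x))\<^sup>2)"
    by (intro tendsto_intros lim square_integrable_inner_tendsto[OF U f f lim])
  ultimately show ?thesis by (simp add: power2_norm_eq_inner)
qed

text \<open>The Riesz-Fischer argument: a fast subsequence has summable increments almost everywhere
  and hence a pointwise limit; Fatou's lemma then transfers the Cauchy estimate to the limit, for
  all late indices and not only along the subsequence.\<close>

lemma square_integrable_complete: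
  fixes U :: "nat \<Rightarrow> 'a::euclidean_space \<Rightarrow> 'b::euclidean_space"
  assumes \<Omega>: "\<Omega> \<in> lmeasurable" and U: "\<And>n. square_integrable_on (U n) \<Omega>"
    and Cauchy: "\<And>e. 0 < e \<Longrightarrow> \<exists>N. \<forall>m\<ge>N. \<forall>n\<ge>N. (LINT x|lebesgue_on \<Omega>. (norm (U m x - U n x))\<^sup>2) < e"
  obtains f where "square_integrable_on f \<Omega>" "(\<lambda>n. LINT x|lebesgue_on \<Omega>. (norm (f x - U n x))\<^sup>2) \<longlonglongrightarrow> 0"
proof -
  let ?M = "lebesgue_on \<Omega>"
  interpret finite_measure ?M
    using \<Omega> by (rule finite_measure_lebesgue_on)
  have mU [measurable]: "U n \<in> borel_measurable ?M" for n using U unfolding square_integrable_on_def by blast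
  have sq: "integrable ?M (\<lambda>x. (norm (U m x - U n x))\<^sup>2)" for m n
    using square_integrable_diff[OF U U] unfolding square_integrable_on_def by blast
  obtain N where N: "\<And>k m n. N k \<le> m \<Longrightarrow> N k \<le> n \<Longrightarrow> (LINT x|?M. (norm (U m x - U n x))\<^sup>2) < (1/4) ^ k"
  proof -
    have "\<exists>N. \<forall>m\<ge>N. \<forall>n\<ge>N. (LINT x|?M. (norm (U m x - U n x))\<^sup>2) < (1/4) ^ k" for k
      by (rule Cauchy) simp
    then obtain N where "\<forall>k. \<forall>m\<ge>N k. \<forall>n\<ge>N k. (LINT x|?M. (norm (U m x - U n x))\<^sup>2) < (1/4) ^ k"
      by metis
    then show ?thesis using that by blast
  qed
  \<comment> \<open>The running maximum makes the indices monotone, so that an estimate at level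
    \<open>k\<close> applies to all later terms of the subsequence.\<close>
  define r where "r = (\<lambda>k. Max (N ` {..k}))"
  have rN: "N k \<le> r k" for k unfolding r_def by (intro Max_ge) auto
  have r_mono: "r k \<le> r l" if "k \<le> l" for k l unfolding r_def by (intro Max_mono) (use that in auto)
  have rk: "(LINT x|?M. (norm (U m x - U n x))\<^sup>2) < (1/4) ^ k" if "r k \<le> m" "r k \<le> n" for k m n
    by (rule N) (use that rN[of k] in auto)
  define \<mu> where "\<mu> = measure ?M (space ?M)"
  have L1: "(\<integral>\<^sup>+x. ennreal (norm (U (r (Suc k)) x - U (r k) x)) \<partial>?M) \<le> ennreal ((1/2) ^ k * (\<mu> + 1))" for k
  proof -
    have "(\<integral>\<^sup>+x. ennreal (norm (U (r (Suc k)) x - U (r k) x)) \<partial>?M) \<le>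
        (\<integral>\<^sup>+x. ennreal ((1/2) ^ k + 2 ^ k * (norm (U (r (Suc k)) x - U (r k) x))\<^sup>2) \<partial>?M)"
    proof (intro nn_integral_mono ennreal_leI)
      fix x
      define t where "t = norm (U (r (Suc k)) x - U (r k) x)"
      have t: "0 \<le> t" unfolding t_def by simp
      \<comment> \<open>Cutting at height \<open>(1/2)^k\<close> bounds the norm by its square.
        After integration the second term is at most \<open>2^k * (1/4)^k\<close>, so both terms are
        summable because \<Omega> has finite measure.\<close>
      have "t \<le> (1/2) ^ k + 2 ^ k * t\<^sup>2"
      proof (cases "t \<le> (1/2) ^ k")
        case True
        then show ?thesis by (simp add: add_increasing2)
      next
        case False
        then have "1 \<le> 2 ^ k * t" by (simp add: power_one_over field_simps)
        then have "t * 1 \<le> t * (2 ^ k * t)" using t by (intro mult_left_mono)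
        then show ?thesis by (simp add: power2_eq_square mult_ac add_increasing)
      qed
      then show "norm (U (r (Suc k)) x - U (r k) x) \<le> (1/2) ^ k + 2 ^ k * (norm (U (r (Suc k)) x - U (r k) x))\<^sup>2"
        unfolding t_def .
    qed
    also have "\<dots> = ennreal (LINT x|?M. (1/2) ^ k + 2 ^ k * (norm (U (r (Suc k)) x - U (r k) x))\<^sup>2)"
      by (rule nn_integral_eq_integral) (use sq in auto)
    also have "(LINT x|?M. (1/2) ^ k + 2 ^ k * (norm (U (r (Suc k)) x - U (r k) x))\<^sup>2) =
        (1/2) ^ k * \<mu> + 2 ^ k * (LINT x|?M. (norm (U (r (Suc k)) x - U (r k) x))\<^sup>2)"
      using sq by (simp add: \<mu>_def)
    also have "\<dots> \<le> (1/2) ^ k * \<mu> + 2 ^ k * (1/4) ^ k"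
      by (intro add_left_mono mult_left_mono less_imp_le[OF rk]) (auto intro: r_mono)
    also have "(2::real) ^ k * (1/4) ^ k = (1/2) ^ k"
      by (simp flip: power_mult_distrib)
    finally show ?thesis by (simp add: distrib_left ennreal_leI)
  qed
  have "(\<integral>\<^sup>+x. (\<Sum>k. ennreal (norm (U (r (Suc k)) x - U (r k) x))) \<partial>?M) =
      (\<Sum>k. \<integral>\<^sup>+x. ennreal (norm (U (r (Suc k)) x - U (r k) x)) \<partial>?M)"
    by (rule nn_integral_suminf) measurable
  also have "\<dots> \<le> (\<Sum>k. ennreal ((1/2) ^ k * (\<mu> + 1)))"
    by (intro suminf_le L1) auto
  also have "\<dots> < \<infinity>"
  proof -
    have "summable (\<lambda>k. (1/2::real) ^ k * (\<mu> + 1))" by (intro summable_mult2 summable_geometric) simp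
    then show ?thesis by (subst suminf_ennreal2) (auto simp: \<mu>_def)
  qed
  finally have "AE x in ?M. (\<Sum>k. ennreal (norm (U (r (Suc k)) x - U (r k) x))) \<noteq> \<infinity>"
    by (intro nn_integral_PInf_AE) auto
  then have AEconv: "AE x in ?M. (\<lambda>k. U (r k) x) \<longlonglongrightarrow> lim (\<lambda>k. U (r k) x)"
  proof eventually_elim
    case (elim x)
    then have "summable (\<lambda>k. norm (U (r (Suc k)) x - U (r k) x))"
      by (intro summable_suminf_not_top) auto
    then have "summable (\<lambda>k. U (r (Suc k)) x - U (r k) x)" by (rule summable_norm_cancel)
    from summable_LIMSEQ[OF this]
    have "(\<lambda>k. U (r k) x - U (r 0) x) \<longlonglongrightarrow> (\<Sum>k. U (r (Suc k)) x - U (r k) x)"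
      by (simp only: sum_lessThan_telescope[of "\<lambda>k. U (r k) x"])
    from tendsto_add[OF this tendsto_const[of "U (r 0) x"]]
    have "convergent (\<lambda>k. U (r k) x)" by (auto simp: convergent_def)
    then show ?case by (simp add: convergent_LIMSEQ_iff)
  qed
  \<comment> \<open>On the exceptional null set \<open>lim\<close> is an unspecified value;
    measurability of \<open>f\<close> holds regardless, and the later statements are
    almost-everywhere ones.\<close>
  define f where "f = (\<lambda>x. lim (\<lambda>k. U (r k) x))"
  have mf [measurable]: "f \<in> borel_measurable ?M" unfolding f_def by (rule borel_measurable_lim_metric) (rule mU)
  have fatou: "(\<integral>\<^sup>+x. ennreal ((norm (f x - U n x))\<^sup>2) \<partial>?M) \<le> ennreal ((1/4) ^ k)" if n: "r k \<le> n" for n k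
  proof -
    have "(\<integral>\<^sup>+x. ennreal ((norm (f x - U n x))\<^sup>2) \<partial>?M) =
        (\<integral>\<^sup>+x. liminf (\<lambda>j. ennreal ((norm (U (r j) x - U n x))\<^sup>2)) \<partial>?M)"
      using AEconv
    proof (intro nn_integral_cong_AE, eventually_elim)
      case (elim x)
      then have "(\<lambda>j. ennreal ((norm (U (r j) x - U n x))\<^sup>2)) \<longlonglongrightarrow> ennreal ((norm (f x - U n x))\<^sup>2)"
        unfolding f_def by (intro tendsto_ennrealI tendsto_intros)
      from lim_imp_Liminf[OF sequentially_bot this] show ?case by (rule sym)
    qed
    also have "\<dots> \<le> liminf (\<lambda>j. \<integral>\<^sup>+x. ennreal ((norm (U (r j) x - U n x))\<^sup>2) \<partial>?M)"
      by (rule nn_integral_liminf) measurable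
    also have "\<dots> \<le> ennreal ((1/4) ^ k)"
    proof (rule Liminf_le)
      have "(\<integral>\<^sup>+x. ennreal ((norm (U (r j) x - U n x))\<^sup>2) \<partial>?M) \<le> ennreal ((1/4) ^ k)" if "k \<le> j" for j
      proof -
        have "(\<integral>\<^sup>+x. ennreal ((norm (U (r j) x - U n x))\<^sup>2) \<partial>?M) = ennreal (LINT x|?M. (norm (U (r j) x - U n x))\<^sup>2)"
          by (rule nn_integral_eq_integral) (use sq in auto)
        then show ?thesis using rk[OF r_mono[OF that] n] by (simp add: ennreal_leI less_imp_le)
      qed
      then show "\<forall>\<^sub>F j in sequentially. (\<integral>\<^sup>+x. ennreal ((norm (U (r j) x - U n x))\<^sup>2) \<partial>?M) \<le> ennreal ((1/4) ^ k)"
        by (rule eventually_sequentiallyI)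
    qed simp
    finally show ?thesis .
  qed
  have sqfU: "square_integrable_on (\<lambda>x. f x - U n x) \<Omega>" if "r 0 \<le> n" for n
  proof -
    have "integrable ?M (\<lambda>x. (norm (f x - U n x))\<^sup>2)"
      by (rule integrableI_nonneg) (use fatou[OF that] in \<open>auto intro: le_less_trans\<close>)
    then show ?thesis unfolding square_integrable_on_def by simp
  qed
  \<comment> \<open>The limit is the sum of \<open>f - U (r 0)\<close>, which Fatou's lemma
    controls, and the square-integrable \<open>U (r 0)\<close>.\<close>
  have sqf: "square_integrable_on f \<Omega>"
    using square_integrable_lincomb(1)[OF sqfU[OF order_refl] U[of "r 0"], of 1 1] by simp
  have small: "(LINT x|?M. (norm (f x - U n x))\<^sup>2) \<le> (1/4) ^ k" if "r k \<le> n" for n k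
  proof -
    have "integrable ?M (\<lambda>x. (norm (f x - U n x))\<^sup>2)"
      using square_integrable_diff[OF sqf U] unfolding square_integrable_on_def by blast
    then have "ennreal (LINT x|?M. (norm (f x - U n x))\<^sup>2) \<le> ennreal ((1/4) ^ k)"
      using fatou[OF that] by (subst nn_integral_eq_integral[symmetric]) auto
    then show ?thesis by (subst (asm) ennreal_le_iff) auto
  qed
  have "(\<lambda>n. LINT x|?M. (norm (f x - U n x))\<^sup>2) \<longlonglongrightarrow> 0"
  proof (rule LIMSEQ_I)
    fix e :: real assume "0 < e"
    then obtain k where "(1/4) ^ k < e" using real_arch_pow_inv[of e "1/4"] by auto
    then have "norm ((LINT x|?M. (norm (f x - U n x))\<^sup>2) - 0) < e" if "r k \<le> n" for n
      using small[OF that] by simp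
    then show "\<exists>no. \<forall>n\<ge>no. norm ((LINT x|?M. (norm (f x - U n x))\<^sup>2) - 0) < e" by blast
  qed
  with sqf show ?thesis using that by blast
qed

subsection \<open>The torsion function\<close>

lemma weak_grad_AE_eq:
  assumes "open \<Omega>" "has_weak_gradient u g \<Omega>"
  shows "AE x in lebesgue_on \<Omega>. weak_grad \<Omega> u x = g x"
  unfolding weak_grad_def by (rule weak_gradient_unique[OF assms(1) someI[of "\<lambda>g. has_weak_gradient u g \<Omega>"] assms(2)]) (rule assms(2))

text \<open>Lebesgue measure is complete, so a change on a null set preserves measurability. This
  applies to \<open>weak_grad\<close>, which is compared with a known gradient only almost
  everywhere.\<close>

lemma borel_measurable_lebesgue_on_AE:
  fixes f :: "'a::euclidean_space \<Rightarrow> 'b::euclidean_space"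
  assumes f: "f \<in> borel_measurable (lebesgue_on \<Omega>)" and ae: "AE x in lebesgue_on \<Omega>. f x = g x"
    and \<Omega>: "\<Omega> \<in> sets lebesgue"
  shows "g \<in> borel_measurable (lebesgue_on \<Omega>)"
proof -
  have "AE x in lebesgue. x \<in> \<Omega> \<longrightarrow> f x = g x"
    using ae \<Omega> by (subst (asm) AE_restrict_space_iff) auto
  then have "AE x in lebesgue. (if x \<in> \<Omega> then f x else 0) = (if x \<in> \<Omega> then g x else 0)"
    by eventually_elim auto
  from borel_measurable_AE[OF borel_measurable_if_I[OF f \<Omega>] this]
  show ?thesis by (rule borel_measurable_if_D)
qed

text \<open>Integrals with the chosen representative may be computed with any weak gradient at hand,
  in practice with a limit of classical gradients.\<close>

lemma weak_grad_square_integrable: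
  fixes u :: "'a::euclidean_space \<Rightarrow> real"
  assumes \<Omega>: "open \<Omega>" and u: "has_weak_gradient u g \<Omega>" and g: "square_integrable_on g \<Omega>"
  shows "square_integrable_on (weak_grad \<Omega> u) \<Omega>"
    "(LINT x|lebesgue_on \<Omega>. (norm (weak_grad \<Omega> u x))\<^sup>2) = (LINT x|lebesgue_on \<Omega>. (norm (g x))\<^sup>2)"
    "h \<in> borel_measurable (lebesgue_on \<Omega>) \<Longrightarrow>
      (LINT x|lebesgue_on \<Omega>. weak_grad \<Omega> u x \<bullet> h x) = (LINT x|lebesgue_on \<Omega>. g x \<bullet> h x)"
proof -
  have ae: "AE x in lebesgue_on \<Omega>. g x = weak_grad \<Omega> u x"
    using weak_grad_AE_eq[OF \<Omega> u] by eventually_elim simp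
  have mg: "g \<in> borel_measurable (lebesgue_on \<Omega>)" and ig: "integrable (lebesgue_on \<Omega>) (\<lambda>x. (norm (g x))\<^sup>2)"
    using g unfolding square_integrable_on_def by auto
  have mw: "weak_grad \<Omega> u \<in> borel_measurable (lebesgue_on \<Omega>)"
    by (rule borel_measurable_lebesgue_on_AE[OF mg ae]) (use \<Omega> in auto)
  have sq: "AE x in lebesgue_on \<Omega>. (norm (g x))\<^sup>2 = (norm (weak_grad \<Omega> u x))\<^sup>2"
    using ae by eventually_elim simp
  show "square_integrable_on (weak_grad \<Omega> u) \<Omega>"
    unfolding square_integrable_on_def
    using integrable_cong_AE[OF _ _ sq] mw mg ig by auto
  show "(LINT x|lebesgue_on \<Omega>. (norm (weak_grad \<Omega> u x))\<^sup>2) = (LINT x|lebesgue_on \<Omega>. (norm (g x))\<^sup>2)"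
    by (rule integral_cong_AE) (use mw mg sq in \<open>auto elim: eventually_mono\<close>)
  assume h: "h \<in> borel_measurable (lebesgue_on \<Omega>)"
  show "(LINT x|lebesgue_on \<Omega>. weak_grad \<Omega> u x \<bullet> h x) = (LINT x|lebesgue_on \<Omega>. g x \<bullet> h x)"
  proof (rule integral_cong_AE)
    show "AE x in lebesgue_on \<Omega>. weak_grad \<Omega> u x \<bullet> h x = g x \<bullet> h x"
      using ae by eventually_elim simp
  qed (intro borel_measurable_inner mw mg h)+
qed

lemma has_weak_gradient_diff:
  fixes u v :: "'a::euclidean_space \<Rightarrow> real"
  assumes \<Omega>: "open \<Omega>" and u: "has_weak_gradient u g \<Omega>" and v: "has_weak_gradient v h \<Omega>"
  shows "has_weak_gradient (\<lambda>x. u x - v x) (\<lambda>x. g x - h x) \<Omega>"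
  unfolding has_weak_gradient_def
proof (intro conjI ballI)
  have loc: "locally_integrable_on u \<Omega>" "locally_integrable_on v \<Omega>" "locally_integrable_on g \<Omega>" "locally_integrable_on h \<Omega>"
    using u v unfolding has_weak_gradient_def by blast+
  show "locally_integrable_on (\<lambda>x. u x - v x) \<Omega>" "locally_integrable_on (\<lambda>x. g x - h x) \<Omega>"
    using loc unfolding locally_integrable_on_def by auto
  fix \<phi> b assume \<phi>: "\<phi> \<in> test_functions \<Omega>" and b: "b \<in> (Basis :: 'a set)"
  obtain K where K: "compact K" "K \<subseteq> \<Omega>" "\<And>x. x \<notin> K \<Longrightarrow> \<phi> x = 0 \<and> grad \<phi> x = 0"
    using test_function_support[OF \<phi>] by blast
  note c = test_function_continuous[OF \<phi>]
  have cb: "continuous_on UNIV (\<lambda>x. grad \<phi> x \<bullet> b)" by (intro continuous_intros c)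
  have i1: "integrable (lebesgue_on \<Omega>) (\<lambda>x. k x * (grad \<phi> x \<bullet> b))" if "locally_integrable_on k \<Omega>" for k
    using locally_integrable_times[OF that \<Omega> cb K(1,2)] K(3) by (simp add: mult.commute)
  have i2: "integrable (lebesgue_on \<Omega>) (\<lambda>x. (k x \<bullet> b) * \<phi> x)" if "locally_integrable_on k \<Omega>" for k
    using locally_integrable_times[OF locally_integrable_component[OF that, of b] \<Omega> c(1) K(1,2)] K(3)
    by (simp add: mult.commute)
  have eq: "(LINT x|lebesgue_on \<Omega>. w x * (grad \<phi> x \<bullet> b)) = - (LINT x|lebesgue_on \<Omega>. (k x \<bullet> b) * \<phi> x)"
    if "has_weak_gradient w k \<Omega>" for w k
    using that \<phi> b unfolding has_weak_gradient_def by (simp add: grad_inner_Basis)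
  have "(LINT x|lebesgue_on \<Omega>. (u x - v x) * (grad \<phi> x \<bullet> b)) = - (LINT x|lebesgue_on \<Omega>. ((g x - h x) \<bullet> b) * \<phi> x)"
    using i1[OF loc(1)] i1[OF loc(2)] i2[OF loc(3)] i2[OF loc(4)] eq[OF u] eq[OF v]
    by (simp add: left_diff_distrib inner_diff_left)
  then show "(LINT x|lebesgue_on \<Omega>. (u x - v x) * frechet_derivative \<phi> (at x) b) =
      - (LINT x|lebesgue_on \<Omega>. ((g x - h x) \<bullet> b) * \<phi> x)"
    by (simp add: grad_inner_Basis[OF b])
qed

lemma bounded_open_lmeasurable: "open \<Omega> \<Longrightarrow> bounded \<Omega> \<Longrightarrow> \<Omega> \<in> lmeasurable"
  for \<Omega> :: "'a::euclidean_space set"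
  by (intro bounded_set_imp_lmeasurable) auto

lemma square_integrable_const:
  "\<Omega> \<in> lmeasurable \<Longrightarrow> square_integrable_on (\<lambda>_. c) \<Omega>"
  unfolding square_integrable_on_def using finite_measure.integrable_const[OF finite_measure_lebesgue_on] by auto

lemma square_integrable_integrable:
  fixes f :: "'a::euclidean_space \<Rightarrow> 'b::euclidean_space"
  assumes \<Omega>: "\<Omega> \<in> lmeasurable" and f: "square_integrable_on f \<Omega>"
  shows "integrable (lebesgue_on \<Omega>) f"
proof (rule Bochner_Integration.integrable_bound)
  interpret finite_measure "lebesgue_on \<Omega>" using \<Omega> by (rule finite_measure_lebesgue_on)
  show "integrable (lebesgue_on \<Omega>) (\<lambda>x. 1 + (norm (f x))\<^sup>2)"
    using f unfolding square_integrable_on_def by auto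
  show "AE x in lebesgue_on \<Omega>. norm (f x) \<le> norm (1 + (norm (f x))\<^sup>2)"
  proof (rule AE_I2)
    fix x
    have "0 \<le> (norm (f x) - 1)\<^sup>2" by simp
    then have "2 * norm (f x) \<le> 1 + (norm (f x))\<^sup>2" by (simp add: power2_diff)
    then have "norm (f x) \<le> 1 + (norm (f x))\<^sup>2" using norm_ge_zero[of "f x"] by linarith
    then show "norm (f x) \<le> norm (1 + (norm (f x))\<^sup>2)" by simp
  qed
qed (use f in \<open>auto simp: square_integrable_on_def\<close>)

lemma square_integrable_locally_integrable:
  fixes f :: "'a::euclidean_space \<Rightarrow> 'b::euclidean_space"
  assumes \<Omega>: "\<Omega> \<in> lmeasurable" and f: "square_integrable_on f \<Omega>"
  shows "locally_integrable_on f \<Omega>"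
  unfolding locally_integrable_on_def
proof (intro allI impI, elim conjE)
  fix K :: "'a set" assume K: "compact K" "K \<subseteq> \<Omega>"
  have "integrable lebesgue (\<lambda>x. indicator \<Omega> x *\<^sub>R f x)"
    using square_integrable_integrable[OF assms] \<Omega> by (subst (asm) integrable_restrict_space) auto
  from integrable_mult_indicator[OF _ this, of K]
  have "integrable lebesgue (\<lambda>x. indicator K x *\<^sub>R indicator \<Omega> x *\<^sub>R f x)"
    using borel_compact[OF K(1)] by simp
  also have "(\<lambda>x. indicator K x *\<^sub>R indicator \<Omega> x *\<^sub>R f x) = (\<lambda>x. indicator K x *\<^sub>R f x)"
    using K(2) by (auto simp: indicator_def fun_eq_iff)
  finally show "integrable (lebesgue_on K) f"
    using borel_compact[OF K(1)] by (subst integrable_restrict_space) auto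
qed

section \<open>The closure of the test functions, described by square-norm limits\<close>

lemma compact_support_square_integrable:
  fixes f :: "'a::euclidean_space \<Rightarrow> 'b::euclidean_space"
  assumes \<Omega>: "open \<Omega>" and f: "continuous_on UNIV f" and K: "compact K" "K \<subseteq> \<Omega>" "\<And>x. x \<notin> K \<Longrightarrow> f x = 0"
  shows "square_integrable_on f \<Omega>"
  unfolding square_integrable_on_def
proof
  have "continuous_on UNIV (\<lambda>x. (norm (f x))\<^sup>2)" by (intro continuous_intros f)
  from compact_support_integral(2)[OF this K(1) _ \<Omega> K(2)]
  show "integrable (lebesgue_on \<Omega>) (\<lambda>x. (norm (f x))\<^sup>2)" using K(3) by simp
qed (rule continuous_borel_lebesgue_on[OF f])

text \<open>Both sides of the defining identity are pairings with fixed square-integrable functions,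
  so the identity for the test functions passes to the limit. This is the closedness of the weak
  gradient.\<close>

lemma has_weak_gradient_limit:
  fixes w :: "'a::euclidean_space \<Rightarrow> real"
  assumes \<Omega>: "open \<Omega>" "bounded \<Omega>" and w: "square_integrable_on w \<Omega>" and g: "square_integrable_on g \<Omega>"
    and \<phi>: "\<And>n. \<phi> n \<in> test_functions \<Omega>"
    and lim: "(\<lambda>n. LINT x|lebesgue_on \<Omega>. (norm (w x - \<phi> n x))\<^sup>2) \<longlonglongrightarrow> 0"
      "(\<lambda>n. LINT x|lebesgue_on \<Omega>. (norm (g x - grad (\<phi> n) x))\<^sup>2) \<longlonglongrightarrow> 0"
  shows "has_weak_gradient w g \<Omega>"
  unfolding has_weak_gradient_def
proof (intro conjI ballI)
  note L = bounded_open_lmeasurable[OF \<Omega>]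
  show "locally_integrable_on w \<Omega>" "locally_integrable_on g \<Omega>"
    by (intro square_integrable_locally_integrable L w g)+
  fix \<psi> b assume \<psi>: "\<psi> \<in> test_functions \<Omega>" and b: "b \<in> (Basis :: 'a set)"
  obtain K where K: "compact K" "K \<subseteq> \<Omega>" "\<And>x. x \<notin> K \<Longrightarrow> \<psi> x = 0 \<and> grad \<psi> x = 0"
    using test_function_support[OF \<psi>] by blast
  note c = test_function_continuous[OF \<psi>]
  have s1: "square_integrable_on (\<lambda>x. grad \<psi> x \<bullet> b) \<Omega>" and s2: "square_integrable_on (\<lambda>x. \<psi> x *\<^sub>R b) \<Omega>"
    by (rule compact_support_square_integrable[OF \<Omega>(1) _ K(1,2)], intro continuous_intros c, use K(3) in simp)+
  have "(\<lambda>n. LINT x|lebesgue_on \<Omega>. \<phi> n x \<bullet> (grad \<psi> x \<bullet> b)) \<longlonglongrightarrow> (LINT x|lebesgue_on \<Omega>. w x \<bullet> (grad \<psi> x \<bullet> b))"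
    by (rule square_integrable_inner_tendsto[OF test_function_square_integrable(1)[OF \<Omega>(1) \<phi>] w s1 lim(1)])
  moreover have "(LINT x|lebesgue_on \<Omega>. \<phi> n x \<bullet> (grad \<psi> x \<bullet> b)) = - (LINT x|lebesgue_on \<Omega>. grad (\<phi> n) x \<bullet> (\<psi> x *\<^sub>R b))" for n
    using test_function_has_weak_gradient[OF \<Omega>(1) \<phi>[of n]] \<psi> b unfolding has_weak_gradient_def
    by (simp add: grad_inner_Basis mult.commute)
  ultimately have "(\<lambda>n. - (LINT x|lebesgue_on \<Omega>. grad (\<phi> n) x \<bullet> (\<psi> x *\<^sub>R b))) \<longlonglongrightarrow> (LINT x|lebesgue_on \<Omega>. w x \<bullet> (grad \<psi> x \<bullet> b))"
    by simp
  moreover have "(\<lambda>n. - (LINT x|lebesgue_on \<Omega>. grad (\<phi> n) x \<bullet> (\<psi> x *\<^sub>R b))) \<longlonglongrightarrow> - (LINT x|lebesgue_on \<Omega>. g x \<bullet> (\<psi> x *\<^sub>R b))"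
    by (intro tendsto_minus square_integrable_inner_tendsto[OF test_function_square_integrable(2)[OF \<Omega>(1) \<phi>] g s2 lim(2)])
  ultimately have "(LINT x|lebesgue_on \<Omega>. w x \<bullet> (grad \<psi> x \<bullet> b)) = - (LINT x|lebesgue_on \<Omega>. g x \<bullet> (\<psi> x *\<^sub>R b))"
    by (rule LIMSEQ_unique)
  then show "(LINT x|lebesgue_on \<Omega>. w x * frechet_derivative \<psi> (at x) b) = - (LINT x|lebesgue_on \<Omega>. (g x \<bullet> b) * \<psi> x)"
    by (simp add: grad_inner_Basis[OF b] mult.commute)
qed

lemma H1_norm_diff_test:
  fixes w :: "'a::euclidean_space \<Rightarrow> real"
  assumes \<Omega>: "open \<Omega>" and w: "has_weak_gradient w g \<Omega>" and g: "square_integrable_on g \<Omega>"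
    and \<phi>: "\<phi> \<in> test_functions \<Omega>"
  shows "H1_norm \<Omega> (\<lambda>x. w x - \<phi> x) = sqrt ((LINT x|lebesgue_on \<Omega>. (norm (w x - \<phi> x))\<^sup>2) +
    (LINT x|lebesgue_on \<Omega>. (norm (g x - grad \<phi> x))\<^sup>2))"
  using weak_grad_square_integrable(2)[OF \<Omega> has_weak_gradient_diff[OF \<Omega> w test_function_has_weak_gradient[OF \<Omega> \<phi>]]
      square_integrable_diff[OF g test_function_square_integrable(2)[OF \<Omega> \<phi>]]]
  unfolding H1_norm_def by simp

text \<open>Together with \<open>H10_E\<close>, membership in \<open>H10\<close> becomes a pair of
  square-norm limits, of the functions and of their gradients, with an explicit limit gradient
  \<open>g\<close>.\<close>

lemma H10_I:
  fixes w :: "'a::euclidean_space \<Rightarrow> real"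
  assumes \<Omega>: "open \<Omega>" "bounded \<Omega>" and w: "square_integrable_on w \<Omega>" and g: "square_integrable_on g \<Omega>"
    and \<phi>: "\<And>n. \<phi> n \<in> test_functions \<Omega>"
    and lim: "(\<lambda>n. LINT x|lebesgue_on \<Omega>. (norm (w x - \<phi> n x))\<^sup>2) \<longlonglongrightarrow> 0"
      "(\<lambda>n. LINT x|lebesgue_on \<Omega>. (norm (g x - grad (\<phi> n) x))\<^sup>2) \<longlonglongrightarrow> 0"
  shows "w \<in> H10 \<Omega>" "has_weak_gradient w g \<Omega>"
proof -
  show wg: "has_weak_gradient w g \<Omega>" by (rule has_weak_gradient_limit[OF assms])
  have "(\<lambda>n. H1_norm \<Omega> (\<lambda>x. w x - \<phi> n x)) \<longlonglongrightarrow> sqrt (0 + 0)"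
    unfolding H1_norm_diff_test[OF \<Omega>(1) wg g \<phi>] by (intro tendsto_intros lim)
  then show "w \<in> H10 \<Omega>"
    unfolding H10_def H1_def using w g wg \<phi> by auto
qed

lemma H10_E:
  fixes w :: "'a::euclidean_space \<Rightarrow> real"
  assumes \<Omega>: "open \<Omega>" and w: "w \<in> H10 \<Omega>"
  obtains g \<phi> where "square_integrable_on w \<Omega>" "square_integrable_on g \<Omega>" "has_weak_gradient w g \<Omega>"
    "\<And>n::nat. \<phi> n \<in> test_functions \<Omega>"
    "(\<lambda>n. LINT x|lebesgue_on \<Omega>. (norm (w x - \<phi> n x))\<^sup>2) \<longlonglongrightarrow> 0"
    "(\<lambda>n. LINT x|lebesgue_on \<Omega>. (norm (g x - grad (\<phi> n) x))\<^sup>2) \<longlonglongrightarrow> 0"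
proof -
  obtain g \<phi> where sw: "square_integrable_on w \<Omega>" and wg: "has_weak_gradient w g \<Omega>" and sg: "square_integrable_on g \<Omega>"
    and \<phi>: "\<And>n::nat. \<phi> n \<in> test_functions \<Omega>" and lim: "(\<lambda>n. H1_norm \<Omega> (\<lambda>x. w x - \<phi> n x)) \<longlonglongrightarrow> 0"
    using w unfolding H10_def H1_def by blast
  define A where "A = (\<lambda>n. LINT x|lebesgue_on \<Omega>. (norm (w x - \<phi> n x))\<^sup>2)"
  define B where "B = (\<lambda>n. LINT x|lebesgue_on \<Omega>. (norm (g x - grad (\<phi> n) x))\<^sup>2)"
  have nn: "0 \<le> A n" "0 \<le> B n" for n unfolding A_def B_def by simp_all
  have "(\<lambda>n. (H1_norm \<Omega> (\<lambda>x. w x - \<phi> n x))\<^sup>2) \<longlonglongrightarrow> 0\<^sup>2" by (intro tendsto_intros lim)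
  moreover have "H1_norm \<Omega> (\<lambda>x. w x - \<phi> n x) = sqrt (A n + B n)" for n
    unfolding A_def B_def by (rule H1_norm_diff_test[OF \<Omega> wg sg \<phi>])
  ultimately have AB: "(\<lambda>n. A n + B n) \<longlonglongrightarrow> 0" using nn by simp
  have "A \<longlonglongrightarrow> 0" "B \<longlonglongrightarrow> 0"
    by (rule tendsto_sandwich[OF always_eventually always_eventually tendsto_const AB]; use nn in simp)+
  then show ?thesis using that sw sg wg \<phi> unfolding A_def B_def by blast
qed

lemma test_function_in_H10:
  fixes \<phi> :: "'a::euclidean_space \<Rightarrow> real"
  assumes "open \<Omega>" "bounded \<Omega>" "\<phi> \<in> test_functions \<Omega>"
  shows "\<phi> \<in> H10 \<Omega>"
  by (rule H10_I(1)[OF assms(1,2) test_function_square_integrable[OF assms(1,3)] assms(3)]) simp_all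

text \<open>Rayleigh quotients are nonnegative, but an infimum of reals inherits this only over a
  nonempty set. A bump on a box in \<Omega> is positive on an open set and therefore an admissible
  competitor.\<close>

lemma eigenvalue1_nonneg:
  fixes \<Omega> :: "'a::euclidean_space set"
  assumes \<Omega>: "open \<Omega>" "bounded \<Omega>" "\<Omega> \<noteq> {}"
  shows "0 \<le> eigenvalue1 \<Omega>"
  unfolding eigenvalue1_def
proof (rule cINF_greatest)
  obtain x where "x \<in> \<Omega>" using \<Omega>(3) by blast
  then obtain a b where ab: "x \<in> box a b" "cbox a b \<subseteq> \<Omega>"
    using open_contains_cbox[OF \<Omega>(1)] by metis
  have "\<not> (AE y in lebesgue_on \<Omega>. bump 0 a b y = 0)"
  proof
    assume "AE y in lebesgue_on \<Omega>. bump 0 a b y = 0"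
    then have "AE y in lebesgue. y \<in> \<Omega> \<longrightarrow> bump 0 a b y = 0"
      using \<Omega>(1) by (subst (asm) AE_restrict_space_iff) auto
    then have "AE y in lebesgue. y \<notin> box a b"
    proof eventually_elim
      case (elim y)
      then show ?case using bump_pos[of y a b 0] ab(2) box_subset_cbox[of a b] by auto
    qed
    then have "box a b \<in> null_sets lebesgue" by (subst (asm) AE_iff_null_sets[symmetric]) auto
    then show False
      using open_not_negligible[OF open_box, of a b] ab(1) by (auto simp: negligible_iff_null_sets)
  qed
  then show "{u \<in> H10 \<Omega>. \<not> (AE x in lebesgue_on \<Omega>. u x = 0)} \<noteq> {}"
    using test_function_in_H10[OF \<Omega>(1,2) bump_test_function[OF ab(2)]] by blast
qed simp

text \<open>The functional whose Euler-Lagrange equation is the torsion equation. It is evaluated at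
  test functions only, hence the classical gradient.\<close>

definition torsion_energy :: "'a::euclidean_space set \<Rightarrow> ('a \<Rightarrow> real) \<Rightarrow> real" where
  "torsion_energy \<Omega> \<phi> = 1/2 * (LINT x|lebesgue_on \<Omega>. (norm (grad \<phi> x))\<^sup>2) - (LINT x|lebesgue_on \<Omega>. \<phi> x)"

text \<open>The torsional rigidity of the ball with the same measure as \<open>\<Omega>\<close>.\<close>

definition ball_torsion :: "'a::euclidean_space set \<Rightarrow> real" where
  "ball_torsion \<Omega> = measure lebesgue \<Omega> powr ((real DIM('a) + 2) / real DIM('a)) /
    (real DIM('a) * (real DIM('a) + 2) * measure lebesgue (ball (0::'a) 1) powr (2 / real DIM('a)))"

lemma torsion_energy_bound:
  fixes \<Omega> :: "'a::euclidean_space set"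
  assumes \<Omega>: "open \<Omega>" "bounded \<Omega>" "\<Omega> \<noteq> {}" and \<phi>: "\<phi> \<in> test_functions \<Omega>"
  shows "- (1/2 * ball_torsion \<Omega>) \<le> torsion_energy \<Omega> \<phi>"
proof -
  obtain K where K: "compact K" "K \<subseteq> \<Omega>" "\<And>x. x \<notin> K \<Longrightarrow> \<phi> x = 0 \<and> grad \<phi> x = 0"
    using test_function_support[OF \<phi>] by blast
  have "measure lebesgue \<Omega> = measure lborel \<Omega>" "measure lebesgue (ball (0::'a) 1) = measure lborel (ball (0::'a) 1)"
    using \<Omega>(1) by (auto simp: measure_completion)
  then show ?thesis
    using saint_venant_test[OF \<Omega> test_function_has_derivative[OF \<phi>] test_function_continuous(2)[OF \<phi>] K
        test_function_integrals(1,2)[OF \<Omega>(1) \<phi>]] test_function_integrals(6,8)[OF \<Omega>(1) \<phi>]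
    unfolding torsion_energy_def ball_torsion_def by simp
qed

text \<open>Used with \<open>a = b = 1/2\<close> for midpoints of a minimizing sequence and with
  \<open>a = 1\<close> for variations in direction \<psi>.\<close>

lemma torsion_energy_lincomb:
  assumes \<Omega>: "open \<Omega>" and \<phi>: "\<phi> \<in> test_functions \<Omega>" and \<psi>: "\<psi> \<in> test_functions \<Omega>"
  shows "torsion_energy \<Omega> (\<lambda>x. a * \<phi> x + b * \<psi> x) =
    1/2 * (a\<^sup>2 * (LINT x|lebesgue_on \<Omega>. (norm (grad \<phi> x))\<^sup>2) + 2 * a * b * (LINT x|lebesgue_on \<Omega>. grad \<phi> x \<bullet> grad \<psi> x) +
      b\<^sup>2 * (LINT x|lebesgue_on \<Omega>. (norm (grad \<psi> x))\<^sup>2)) -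
    (a * (LINT x|lebesgue_on \<Omega>. \<phi> x) + b * (LINT x|lebesgue_on \<Omega>. \<psi> x))"
  unfolding torsion_energy_def test_function_lincomb(2)[OF \<phi> \<psi>]
    square_integrable_lincomb(2)[OF test_function_square_integrable(2)[OF \<Omega> \<phi>] test_function_square_integrable(2)[OF \<Omega> \<psi>]]
  using test_function_integrals(3)[OF \<Omega> \<phi>] test_function_integrals(3)[OF \<Omega> \<psi>] by simp

text \<open>The direct method. The transport estimate bounds the energy from below, strict convexity
  makes the gradients of a minimizing sequence Cauchy, and the Poincare inequality does the same for
  the functions. Vanishing first variation gives the equation against test functions, and density
  extends it to \<open>H10\<close>. Existence is what gives content to the choice in
  \<open>torsional_rigidity\<close>.\<close>

lemma torsion_function_exists:
  fixes \<Omega> :: "'a::euclidean_space set"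
  assumes \<Omega>: "open \<Omega>" "bounded \<Omega>" "\<Omega> \<noteq> {}"
  shows "\<exists>w. is_torsion_function \<Omega> w"
proof -
  note L = bounded_open_lmeasurable[OF \<Omega>(1,2)]
  let ?I = "\<lambda>h. LINT x|lebesgue_on \<Omega>. h x" and ?J = "torsion_energy \<Omega>" and ?T = "test_functions \<Omega>"
  obtain R where R: "\<And>x. x \<in> \<Omega> \<Longrightarrow> norm x \<le> R" "0 < R" using \<Omega>(2) bounded_pos by metis
  have nonempty: "?T \<noteq> {}"
  proof -
    obtain x where "x \<in> \<Omega>" using \<Omega>(3) by blast
    \<comment> \<open>The box is a single point with empty interior, so this bump is the zero
      function, which is test function enough.\<close>
    then show ?thesis using bump_test_function[of x x \<Omega> 0] by auto
  qed
  define m where "m = Inf (?J ` ?T)"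
  have bdd: "bdd_below (?J ` ?T)"
    using torsion_energy_bound[OF \<Omega>] by (intro bdd_belowI2)
  have m_le: "m \<le> ?J \<psi>" if "\<psi> \<in> ?T" for \<psi>
    unfolding m_def using bdd that by (intro cInf_lower) auto
  have "\<exists>\<phi>\<in>?T. ?J \<phi> < m + 1 / real (Suc n)" for n
  proof -
    have "Inf (?J ` ?T) < m + 1 / real (Suc n)" unfolding m_def by simp
    then show ?thesis using cInf_lessD[of "?J ` ?T"] nonempty by auto
  qed
  then obtain \<phi> where \<phi>: "\<And>n. \<phi> n \<in> ?T" and J\<phi>: "\<And>n. ?J (\<phi> n) < m + 1 / real (Suc n)" by metis
  have grad_diff: "?I (\<lambda>x. (norm (grad (\<phi> i) x - grad (\<phi> j) x))\<^sup>2) \<le> 4 / real (Suc i) + 4 / real (Suc j)" for i j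
  proof -
    have 1: "?I (\<lambda>x. (norm (grad (\<phi> i) x - grad (\<phi> j) x))\<^sup>2) = ?I (\<lambda>x. (norm (grad (\<phi> i) x))\<^sup>2) -
        2 * ?I (\<lambda>x. grad (\<phi> i) x \<bullet> grad (\<phi> j) x) + ?I (\<lambda>x. (norm (grad (\<phi> j) x))\<^sup>2)"
      using square_integrable_lincomb(2)[OF test_function_square_integrable(2)[OF \<Omega>(1) \<phi>[of i]]
          test_function_square_integrable(2)[OF \<Omega>(1) \<phi>[of j]], of 1 "-1"] by simp
    have "m \<le> ?J (\<lambda>x. 1/2 * \<phi> i x + 1/2 * \<phi> j x)" by (intro m_le test_function_lincomb \<phi>)
    then have 2: "m \<le> 1/2 * (1/4 * ?I (\<lambda>x. (norm (grad (\<phi> i) x))\<^sup>2) + 1/2 * ?I (\<lambda>x. grad (\<phi> i) x \<bullet> grad (\<phi> j) x) +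
        1/4 * ?I (\<lambda>x. (norm (grad (\<phi> j) x))\<^sup>2)) - (1/2 * ?I (\<phi> i) + 1/2 * ?I (\<phi> j))"
      unfolding torsion_energy_lincomb[OF \<Omega>(1) \<phi> \<phi>] by (simp add: power2_eq_square)
    have 3: "1/2 * ?I (\<lambda>x. (norm (grad (\<phi> k) x))\<^sup>2) - ?I (\<phi> k) < m + 1 / real (Suc k)" for k
      using J\<phi>[of k] unfolding torsion_energy_def .
    \<comment> \<open>The parallelogram identity: the mean of the two energies exceeds the energy of
      the midpoint by \<open>D / 8\<close>. The midpoint has energy at least \<open>m\<close>, so
      \<open>D / 8\<close> is at most \<open>(e + f) / 2\<close>.\<close>
    have "D \<le> 4 * e + 4 * f"
      if "D = a - 2 * c + b" "m \<le> 1/2 * (1/4 * a + 1/2 * c + 1/4 * b) - (1/2 * p + 1/2 * q)"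
        "1/2 * a - p < m + e" "1/2 * b - q < m + f" for a b c p q D e f :: real
      using that by argo
    from this[OF 1 2 3[of i] 3[of j]] show ?thesis by simp
  qed
  have small: "\<exists>N. \<forall>i\<ge>N. \<forall>j\<ge>N. C * (4 / real (Suc i) + 4 / real (Suc j)) < e" if "0 < e" "0 < C" for C e :: real
  proof -
    obtain N where N: "8 * C / e < real N" using reals_Archimedean2 by blast
    have "C * (4 / real (Suc i) + 4 / real (Suc j)) < e" if ij: "N \<le> i" "N \<le> j" for i j
    proof -
      have k: "4 / real (Suc k) * C < e / 2" if "N \<le> k" for k
      proof -
        have "8 * C / e < real (Suc k)" using N that by linarith
        then show ?thesis using \<open>0 < e\<close> by (simp add: field_simps)
      qed
      have "C * (x + y) < e" if "x * C < e / 2" "y * C < e / 2" for x y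
      proof -
        have "C * (x + y) = x * C + y * C" by (simp add: algebra_simps)
        then show ?thesis using that by linarith
      qed
      from this[OF k[OF ij(1)] k[OF ij(2)]] show ?thesis .
    qed
    then show ?thesis by blast
  qed
  have cg: "\<exists>N. \<forall>i\<ge>N. \<forall>j\<ge>N. ?I (\<lambda>x. (norm (grad (\<phi> i) x - grad (\<phi> j) x))\<^sup>2) < e" if e: "0 < e" for e
  proof -
    obtain N where "\<And>i j. N \<le> i \<Longrightarrow> N \<le> j \<Longrightarrow> 4 / real (Suc i) + 4 / real (Suc j) < e"
      using small[OF e, of 1] by auto
    then show ?thesis using le_less_trans[OF grad_diff] by blast
  qed
  obtain g where g: "square_integrable_on g \<Omega>" and limg: "(\<lambda>n. ?I (\<lambda>x. (norm (g x - grad (\<phi> n) x))\<^sup>2)) \<longlonglongrightarrow> 0"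
    by (rule square_integrable_complete[where U="\<lambda>n. grad (\<phi> n)",
          OF L test_function_square_integrable(2)[OF \<Omega>(1) \<phi>] cg]) (assumption, rule that)
  have fun_diff: "?I (\<lambda>x. (norm (\<phi> i x - \<phi> j x))\<^sup>2) \<le> 4 * R\<^sup>2 * (4 / real (Suc i) + 4 / real (Suc j))" for i j
  proof -
    have t: "(\<lambda>x. 1 * \<phi> i x + (-1) * \<phi> j x) \<in> ?T" by (intro test_function_lincomb \<phi>)
    have "?I (\<lambda>x. (norm (1 * \<phi> i x + (-1) * \<phi> j x))\<^sup>2) \<le> 4 * R\<^sup>2 * ?I (\<lambda>x. (norm (grad (\<lambda>x. 1 * \<phi> i x + (-1) * \<phi> j x) x))\<^sup>2)"
      by (rule poincare_inequality[OF \<Omega>(1) t R(1)])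
    also have "?I (\<lambda>x. (norm (grad (\<lambda>x. 1 * \<phi> i x + (-1) * \<phi> j x) x))\<^sup>2) = ?I (\<lambda>x. (norm (grad (\<phi> i) x - grad (\<phi> j) x))\<^sup>2)"
      unfolding test_function_lincomb(2)[OF \<phi> \<phi>] by simp
    also have "4 * R\<^sup>2 * \<dots> \<le> 4 * R\<^sup>2 * (4 / real (Suc i) + 4 / real (Suc j))"
      by (intro mult_left_mono grad_diff) simp
    finally show ?thesis by simp
  qed
  have cw: "\<exists>N. \<forall>i\<ge>N. \<forall>j\<ge>N. ?I (\<lambda>x. (norm (\<phi> i x - \<phi> j x))\<^sup>2) < e" if e: "0 < e" for e
  proof -
    obtain N where "\<And>i j. N \<le> i \<Longrightarrow> N \<le> j \<Longrightarrow> 4 * R\<^sup>2 * (4 / real (Suc i) + 4 / real (Suc j)) < e"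
      using small[OF e, of "4 * R\<^sup>2"] R(2) by auto
    then show ?thesis using le_less_trans[OF fun_diff] by blast
  qed
  obtain w where w: "square_integrable_on w \<Omega>" and limw: "(\<lambda>n. ?I (\<lambda>x. (norm (w x - \<phi> n x))\<^sup>2)) \<longlonglongrightarrow> 0"
    by (rule square_integrable_complete[where U=\<phi>,
          OF L test_function_square_integrable(1)[OF \<Omega>(1) \<phi>] cw]) (assumption, rule that)
  note wH = H10_I[OF \<Omega>(1,2) w g \<phi> limw limg]
  have EL: "?I (\<lambda>x. g x \<bullet> grad \<psi> x) = ?I \<psi>" if \<psi>: "\<psi> \<in> ?T" for \<psi>
  proof -
    define D where "D = ?I (\<lambda>x. (norm (grad \<psi> x))\<^sup>2)"
    define l where "l = ?I (\<lambda>x. g x \<bullet> grad \<psi> x) - ?I \<psi>"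
    have D: "0 \<le> D" unfolding D_def by simp
    \<comment> \<open>Each \<open>\<phi> n\<close> is minimal up to \<open>1 / (n + 1)\<close>, so
      its perturbation by \<open>t * \<psi>\<close> lowers the energy by less than that. In the
      limit this tolerance vanishes and the linear term becomes \<open>t * l\<close>.\<close>
    have "0 \<le> t * l + 1/2 * t\<^sup>2 * D" for t
    proof (rule tendsto_lowerbound[OF _ _ sequentially_bot])
      have "(\<lambda>n. ?I (\<lambda>x. grad (\<phi> n) x \<bullet> grad \<psi> x)) \<longlonglongrightarrow> ?I (\<lambda>x. g x \<bullet> grad \<psi> x)"
        by (rule square_integrable_inner_tendsto[OF test_function_square_integrable(2)[OF \<Omega>(1) \<phi>] g
              test_function_square_integrable(2)[OF \<Omega>(1) \<psi>] limg])
      then have "(\<lambda>n. 1 / real (Suc n) + (t * (?I (\<lambda>x. grad (\<phi> n) x \<bullet> grad \<psi> x) - ?I \<psi>) + 1/2 * t\<^sup>2 * D)) \<longlonglongrightarrow> 0 + (t * l + 1/2 * t\<^sup>2 * D)"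
        unfolding l_def by (intro tendsto_intros LIMSEQ_Suc[OF lim_const_over_n])
      then show "(\<lambda>n. 1 / real (Suc n) + (t * (?I (\<lambda>x. grad (\<phi> n) x \<bullet> grad \<psi> x) - ?I \<psi>) + 1/2 * t\<^sup>2 * D)) \<longlonglongrightarrow> t * l + 1/2 * t\<^sup>2 * D"
        by simp
      have "0 \<le> 1 / real (Suc n) + (t * (?I (\<lambda>x. grad (\<phi> n) x \<bullet> grad \<psi> x) - ?I \<psi>) + 1/2 * t\<^sup>2 * D)" for n
      proof -
        have "m \<le> ?J (\<lambda>x. 1 * \<phi> n x + t * \<psi> x)" by (intro m_le test_function_lincomb \<phi> \<psi>)
        also have "\<dots> = ?J (\<phi> n) + (t * (?I (\<lambda>x. grad (\<phi> n) x \<bullet> grad \<psi> x) - ?I \<psi>) + 1/2 * t\<^sup>2 * D)"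
          unfolding torsion_energy_lincomb[OF \<Omega>(1) \<phi> \<psi>] by (simp add: torsion_energy_def D_def algebra_simps)
        finally show ?thesis using J\<phi>[of n] by linarith
      qed
      then show "\<forall>\<^sub>F n in sequentially. 0 \<le> 1 / real (Suc n) + (t * (?I (\<lambda>x. grad (\<phi> n) x \<bullet> grad \<psi> x) - ?I \<psi>) + 1/2 * t\<^sup>2 * D)"
        by (rule always_eventually[OF allI])
    qed
    \<comment> \<open>The minimum of the quadratic would be at \<open>- l / D\<close>. Using
      \<open>D + 1\<close> avoids the case \<open>D = 0\<close> and still gives a negative value
      unless \<open>l = 0\<close>.\<close>
    from this[of "- l / (D + 1)"] have "0 \<le> (- l / (D + 1)) * l + 1/2 * (- l / (D + 1))\<^sup>2 * D" .
    moreover have "(- l / (D + 1)) * l + 1/2 * (- l / (D + 1))\<^sup>2 * D = - (l\<^sup>2 * (D + 2) / (2 * (D + 1)\<^sup>2))"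
      using D by (simp add: power2_eq_square divide_simps) (simp add: algebra_simps)
    ultimately have "l\<^sup>2 * (D + 2) / (2 * (D + 1)\<^sup>2) \<le> 0" by linarith
    then have "l = 0" using D by (auto simp: divide_le_0_iff mult_le_0_iff)
    then show ?thesis unfolding l_def by simp
  qed
  have "(LINT x|lebesgue_on \<Omega>. weak_grad \<Omega> w x \<bullet> weak_grad \<Omega> v x) = ?I v" if vH: "v \<in> H10 \<Omega>" for v
  proof -
    obtain h \<psi> where v: "square_integrable_on v \<Omega>" and h: "square_integrable_on h \<Omega>" and vh: "has_weak_gradient v h \<Omega>"
      and \<psi>: "\<And>n::nat. \<psi> n \<in> ?T" and lim: "(\<lambda>n. ?I (\<lambda>x. (norm (v x - \<psi> n x))\<^sup>2)) \<longlonglongrightarrow> 0"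
        "(\<lambda>n. ?I (\<lambda>x. (norm (h x - grad (\<psi> n) x))\<^sup>2)) \<longlonglongrightarrow> 0"
      using H10_E[OF \<Omega>(1) vH] by blast
    have mg: "g \<in> borel_measurable (lebesgue_on \<Omega>)" and mv: "weak_grad \<Omega> v \<in> borel_measurable (lebesgue_on \<Omega>)"
      using g weak_grad_square_integrable(1)[OF \<Omega>(1) vh h] unfolding square_integrable_on_def by blast+
    have "?I (\<lambda>x. weak_grad \<Omega> w x \<bullet> weak_grad \<Omega> v x) = ?I (\<lambda>x. g x \<bullet> weak_grad \<Omega> v x)"
      by (rule weak_grad_square_integrable(3)[OF \<Omega>(1) wH(2) g mv])
    also have "\<dots> = ?I (\<lambda>x. weak_grad \<Omega> v x \<bullet> g x)" by (simp add: inner_commute)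
    also have "\<dots> = ?I (\<lambda>x. h x \<bullet> g x)"
      by (rule weak_grad_square_integrable(3)[OF \<Omega>(1) vh h mg])
    also have "\<dots> = ?I v"
    proof (rule LIMSEQ_unique)
      show "(\<lambda>n. ?I (\<lambda>x. grad (\<psi> n) x \<bullet> g x)) \<longlonglongrightarrow> ?I (\<lambda>x. h x \<bullet> g x)"
        by (rule square_integrable_inner_tendsto[OF test_function_square_integrable(2)[OF \<Omega>(1) \<psi>] h g lim(2)])
      \<comment> \<open>The integral of \<open>v\<close> is its pairing with the constant 1, which
        is square integrable on a bounded domain; so the right-hand side of the equation is
        continuous too.\<close>
      have "(\<lambda>n. ?I (\<lambda>x. \<psi> n x \<bullet> 1)) \<longlonglongrightarrow> ?I (\<lambda>x. v x \<bullet> 1)"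
        by (rule square_integrable_inner_tendsto[OF test_function_square_integrable(1)[OF \<Omega>(1) \<psi>] v square_integrable_const[OF L] lim(1)])
      moreover have "?I (\<lambda>x. grad (\<psi> n) x \<bullet> g x) = ?I (\<lambda>x. \<psi> n x \<bullet> 1)" for n
        using EL[OF \<psi>[of n]] by (simp add: inner_commute)
      ultimately show "(\<lambda>n. ?I (\<lambda>x. grad (\<psi> n) x \<bullet> g x)) \<longlonglongrightarrow> ?I v" by simp
    qed
    finally show ?thesis .
  qed
  then show ?thesis using wH(1) unfolding is_torsion_function_def by blast
qed

text \<open>Testing the equation with \<open>w\<close> itself gives \<open>T\<close> as the integral
  of the squared gradient, hence the sign and the energy \<open>- T / 2\<close>. The energy bound
  for test functions reaches \<open>w\<close> along an approximating sequence, since energies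
  converge along it.\<close>

lemma torsional_rigidity_bounds:
  fixes \<Omega> :: "'a::euclidean_space set"
  assumes \<Omega>: "open \<Omega>" "bounded \<Omega>" "\<Omega> \<noteq> {}"
  shows "0 \<le> torsional_rigidity \<Omega>" "torsional_rigidity \<Omega> \<le> ball_torsion \<Omega>"
proof -
  note L = bounded_open_lmeasurable[OF \<Omega>(1,2)]
  let ?I = "\<lambda>h. LINT x|lebesgue_on \<Omega>. h x"
  define w where "w = (SOME w. is_torsion_function \<Omega> w)"
  have T: "torsional_rigidity \<Omega> = ?I w" unfolding torsional_rigidity_def w_def ..
  have "is_torsion_function \<Omega> w"
    unfolding w_def by (rule someI_ex[OF torsion_function_exists[OF \<Omega>]])
  then have wH: "w \<in> H10 \<Omega>" and ww: "?I (\<lambda>x. weak_grad \<Omega> w x \<bullet> weak_grad \<Omega> w x) = ?I w"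
    unfolding is_torsion_function_def by blast+
  obtain g \<phi> where w: "square_integrable_on w \<Omega>" and g: "square_integrable_on g \<Omega>" and wg: "has_weak_gradient w g \<Omega>"
    and \<phi>: "\<And>n::nat. \<phi> n \<in> test_functions \<Omega>" and lim: "(\<lambda>n. ?I (\<lambda>x. (norm (w x - \<phi> n x))\<^sup>2)) \<longlonglongrightarrow> 0"
      "(\<lambda>n. ?I (\<lambda>x. (norm (g x - grad (\<phi> n) x))\<^sup>2)) \<longlonglongrightarrow> 0"
    using H10_E[OF \<Omega>(1) wH] by blast
  have Tg: "?I w = ?I (\<lambda>x. (norm (g x))\<^sup>2)"
    using ww weak_grad_square_integrable(2)[OF \<Omega>(1) wg g] by (simp add: power2_norm_eq_inner)
  then show "0 \<le> torsional_rigidity \<Omega>" unfolding T by simp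
  have "(\<lambda>n. ?I (\<lambda>x. \<phi> n x \<bullet> 1)) \<longlonglongrightarrow> ?I (\<lambda>x. w x \<bullet> 1)"
    by (rule square_integrable_inner_tendsto[OF test_function_square_integrable(1)[OF \<Omega>(1) \<phi>] w square_integrable_const[OF L] lim(1)])
  then have l1: "(\<lambda>n. ?I (\<phi> n)) \<longlonglongrightarrow> ?I w" by simp
  have l2: "(\<lambda>n. ?I (\<lambda>x. (norm (grad (\<phi> n) x))\<^sup>2)) \<longlonglongrightarrow> ?I (\<lambda>x. (norm (g x))\<^sup>2)"
    by (rule square_integrable_norm_tendsto[OF test_function_square_integrable(2)[OF \<Omega>(1) \<phi>] g lim(2)])
  have "(\<lambda>n. torsion_energy \<Omega> (\<phi> n)) \<longlonglongrightarrow> 1/2 * ?I (\<lambda>x. (norm (g x))\<^sup>2) - ?I w"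
    unfolding torsion_energy_def by (intro tendsto_intros l1 l2)
  then have "- (1/2 * ball_torsion \<Omega>) \<le> 1/2 * ?I (\<lambda>x. (norm (g x))\<^sup>2) - ?I w"
    by (rule tendsto_lowerbound[OF _ _ sequentially_bot])
       (intro always_eventually allI torsion_energy_bound[OF \<Omega> \<phi>])
  then show "torsional_rigidity \<Omega> \<le> ball_torsion \<Omega>" unfolding T using Tg by simp
qed

text \<open>Both inequalities come from \<open>x = T / |\<Omega>|^((d+2)/d) \<le> 1 / K\<close>,
  because \<open>x powr (q - 1)\<close> is the quotient of \<open>F q\<close> and \<open>F 1\<close>
  and is antitone in \<open>x\<close> for \<open>q \<le> 1\<close> and monotone for
  \<open>q \<ge> 1\<close>. Multiplying by \<open>F 1\<close> preserves the order since the
  eigenvalue is nonnegative.\<close>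

lemma F_comparison:
  fixes \<Omega> :: "'a::euclidean_space set" and q :: real
  defines "K \<equiv> real DIM('a) * (real DIM('a) + 2) * omega TYPE('a) powr (2 / real DIM('a))"
  assumes \<Omega>: "\<Omega> \<in> convex_domains"
  shows "q \<le> 1 \<Longrightarrow> F 1 \<Omega> * K powr (1 - q) \<le> F q \<Omega>" "1 \<le> q \<Longrightarrow> F q \<Omega> \<le> F 1 \<Omega> * K powr (1 - q)"
proof -
  have \<Omega>': "open \<Omega>" "bounded \<Omega>" "\<Omega> \<noteq> {}" using \<Omega> unfolding convex_domains_def by auto
  define d where "d = real DIM('a)"
  define V where "V = measure lebesgue \<Omega>"
  define T where "T = torsional_rigidity \<Omega>"
  define l where "l = eigenvalue1 \<Omega>"
  have d: "0 < d" unfolding d_def by simp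
  have V: "0 < V"
    unfolding V_def using measure_lborel_open_pos[OF \<Omega>'] \<Omega>'(1) by (simp add: measure_completion)
  have "0 < omega TYPE('a)" 
    unfolding omega_def using content_ball_pos[of 1 "0::'a"] by (simp add: measure_completion)
  then have K: "0 < K" unfolding K_def d_def[symmetric] using d by simp
  have l: "0 \<le> l" unfolding l_def by (rule eigenvalue1_nonneg[OF \<Omega>'])
  have T: "0 \<le> T" "T \<le> V powr ((d + 2) / d) / K"
    using torsional_rigidity_bounds[OF \<Omega>'] unfolding T_def ball_torsion_def V_def K_def omega_def d_def by simp_all
  have Fq: "F q \<Omega> = l * T powr q / V powr ((d * q + 2 * q - 2) / d)" for q
    unfolding F_def l_def T_def V_def d_def ..
  have F1: "F 1 \<Omega> = l * T / V" unfolding Fq using T(1) V d by simp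
  have F1_nonneg: "0 \<le> F 1 \<Omega>" unfolding F1 using l T V by simp
  have "(q \<le> 1 \<longrightarrow> F 1 \<Omega> * K powr (1 - q) \<le> F q \<Omega>) \<and> (1 \<le> q \<longrightarrow> F q \<Omega> \<le> F 1 \<Omega> * K powr (1 - q))"
  proof (cases "T = 0")
    case True
    \<comment> \<open>For \<open>T = 0\<close> all terms vanish, as \<open>0 powr q = 0\<close>; the
      factorization in the other case splits powers of \<open>T\<close> and uses
      \<open>0 < T\<close>.\<close>
    then show ?thesis unfolding F1 by (simp add: Fq)
  next
    case False
    with T have T0: "0 < T" by simp
    define x where "x = T / V powr ((d + 2) / d)"
    have x: "0 < x" "x \<le> 1 / K"
      using T0 T(2) V K unfolding x_def by (auto simp: field_simps)
    have eq: "F q \<Omega> = F 1 \<Omega> * x powr (q - 1)"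
    proof -
      have "x powr (q - 1) = T powr (q - 1) / V powr ((d + 2) / d * (q - 1))"
        unfolding x_def using T0 V by (simp add: powr_divide powr_powr)
      moreover have "T * T powr (q - 1) = T powr q" using T0 by (simp add: powr_diff)
      moreover have "V * V powr ((d + 2) / d * (q - 1)) = V powr ((d * q + 2 * q - 2) / d)"
      proof -
        have "1 + (d + 2) / d * (q - 1) = (d * q + 2 * q - 2) / d" using d by (simp add: field_simps)
        moreover have "V * V powr ((d + 2) / d * (q - 1)) = V powr (1 + (d + 2) / d * (q - 1))"
          using V by (simp add: powr_add)
        ultimately show ?thesis by simp
      qed
      ultimately show ?thesis unfolding F1 Fq[of q] by (simp only: mult.assoc times_divide_times_eq)
    qed
    have Kq: "(1 / K) powr (q - 1) = K powr (1 - q)"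
      using K by (simp add: powr_divide powr_minus_divide[symmetric])
    have "K powr (1 - q) \<le> x powr (q - 1)" if "q \<le> 1"
      unfolding Kq[symmetric] by (rule powr_mono2') (use x that in auto)
    moreover have "x powr (q - 1) \<le> K powr (1 - q)" if "1 \<le> q"
      unfolding Kq[symmetric] by (rule powr_mono2) (use x that in auto)
    ultimately show ?thesis
      unfolding eq using F1_nonneg by (auto intro: mult_left_mono)
  qed
  then show "q \<le> 1 \<Longrightarrow> F 1 \<Omega> * K powr (1 - q) \<le> F q \<Omega>" "1 \<le> q \<Longrightarrow> F q \<Omega> \<le> F 1 \<Omega> * K powr (1 - q)"
    by blast+
qed

theorem proposition4p1:
  fixes q :: real
  assumes "q > 0"
  shows "(q < 1 \<longrightarrow>
      (INF \<Omega>\<in>(convex_domains :: (real ^ 'n) set set). ereal (F q \<Omega>)) \<ge>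
      C_minus TYPE(real ^ 'n) *
        ereal ((real CARD('n) * (real CARD('n) + 2) * omega TYPE(real ^ 'n) powr (2 / real CARD('n)))
          powr (1 - q)))
    \<and> (q > 1 \<longrightarrow>
      (SUP \<Omega>\<in>(convex_domains :: (real ^ 'n) set set). ereal (F q \<Omega>)) \<le>
      C_plus TYPE(real ^ 'n) *
        ereal ((real CARD('n) * (real CARD('n) + 2) * omega TYPE(real ^ 'n) powr (2 / real CARD('n)))
          powr (1 - q)))"
proof (intro conjI impI)
  let ?K = "(real CARD('n) * (real CARD('n) + 2) * omega TYPE(real ^ 'n) powr (2 / real CARD('n))) powr (1 - q)"
  have D: "DIM(real ^ 'n) = CARD('n)" by simp
  note cmp = F_comparison[where 'a="real ^ 'n", unfolded D]
  show "C_minus TYPE(real ^ 'n) * ereal ?K \<le> (INF \<Omega>\<in>(convex_domains :: (real ^ 'n) set set). ereal (F q \<Omega>))" if "q < 1"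
  proof (rule INF_greatest)
    fix \<Omega> :: "(real ^ 'n) set" assume \<Omega>: "\<Omega> \<in> convex_domains"
    \<comment> \<open>Multiplication by a nonnegative factor is monotone in the extended reals, so
      infinite values of the constants, in particular of \<open>C_plus\<close> below, require no
      separate case.\<close>
    have "C_minus TYPE(real ^ 'n) * ereal ?K \<le> ereal (F 1 \<Omega>) * ereal ?K"
      unfolding C_minus_def by (intro ereal_mult_right_mono INF_lower \<Omega>) simp
    also have "\<dots> \<le> ereal (F q \<Omega>)" using cmp(1)[OF \<Omega>, of q] that by simp
    finally show "C_minus TYPE(real ^ 'n) * ereal ?K \<le> ereal (F q \<Omega>)" .
  qed
  show "(SUP \<Omega>\<in>(convex_domains :: (real ^ 'n) set set). ereal (F q \<Omega>)) \<le> C_plus TYPE(real ^ 'n) * ereal ?K" if "1 < q"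
  proof (rule SUP_least)
    fix \<Omega> :: "(real ^ 'n) set" assume \<Omega>: "\<Omega> \<in> convex_domains"
    have "ereal (F q \<Omega>) \<le> ereal (F 1 \<Omega>) * ereal ?K" using cmp(2)[OF \<Omega>, of q] that by simp
    also have "\<dots> \<le> C_plus TYPE(real ^ 'n) * ereal ?K"
      unfolding C_plus_def by (intro ereal_mult_right_mono SUP_upper \<Omega>) simp
    finally show "ereal (F q \<Omega>) \<le> C_plus TYPE(real ^ 'n) * ereal ?K" .
  qed
qed

end
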